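(* For a triangulation $\sigma$ of a polygon $P$ with vertices $P_1,\dots,P_n$ ($n\ge3$), let $T_\sigma=\bigoplus_{(P_s,P_t)\in\sigma,\ s<t}(s,t)$, the sum over all sides of $P$ and all diagonals of $\sigma$. Then $\sigma\mapsto T_\sigma$ is a bijection between the set of triangulations of $P$ and the set of isomorphism classes of basic cluster tilting objects of $\mathrm{CM}(\Lambda)$.
   Context: Let $K$ be a field, $R=K[x]$. $P$ has vertices $P_1,\dots,P_n$ labelled counterclockwise; a triangulation is a maximal set of pairwise non-crossing diagonals (segments between vertices in the interior of $P$; crossing = sharing an interior point); $(P_s,P_t)$ denotes the side or diagonal joining $P_s,P_t$. $\Lambda$ is the $R$-order in $M_n(K(x))$ whose $(i,j)$ entry ranges over $x^{c_{ij}}R$, where $c_{ij}=0$ for $i\le j$ except $c_{1n}=-1$, $c_{ij}=1$ if $i=j+1$, $c_{ij}=2$ if $i\ge j+2$. A Cohen–Macaulay $\Lambda$-module is a finitely generated left $\Lambda$-module which is free as an $R$-module; $\mathrm{CM}(\Lambda)$ is the full exact subcategory of $\operatorname{mod}\Lambda$ of such modules. For $1\le s<t\le n$, $(s,t)$ is the module of column vectors $[R^{s}\,(x)^{t-s}\,(x^2)^{n-t}]^t\subset K(x)^n$ ($s$ entries in $R$, $t-s$ in $xR$, $n-t$ in $x^2R$). An object $T$ of $\mathrm{CM}(\Lambda)$ is cluster tilting if $\operatorname{add}T=\{Z\mid \operatorname{Ext}^1_\Lambda(T,Z)=0\}=\{Z\mid\operatorname{Ext}^1_\Lambda(Z,T)=0\}$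 (within $\mathrm{CM}(\Lambda)$), where $\operatorname{add}T$ is the class of finite direct sums of direct summands of $T$; basic means pairwise non-isomorphic indecomposable summands. *)

theory Defs
  imports "HOL-Computational_Algebra.Polynomial" "HOL-Computational_Algebra.Fraction_Field"
    "HOL-Library.Product_Lexorder"
begin

text \<open>K(x) is modelled as the fraction field of K[x]; R = K[x] embeds via p |-> Fract p 1.
  Matrices are functions nat => nat => K(x), only the entries with indices in 1..n matter.\<close>

definition embR :: "'k::field poly \<Rightarrow> 'k poly fract" where
  "embR p = Fract p 1"

definition xvar :: "'k::field poly fract" where
  "xvar = Fract [:0, 1:] 1"

definition xR :: "int \<Rightarrow> 'k::field poly fract \<Rightarrow> bool" where
  "xR c r \<longleftrightarrow> (\<exists>p. r = embR p * xvar powi c)"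

definition cexp :: "nat \<Rightarrow> nat \<Rightarrow> nat \<Rightarrow> int" where
  "cexp n i j = (if i \<le> j then (if i = 1 \<and> j = n then -1 else 0)
                 else if i = j + 1 then 1 else 2)"

type_synonym 'k kmat = "nat \<Rightarrow> nat \<Rightarrow> 'k poly fract"

definition Lam :: "nat \<Rightarrow> 'k::field kmat set" where
  "Lam n = {A. (\<forall>i j. (i \<notin> {1..n} \<or> j \<notin> {1..n}) \<longrightarrow> A i j = 0) \<and>
               (\<forall>i\<in>{1..n}. \<forall>j\<in>{1..n}. xR (cexp n i j) (A i j))}"

definition matmul :: "nat \<Rightarrow> 'k::field kmat \<Rightarrow> 'k kmat \<Rightarrow> 'k kmat" where
  "matmul n A B = (\<lambda>i j. \<Sum>k\<in>{1..n}. A i k * B k j)"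

definition matadd :: "'k::field kmat \<Rightarrow> 'k kmat \<Rightarrow> 'k kmat" where
  "matadd A B = (\<lambda>i j. A i j + B i j)"

definition idm :: "nat \<Rightarrow> 'k::field kmat" where
  "idm n = (\<lambda>i j. if i = j \<and> i \<in> {1..n} then 1 else 0)"

text \<open>R acts on Lambda-modules through the central scalar matrices p * identity.\<close>
definition scal :: "nat \<Rightarrow> 'k::field poly \<Rightarrow> 'k kmat" where
  "scal n p = (\<lambda>i j. if i = j \<and> i \<in> {1..n} then embR p else 0)"

record ('r, 'a) lmod =
  mcar :: "'a set"
  mplus :: "'a \<Rightarrow> 'a \<Rightarrow> 'a"
  mzero :: "'a"
  mact :: "(nat \<Rightarrow> nat \<Rightarrow> 'r) \<Rightarrow> 'a \<Rightarrow> 'a"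

definition is_lmod :: "nat \<Rightarrow> ('k::field poly fract, 'a) lmod \<Rightarrow> bool" where
  "is_lmod n M \<longleftrightarrow>
     mzero M \<in> mcar M \<and>
     (\<forall>x\<in>mcar M. \<forall>y\<in>mcar M. mplus M x y \<in> mcar M) \<and>
     (\<forall>x\<in>mcar M. \<forall>y\<in>mcar M. \<forall>z\<in>mcar M. mplus M (mplus M x y) z = mplus M x (mplus M y z)) \<and>
     (\<forall>x\<in>mcar M. \<forall>y\<in>mcar M. mplus M x y = mplus M y x) \<and>
     (\<forall>x\<in>mcar M. mplus M (mzero M) x = x) \<and>
     (\<forall>x\<in>mcar M. \<exists>y\<in>mcar M. mplus M x y = mzero M) \<and>
     (\<forall>A\<in>Lam n. \<forall>x\<in>mcar M. mact M A x \<in> mcar M) \<and>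
     (\<forall>A\<in>Lam n. \<forall>x\<in>mcar M. \<forall>y\<in>mcar M. mact M A (mplus M x y) = mplus M (mact M A x) (mact M A y)) \<and>
     (\<forall>A\<in>Lam n. \<forall>B\<in>Lam n. \<forall>x\<in>mcar M. mact M (matadd A B) x = mplus M (mact M A x) (mact M B x)) \<and>
     (\<forall>A\<in>Lam n. \<forall>B\<in>Lam n. \<forall>x\<in>mcar M. mact M (matmul n A B) x = mact M A (mact M B x)) \<and>
     (\<forall>x\<in>mcar M. mact M (idm n) x = x)"

definition lincomb :: "('r, 'a) lmod \<Rightarrow> ((nat \<Rightarrow> nat \<Rightarrow> 'r) \<times> 'a) list \<Rightarrow> 'a" where
  "lincomb M ps = foldr (\<lambda>(A, g) acc. mplus M (mact M A g) acc) ps (mzero M)"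

definition fin_gen :: "nat \<Rightarrow> ('k::field poly fract, 'a) lmod \<Rightarrow> bool" where
  "fin_gen n M \<longleftrightarrow> (\<exists>gs. set gs \<subseteq> mcar M \<and>
     (\<forall>m\<in>mcar M. \<exists>As. length As = length gs \<and> set As \<subseteq> Lam n \<and> m = lincomb M (zip As gs)))"

text \<open>free as an R-module (a finitely generated Lambda-module can only have finite R-bases)\<close>
definition R_free :: "nat \<Rightarrow> ('k::field poly fract, 'a) lmod \<Rightarrow> bool" where
  "R_free n M \<longleftrightarrow> (\<exists>bs. set bs \<subseteq> mcar M \<and>
     (\<forall>m\<in>mcar M. \<exists>!ps. length ps = length bs \<and> m = lincomb M (zip (map (scal n) ps) bs)))"

definition CM :: "nat \<Rightarrow> ('k::field poly fract, 'a) lmod \<Rightarrow> bool" where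
  "CM n M \<longleftrightarrow> is_lmod n M \<and> fin_gen n M \<and> R_free n M"

definition hom :: "nat \<Rightarrow> ('k::field poly fract, 'a) lmod \<Rightarrow> ('k poly fract, 'b) lmod \<Rightarrow> ('a \<Rightarrow> 'b) \<Rightarrow> bool" where
  "hom n M N f \<longleftrightarrow> (\<forall>x\<in>mcar M. f x \<in> mcar N) \<and>
     (\<forall>x\<in>mcar M. \<forall>y\<in>mcar M. f (mplus M x y) = mplus N (f x) (f y)) \<and>
     (\<forall>A\<in>Lam n. \<forall>x\<in>mcar M. f (mact M A x) = mact N A (f x))"

definition iso :: "nat \<Rightarrow> ('k::field poly fract, 'a) lmod \<Rightarrow> ('k poly fract, 'b) lmod \<Rightarrow> bool" where
  "iso n M N \<longleftrightarrow> (\<exists>f. hom n M N f \<and> bij_betw f (mcar M) (mcar N))"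

definition ses :: "nat \<Rightarrow> ('k::field poly fract, 'z) lmod \<Rightarrow> ('k poly fract, 'e) lmod \<Rightarrow> ('k poly fract, 't) lmod
                    \<Rightarrow> ('z \<Rightarrow> 'e) \<Rightarrow> ('e \<Rightarrow> 't) \<Rightarrow> bool" where
  "ses n Z E T f g \<longleftrightarrow> hom n Z E f \<and> hom n E T g \<and> inj_on f (mcar Z) \<and> g ` mcar E = mcar T \<and>
     f ` mcar Z = {e \<in> mcar E. g e = mzero T}"

text \<open>Ext^1_Lambda(T, Z) = 0: every extension of T by Z in mod Lambda splits.  Every such
  extension is (as a set) in bijection with Z x T, so it suffices to let the middle term range
  over modules whose carrier lives in the type 'z x 't.\<close>
definition ext1_zero :: "nat \<Rightarrow> ('k::field poly fract, 't) lmod \<Rightarrow> ('k poly fract, 'z) lmod \<Rightarrow> bool" where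
  "ext1_zero n T Z \<longleftrightarrow>
     (\<forall>(E :: ('k poly fract, 'z \<times> 't) lmod) f g. is_lmod n E \<and> ses n Z E T f g \<longrightarrow>
        (\<exists>s. hom n T E s \<and> (\<forall>x\<in>mcar T. g (s x) = x)))"

definition dsum2 :: "('r, 'a) lmod \<Rightarrow> ('r, 'b) lmod \<Rightarrow> ('r, 'a \<times> 'b) lmod" where
  "dsum2 M N = \<lparr> mcar = mcar M \<times> mcar N,
      mplus = (\<lambda>x y. (mplus M (fst x) (fst y), mplus N (snd x) (snd y))),
      mzero = (mzero M, mzero N),
      mact = (\<lambda>A x. (mact M A (fst x), mact N A (snd x))) \<rparr>"

definition dsum_list :: "('r, 'a) lmod list \<Rightarrow> ('r, nat \<Rightarrow> 'a) lmod" where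
  "dsum_list Ms = \<lparr> mcar = {f. (\<forall>i<length Ms. f i \<in> mcar (Ms ! i)) \<and> (\<forall>i\<ge>length Ms. f i = undefined)},
      mplus = (\<lambda>f g i. if i < length Ms then mplus (Ms ! i) (f i) (g i) else undefined),
      mzero = (\<lambda>i. if i < length Ms then mzero (Ms ! i) else undefined),
      mact = (\<lambda>A f i. if i < length Ms then mact (Ms ! i) A (f i) else undefined) \<rparr>"

text \<open>Universe type for auxiliary modules: every Cohen--Macaulay module (free of finite rank over
  K[x]) and every direct summand of one has a carrier injecting into nat => K(x), so iso classes
  are all represented there.\<close>
type_synonym 'k umod = "('k poly fract, nat \<Rightarrow> 'k poly fract) lmod"

definition summand :: "nat \<Rightarrow> ('k::field poly fract, 'a) lmod \<Rightarrow> ('k poly fract, 't) lmod \<Rightarrow> bool" where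
  "summand n X T \<longleftrightarrow> is_lmod n X \<and>
     (\<exists>Y :: ('k poly fract, 't) lmod. is_lmod n Y \<and> iso n (dsum2 X Y) T)"

definition in_add :: "nat \<Rightarrow> ('k::field poly fract, 't) lmod \<Rightarrow> ('k poly fract, 'z) lmod \<Rightarrow> bool" where
  "in_add n T Z \<longleftrightarrow>
     (\<exists>Xs :: 'k umod list. (\<forall>X\<in>set Xs. summand n X T) \<and> iso n (dsum_list Xs) Z)"

definition indec :: "nat \<Rightarrow> ('k::field poly fract, 'a) lmod \<Rightarrow> bool" where
  "indec n X \<longleftrightarrow> is_lmod n X \<and> mcar X \<noteq> {mzero X} \<and>
     (\<forall>(Y1 :: ('k poly fract, 'a) lmod) (Y2 :: ('k poly fract, 'a) lmod). is_lmod n Y1 \<and> is_lmod n Y2 \<and> iso n (dsum2 Y1 Y2) X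
         \<longrightarrow> mcar Y1 = {mzero Y1} \<or> mcar Y2 = {mzero Y2})"

definition basic :: "nat \<Rightarrow> ('k::field poly fract, 't) lmod \<Rightarrow> bool" where
  "basic n T \<longleftrightarrow> (\<exists>Xs :: 'k umod list. (\<forall>X\<in>set Xs. indec n X) \<and>
     (\<forall>i<length Xs. \<forall>j<length Xs. i \<noteq> j \<longrightarrow> \<not> iso n (Xs ! i) (Xs ! j)) \<and>
     iso n (dsum_list Xs) T)"

definition cluster_tilting :: "nat \<Rightarrow> ('k::field poly fract, 't) lmod \<Rightarrow> bool" where
  "cluster_tilting n T \<longleftrightarrow> CM n T \<and>
     (\<forall>Z :: 'k umod. CM n Z \<longrightarrow>
        (in_add n T Z \<longleftrightarrow> ext1_zero n T Z) \<and> (in_add n T Z \<longleftrightarrow> ext1_zero n Z T))"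

definition stmod :: "nat \<Rightarrow> nat \<Rightarrow> nat \<Rightarrow> 'k::field umod" where
  "stmod n s t = \<lparr> mcar = {v. (\<forall>i. i \<notin> {1..n} \<longrightarrow> v i = 0) \<and>
         (\<forall>i\<in>{1..n}. xR (if i \<le> s then 0 else if i \<le> t then 1 else 2) (v i))},
      mplus = (\<lambda>v w i. v i + w i),
      mzero = (\<lambda>i. 0),
      mact = (\<lambda>A v i. if i \<in> {1..n} then (\<Sum>k\<in>{1..n}. A i k * v k) else 0) \<rparr>"

definition sides :: "nat \<Rightarrow> (nat \<times> nat) set" where
  "sides n = {(i, i + 1) | i. 1 \<le> i \<and> i < n} \<union> {(1, n)}"

definition diagonals :: "nat \<Rightarrow> (nat \<times> nat) set" where
  "diagonals n = {(s, t). 1 \<le> s \<and> s + 2 \<le> t \<and> t \<le> n \<and> (s, t) \<noteq> (1, n)}"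

definition crosses :: "nat \<times> nat \<Rightarrow> nat \<times> nat \<Rightarrow> bool" where
  "crosses d e \<longleftrightarrow> (fst d < fst e \<and> fst e < snd d \<and> snd d < snd e) \<or>
                     (fst e < fst d \<and> fst d < snd e \<and> snd e < snd d)"

definition triangulation :: "nat \<Rightarrow> (nat \<times> nat) set \<Rightarrow> bool" where
  "triangulation n \<sigma> \<longleftrightarrow> \<sigma> \<subseteq> diagonals n \<and> (\<forall>d\<in>\<sigma>. \<forall>e\<in>\<sigma>. \<not> crosses d e) \<and>
     (\<forall>d\<in>diagonals n - \<sigma>. \<exists>e\<in>\<sigma>. crosses d e)"

definition Tsig :: "nat \<Rightarrow> (nat \<times> nat) set \<Rightarrow> ('k::field poly fract, nat \<Rightarrow> nat \<Rightarrow> 'k poly fract) lmod" where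
  "Tsig n \<sigma> = dsum_list (map (\<lambda>(s, t). stmod n s t) (sorted_list_of_set (sides n \<union> \<sigma>)))"

end

theory Submission
  imports Defs
begin

text \<open>A torsion-free module over the order amounts to a free \<open>K[x]\<close>-module \<open>L\<close> (its first component)
  with a chain \<open>L = U\<^sub>1 \<supseteq> \<dots> \<supseteq> U\<^sub>n\<close> such that \<open>x U\<^sub>i \<subseteq> U\<^sub>i\<^sub>+\<^sub>1\<close> and \<open>x\<^sup>2 L \<subseteq> U\<^sub>n \<subseteq> x L\<close>. A basis of
  \<open>L\<close> lying as deep as possible in the chain is adapted to every \<open>U\<^sub>i\<close>, so each Cohen--Macaulay module is
  a direct sum of modules \<open>(s, t)\<close>. In the chain picture an extension of \<open>(s, t)\<close> by \<open>(u, v)\<close>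
  can fail to split only when the two segments cross, and then an explicit cocycle does not split.
  Hence a cluster tilting object is given by a family of pairs that consists of exactly the pairs
  crossing none of its members: the sides and a triangulation.\<close>

text \<open>A basis vector \<open>y\<close> of \<open>L\<close> yields the pair
  \<open>(s, t)\<close> of the last positions in the chain that contain \<open>y\<close> and
  \<open>x y\<close>. The corner entries in x^(-1) R are the source of U_n \<subseteq> x L, and this
  forces \<open>s < t\<close>. Depth is the sum of both positions: an exchange improving one of them
  is arranged so that the other does not drop. Only nonzero constants are units of K[x], so a basis
  vector is exchanged only for a combination in which its coefficient is a constant. This suffices,
  because x^2 L lies in every member of the chain and coefficients matter only modulo x^2. As K[x]
  is not local, summands are recognised through maps modulo x. A section over \<open>(s, t)\<close>
  amounts to one element \<open>y\<close> in the s-th submodule with \<open>x y\<close> in the t-th.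
  The obstruction is an element of \<open>Z\<close> that must be written as \<open>x p + q\<close>
  with \<open>p\<close> in its s-th and \<open>q\<close> in its t-th submodule, a question about
  exponents of x. For crossing pairs the cocycle is the commutator with a diagonal matrix over K(x)
  supported on the rows after \<open>u\<close> up to \<open>v\<close>.\<close>

section \<open>The embedding of K[x] into K(x) and divisibility by powers of x\<close>

lemma embR_0 [simp]: "embR 0 = 0"
  by (simp add: embR_def Zero_fract_def)

lemma embR_1 [simp]: "embR 1 = 1"
  by (simp add: embR_def One_fract_def)

lemma embR_add: "embR (p + q) = embR p + embR q"
  by (simp add: embR_def)

lemma embR_mult: "embR (p * q) = embR p * embR q"
  by (simp add: embR_def)

lemma embR_power: "embR (p ^ m) = embR p ^ m"
  by (induction m) (simp_all add: embR_mult)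

lemma embR_minus: "embR (- p) = - embR p"
  by (simp add: embR_def)

lemma embR_sum: "embR (\<Sum>j\<in>A. f j) = (\<Sum>j\<in>A. embR (f j))"
  by (induction A rule: infinite_finite_induct) (simp_all add: embR_add)

lemma embR_eq_iff [simp]: "embR p = embR q \<longleftrightarrow> p = q"
  by (simp add: embR_def eq_fract)

lemma embR_eq_0_iff [simp]: "embR p = 0 \<longleftrightarrow> p = 0"
  using embR_eq_iff[of p 0] by (simp del: embR_eq_iff)

abbreviation Xp :: "'k::field poly" where "Xp \<equiv> [:0, 1:]"

lemma embR_Xp: "embR Xp = xvar"
  by (simp add: embR_def xvar_def)

lemma xvar_nonzero [simp]: "xvar \<noteq> 0"
  using embR_eq_0_iff[of Xp] by (simp add: embR_Xp)

lemma xR_0 [simp]: "xR c 0"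
  unfolding xR_def by (rule exI[of _ 0]) simp

lemma xR_embR [simp]: "xR 0 (embR p)"
  unfolding xR_def by (rule exI[of _ p]) simp

lemma xR_0_iff: "xR 0 r \<longleftrightarrow> (\<exists>p. r = embR p)"
  by (simp add: xR_def)

lemma xR_1 [simp]: "xR 0 1"
  using xR_embR[of 1] by simp

lemma xR_powi [simp]: "xR c (xvar powi c)"
  unfolding xR_def by (rule exI[of _ 1]) simp

lemma xR_add: "xR c r \<Longrightarrow> xR c s \<Longrightarrow> xR c (r + s)"
  unfolding xR_def by (metis distrib_right embR_add)

lemma xR_mult: "xR c r \<Longrightarrow> xR d s \<Longrightarrow> xR (c + d) (r * s)"
proof -
  assume "xR c r" "xR d s"
  then obtain p q where "r = embR p * xvar powi c" "s = embR q * xvar powi d"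
    unfolding xR_def by blast
  then have "r * s = embR (p * q) * xvar powi (c + d)"
    by (simp add: embR_mult power_int_add)
  then show ?thesis unfolding xR_def by blast
qed

lemma xR_mult_emb: "xR c r \<Longrightarrow> xR c (embR p * r)"
  using xR_mult[of 0 "embR p" c r] by simp

lemma xR_minus: "xR c r \<Longrightarrow> xR c (- r)"
  using xR_mult_emb[of c r "- 1"] by (simp add: embR_minus)

lemma xR_diff: "xR c r \<Longrightarrow> xR c s \<Longrightarrow> xR c (r - s)"
  using xR_add[of c r "- s"] xR_minus[of c s] by simp

lemma xR_sum: "(\<And>j. j \<in> A \<Longrightarrow> xR c (f j)) \<Longrightarrow> xR c (\<Sum>j\<in>A. f j)"
  by (induction A rule: infinite_finite_induct) (auto intro: xR_add)

lemma xR_mono: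
  assumes "xR c r" "d \<le> c"
  shows "xR d r"
proof -
  from assms(1) obtain p where p: "r = embR p * xvar powi c"
    unfolding xR_def by blast
  have "xvar powi c = xvar ^ nat (c - d) * xvar powi d"
  proof -
    have "xvar powi c = xvar powi (int (nat (c - d)) + d)" using assms(2) by simp
    then show ?thesis by (simp only: power_int_add xvar_nonzero power_int_of_nat simp_thms)
  qed
  also have "xvar ^ nat (c - d) = embR (Xp ^ nat (c - d))"
    by (simp add: embR_power embR_Xp)
  finally have e: "xvar powi c = embR (Xp ^ nat (c - d)) * xvar powi d" .
  have "r = embR (p * Xp ^ nat (c - d)) * xvar powi d"
    unfolding p e embR_mult by (simp only: mult.assoc)
  then show ?thesis unfolding xR_def by blast
qed

lemma xR_shift: "xR c (r * xvar powi d) \<longleftrightarrow> xR (c - d) r"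
proof
  assume "xR c (r * xvar powi d)"
  then have "xR (c + (- d)) (r * xvar powi d * xvar powi (- d))"
    by (intro xR_mult xR_powi)
  then show "xR (c - d) r"
    by (simp add: mult.assoc power_int_add[symmetric])
next
  assume "xR (c - d) r"
  then have "xR (c - d + d) (r * xvar powi d)"
    by (intro xR_mult xR_powi)
  then show "xR c (r * xvar powi d)" by simp
qed

lemma xR_embR_pow: "xR (int e) (embR p) \<longleftrightarrow> Xp ^ e dvd p"
proof -
  have "xR (int e) (embR p) \<longleftrightarrow> (\<exists>q. embR p = embR (q * Xp ^ e))"
    by (simp add: xR_def embR_mult embR_power embR_Xp)
  also have "\<dots> \<longleftrightarrow> Xp ^ e dvd p"
    by (auto simp: dvd_def mult.commute)
  finally show ?thesis .
qed

lemma coeff_0_iff_Xp_dvd: "coeff p 0 = 0 \<longleftrightarrow> Xp dvd p"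
  by (simp add: dvd_iff_poly_eq_0 poly_0_coeff_0)

lemma xR_1_embR: "xR 1 (embR p) \<longleftrightarrow> coeff p 0 = 0"
  using xR_embR_pow[of 1 p] by (simp add: coeff_0_iff_Xp_dvd)

lemma not_xR_1_1 [simp]: "\<not> xR 1 1"
  using xR_1_embR[of 1] by simp

text \<open>The assumptions on \<open>r\<close> say that it is a polynomial with nonzero constant
  term, so the product has x-order exactly \<open>d\<close>.\<close>

lemma xR_powi_le:
  assumes "xR c (r * xvar powi d)" "xR 0 r" "\<not> xR 1 r"
  shows "c \<le> d"
proof (rule ccontr)
  assume "\<not> c \<le> d"
  then show False
    using assms xR_mono[of "c - d" r 1] by (simp add: xR_shift)
qed

text \<open>Coordinates of module elements are fractions, whereas the abstract modules below take
  polynomial scalars. This inverse of \<open>embR\<close> translates between the two and is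
  meaningful only under \<open>xR 0 r\<close>.\<close>

definition unR :: "'k::field poly fract \<Rightarrow> 'k poly" where
  "unR r = (THE p. embR p = r)"

lemma unR_embR [simp]: "unR (embR p) = p"
  by (simp add: unR_def)

lemma embR_unR: "xR 0 r \<Longrightarrow> embR (unR r) = r"
  by (auto simp: xR_0_iff)

lemma unR_0 [simp]: "unR 0 = 0"
  using unR_embR[of 0] by simp

lemma unR_add: "xR 0 r \<Longrightarrow> xR 0 s \<Longrightarrow> unR (r + s) = unR r + unR s"
  by (auto simp: xR_0_iff simp flip: embR_add)

section \<open>Modules over the polynomial ring on an explicit carrier\<close>

text \<open>The modules live on an explicit carrier with addition as a parameter, so type class sums
  do not apply to them. Coefficients and generators are functions, of which only the values below
  the length matter.\<close>

primrec lc :: "('a \<Rightarrow> 'a \<Rightarrow> 'a) \<Rightarrow> 'a \<Rightarrow> ('r \<Rightarrow> 'a \<Rightarrow> 'a) \<Rightarrow> (nat \<Rightarrow> 'r) \<Rightarrow> (nat \<Rightarrow> 'a) \<Rightarrow> nat \<Rightarrow> 'a" where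
  "lc add zero sm a b 0 = zero"
| "lc add zero sm a b (Suc r) = add (lc add zero sm a b r) (sm (a r) (b r))"

locale rmod =
  fixes C :: "'a set" and add :: "'a \<Rightarrow> 'a \<Rightarrow> 'a" (infixl "\<oplus>" 65) and zero :: 'a ("\<zero>")
    and sm :: "'k::field poly \<Rightarrow> 'a \<Rightarrow> 'a" (infixr "\<odot>" 70)
  assumes zero_closed [simp]: "\<zero> \<in> C"
    and add_closed [simp]: "x \<in> C \<Longrightarrow> y \<in> C \<Longrightarrow> x \<oplus> y \<in> C"
    and assoc: "x \<in> C \<Longrightarrow> y \<in> C \<Longrightarrow> z \<in> C \<Longrightarrow> (x \<oplus> y) \<oplus> z = x \<oplus> (y \<oplus> z)"
    and comm: "x \<in> C \<Longrightarrow> y \<in> C \<Longrightarrow> x \<oplus> y = y \<oplus> x"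
    and zero_left [simp]: "x \<in> C \<Longrightarrow> \<zero> \<oplus> x = x"
    and inverse_ex: "x \<in> C \<Longrightarrow> \<exists>y\<in>C. x \<oplus> y = \<zero>"
    and sm_closed [simp]: "x \<in> C \<Longrightarrow> p \<odot> x \<in> C"
    and sm_add_right: "x \<in> C \<Longrightarrow> y \<in> C \<Longrightarrow> p \<odot> (x \<oplus> y) = (p \<odot> x) \<oplus> (p \<odot> y)"
    and sm_add_left: "x \<in> C \<Longrightarrow> (p + q) \<odot> x = (p \<odot> x) \<oplus> (q \<odot> x)"
    and sm_mult: "x \<in> C \<Longrightarrow> (p * q) \<odot> x = p \<odot> q \<odot> x"
    and sm_one [simp]: "x \<in> C \<Longrightarrow> 1 \<odot> x = x"
begin

abbreviation lcomb ("\<Sigma>") where "lcomb \<equiv> lc add zero sm"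

lemma left_comm: "x \<in> C \<Longrightarrow> y \<in> C \<Longrightarrow> z \<in> C \<Longrightarrow> x \<oplus> (y \<oplus> z) = y \<oplus> (x \<oplus> z)"
  by (metis assoc comm)

lemmas ac = assoc comm left_comm

lemma zero_right [simp]: "x \<in> C \<Longrightarrow> x \<oplus> \<zero> = x"
  using comm[of x \<zero>] by simp

lemma cancel: "x \<in> C \<Longrightarrow> y \<in> C \<Longrightarrow> z \<in> C \<Longrightarrow> x \<oplus> y = x \<oplus> z \<longleftrightarrow> y = z"
  by (metis assoc comm inverse_ex zero_left)

lemma sm_zero_left [simp]: "x \<in> C \<Longrightarrow> 0 \<odot> x = \<zero>"
  using sm_add_left[of x 0 0] cancel[of "0 \<odot> x" "0 \<odot> x" \<zero>] by simp

lemma sm_zero_right [simp]: "p \<odot> \<zero> = \<zero>"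
  using sm_add_right[of \<zero> \<zero> p] cancel[of "p \<odot> \<zero>" "p \<odot> \<zero>" \<zero>] by simp

lemma add_neg [simp]: "x \<in> C \<Longrightarrow> x \<oplus> ((-1) \<odot> x) = \<zero>"
  using sm_add_left[of x 1 "-1"] by simp

lemma neg_eq_iff: "x \<in> C \<Longrightarrow> y \<in> C \<Longrightarrow> x \<oplus> ((-1) \<odot> y) = \<zero> \<longleftrightarrow> x = y"
  by (metis add_neg cancel comm sm_closed)

lemma lc_closed [simp]: "(\<And>j. j < r \<Longrightarrow> b j \<in> C) \<Longrightarrow> \<Sigma> a b r \<in> C"
  by (induction r) simp_all

lemma lc_cong: "(\<And>j. j < r \<Longrightarrow> a j = a' j) \<Longrightarrow> (\<And>j. j < r \<Longrightarrow> b j = b' j) \<Longrightarrow> \<Sigma> a b r = \<Sigma> a' b' r"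
  by (induction r) simp_all

lemma lc_add: "(\<And>j. j < r \<Longrightarrow> b j \<in> C) \<Longrightarrow> \<Sigma> (\<lambda>j. a j + a' j) b r = \<Sigma> a b r \<oplus> \<Sigma> a' b r"
  by (induction r) (simp_all add: sm_add_left ac)

lemma lc_scale: "(\<And>j. j < r \<Longrightarrow> b j \<in> C) \<Longrightarrow> \<Sigma> (\<lambda>j. p * a j) b r = p \<odot> \<Sigma> a b r"
  by (induction r) (simp_all add: sm_add_right sm_mult)

lemma lc_zero: "(\<And>j. j < r \<Longrightarrow> b j \<in> C) \<Longrightarrow> (\<And>j. j < r \<Longrightarrow> a j \<odot> b j = \<zero>) \<Longrightarrow> \<Sigma> a b r = \<zero>"
  by (induction r) simp_all

lemma lc_split: "(\<And>j. j < r \<Longrightarrow> b j \<in> C) \<Longrightarrow> k < r \<Longrightarrow> \<Sigma> a b r = \<Sigma> (a(k := 0)) b r \<oplus> (a k \<odot> b k)"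
proof (induction r)
  case (Suc r)
  show ?case
  proof (cases "k = r")
    case True
    have "\<Sigma> (a(k := 0)) b r = \<Sigma> a b r" by (rule lc_cong) (use True in auto)
    moreover have "(a(k := 0)) r = 0" using True by simp
    ultimately show ?thesis unfolding lc.simps using Suc.prems True by (simp del: fun_upd_apply)
  next
    case False
    with Suc.prems have kr: "k < r" by simp
    then have *: "\<Sigma> a b r = \<Sigma> (a(k := 0)) b r \<oplus> (a k \<odot> b k)"
      using Suc.prems by (intro Suc.IH) auto
    have "\<Sigma> (a(k := 0)) b r \<in> C" "b k \<in> C" "b r \<in> C"
      using Suc.prems by auto
    with False show ?thesis unfolding lc.simps * by (simp add: ac del: fun_upd_apply) simp
  qed
qed simp

lemma lc_single: "(\<And>j. j < r \<Longrightarrow> b j \<in> C) \<Longrightarrow> k < r \<Longrightarrow> (\<And>j. j < r \<Longrightarrow> j \<noteq> k \<Longrightarrow> a j \<odot> b j = \<zero>)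
    \<Longrightarrow> \<Sigma> a b r = a k \<odot> b k"
  by (subst lc_split[of r b k]) (auto simp: lc_zero)

lemma lc_upd: "(\<And>j. j < r \<Longrightarrow> b j \<in> C) \<Longrightarrow> k < r \<Longrightarrow> y \<in> C
    \<Longrightarrow> \<Sigma> a (b(k := y)) r = \<Sigma> (a(k := 0)) b r \<oplus> (a k \<odot> y)"
proof -
  assume b: "\<And>j. j < r \<Longrightarrow> b j \<in> C" and k: "k < r" and y: "y \<in> C"
  have "\<Sigma> (a(k := 0)) (b(k := y)) r' = \<Sigma> (a(k := 0)) b r'" if "r' \<le> r" for r'
    using that b y by (induction r') auto
  then show ?thesis using b k y by (subst lc_split[of r _ k]) auto
qed

lemma lc_lc:
  assumes "\<And>j. j < r \<Longrightarrow> b j \<in> C"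
  shows "\<Sigma> c (\<lambda>j. \<Sigma> (a j) b r) m = \<Sigma> (\<lambda>k. \<Sum>j<m. c j * a j k) b r"
proof (induction m)
  case 0
  then show ?case using assms by (simp add: lc_zero)
next
  case (Suc m)
  then show ?case using assms by (simp add: lc_add lc_scale)
qed

definition spans :: "nat \<Rightarrow> (nat \<Rightarrow> 'a) \<Rightarrow> bool" where
  "spans r b \<longleftrightarrow> (\<forall>j<r. b j \<in> C) \<and> (\<forall>l\<in>C. \<exists>a. l = \<Sigma> a b r)"

definition indep :: "nat \<Rightarrow> (nat \<Rightarrow> 'a) \<Rightarrow> bool" where
  "indep r b \<longleftrightarrow> (\<forall>a. \<Sigma> a b r = \<zero> \<longrightarrow> (\<forall>j<r. a j = 0))"

lemma indepD:
  assumes "indep r b" "\<And>j. j < r \<Longrightarrow> b j \<in> C" "\<Sigma> a b r = \<Sigma> a' b r" "j < r"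
  shows "a j = a' j"
proof -
  have "\<Sigma> (\<lambda>j. a j + (-1) * a' j) b r = \<zero>"
    using assms(2,3) by (simp only: lc_add lc_scale) simp
  then show ?thesis using assms(1,4) unfolding indep_def by fastforce
qed

text \<open>A nonzero constant is a unit of K[x], so the old generator can be recovered from the new
  one and the remaining ones.\<close>

lemma spans_upd:
  assumes b: "spans r b" and k: "k < r" and d: "d k = [:c:]" "c \<noteq> 0"
  shows "spans r (b(k := \<Sigma> d b r))"
proof -
  let ?y = "\<Sigma> d b r"
  have bC: "\<And>j. j < r \<Longrightarrow> b j \<in> C" using b by (simp add: spans_def)
  then have y: "?y \<in> C" by simp
  have "\<exists>a'. l = \<Sigma> a' (b(k := ?y)) r" if "l \<in> C" for l
  proof -
    obtain a where a: "l = \<Sigma> a b r" using b \<open>l \<in> C\<close> unfolding spans_def by blast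
    \<comment> \<open>Chosen so that subtracting \<open>g\<close> times the new generator cancels
      the coefficient of the old \<open>b k\<close>.\<close>
    define g where "g = a k * [:1 / c:]"
    define e where "e = (\<lambda>j. a j + (- g) * d j)"
    have ek: "e k = 0" using d by (simp add: e_def g_def)
    have "l = \<Sigma> (\<lambda>j. e j + g * d j) b r" by (simp add: a e_def)
    also have "\<dots> = \<Sigma> e b r \<oplus> (g \<odot> ?y)" using bC by (simp only: lc_add lc_scale)
    also have "e = (e(k := g))(k := 0)" using ek by auto
    also have "\<Sigma> \<dots> b r \<oplus> (g \<odot> ?y) = \<Sigma> (e(k := g)) (b(k := ?y)) r"
      by (subst lc_upd) (use bC k y in auto)
    finally show ?thesis by blast
  qed
  then show ?thesis using bC y by (auto simp: spans_def)
qed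

lemma spans_drop:
  assumes b: "spans (Suc r) b" and k: "k \<le> r" and z: "b k = \<zero>"
  shows "spans r (if k = r then b else b(k := b r))"
proof -
  have bC: "\<And>j. j \<le> r \<Longrightarrow> b j \<in> C" using b by (simp add: spans_def)
  have "\<exists>a'. l = \<Sigma> a' (if k = r then b else b(k := b r)) r" if "l \<in> C" for l
  proof -
    obtain a where a: "l = \<Sigma> a b (Suc r)" using b \<open>l \<in> C\<close> unfolding spans_def by blast
    show ?thesis
    proof (cases "k = r")
      case True
      then show ?thesis using a z bC by (intro exI[of _ a]) simp
    next
      case False
      with k have kr: "k < r" by simp
      have "\<Sigma> a b r = \<Sigma> (a(k := 0)) b r"
        using lc_split[of r b k a] bC kr z by simp
      moreover have "\<Sigma> (a(k := a r)) (b(k := b r)) r = \<Sigma> (a(k := 0)) b r \<oplus> (a r \<odot> b r)"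
        by (subst lc_upd) (use bC kr in auto)
      ultimately show ?thesis using a False by (intro exI[of _ "a(k := a r)"]) simp
    qed
  qed
  then show ?thesis using bC unfolding spans_def by auto
qed

end

section \<open>Minimal generating families are bases\<close>

context rmod
begin

text \<open>This is the Euclidean algorithm on the coefficients of a relation. While two
  coefficients are nonzero, a change of generators replaces one of them by its remainder modulo the
  other. Once a single coefficient is left, torsion-freeness makes its generator zero, and dropping
  that generator contradicts minimality.\<close>

lemma minimal_spans_indep:
  assumes tf: "\<And>p x. x \<in> C \<Longrightarrow> p \<odot> x = \<zero> \<Longrightarrow> p = 0 \<or> x = \<zero>"
    and b0: "spans r b0" and min: "\<And>r' b'. r' < r \<Longrightarrow> \<not> spans r' b'"
  shows "indep r b0"
proof -
  \<comment> \<open>A nonzero constant counts 1 and the zero polynomial 0, so a vanishing remainder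
    is progress as well.\<close>
  define size where "size = (\<lambda>a :: nat \<Rightarrow> 'k poly. \<Sum>j<r. if a j = 0 then 0 else Suc (degree (a j)))"
  have "\<forall>j<r. a j = 0" if "spans r b" "\<Sigma> a b r = \<zero>" for a b
    using that
  proof (induction "size a" arbitrary: a b rule: less_induct)
    case less
    have bC: "\<And>j. j < r \<Longrightarrow> b j \<in> C" using less.prems(1) by (simp add: spans_def)
    show ?case
    proof (rule ccontr)
      assume "\<not> ?thesis"
      then obtain k0 where k0: "k0 < r" "a k0 \<noteq> 0" by blast
      show False
      proof (cases "\<exists>j<r. j \<noteq> k0 \<and> a j \<noteq> 0")
        case False
        then have "\<Sigma> a b r = a k0 \<odot> b k0"
          using bC k0 by (intro lc_single) auto
        then have "b k0 = \<zero>" using tf[of "b k0" "a k0"] k0 bC less.prems(2) by auto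
        then have "spans (r - 1) (if k0 = r - 1 then b else b(k0 := b (r - 1)))"
          using spans_drop[of "r - 1" b k0] k0 less.prems(1) by simp
        with min[of "r - 1"] k0 show False by simp
      next
        case True
        then obtain j0 where j0: "j0 < r" "j0 \<noteq> k0" "a j0 \<noteq> 0" by blast
        obtain j k where jk: "j < r" "k < r" "j \<noteq> k" "a j \<noteq> 0" "a k \<noteq> 0" "degree (a k) \<le> degree (a j)"
          using j0 k0 by (metis nat_le_linear)
        define q where "q = a j div a k"
        \<comment> \<open>With \<open>q\<close> the quotient, a_j b_j + a_k b_k = (a_j mod a_k) b_j
          + a_k (b_k + q b_j), and the vector in the last bracket becomes the new generator at
          \<open>k\<close>.\<close>
        define d where "d = (\<lambda>i. if i = k then [:1:] else if i = j then q else 0)"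
        define a' where "a' = a(j := a j mod a k)"
        have sp: "spans r (b(k := \<Sigma> d b r))"
          using less.prems(1) jk by (intro spans_upd[where c = 1]) (auto simp: d_def)
        have "\<Sigma> a' (b(k := \<Sigma> d b r)) r = \<Sigma> (a'(k := 0)) b r \<oplus> (a' k \<odot> \<Sigma> d b r)"
          using bC jk by (intro lc_upd) auto
        also have "\<dots> = \<Sigma> (\<lambda>i. (a'(k := 0)) i + a' k * d i) b r"
          using bC by (simp only: lc_add lc_scale)
        also have "\<dots> = \<Sigma> a b r"
          using jk by (intro lc_cong) (auto simp: a'_def d_def q_def)
        finally have z: "\<Sigma> a' (b(k := \<Sigma> d b r)) r = \<zero>" using less.prems(2) by simp
        have "size a' < size a"
          unfolding size_def
        proof (rule sum_strict_mono_ex1)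
          have *: "(if a' j = 0 then 0 else Suc (degree (a' j))) < Suc (degree (a j))"
            using jk degree_mod_less[of "a k" "a j"] by (auto simp: a'_def)
          then show "\<exists>i\<in>{..<r}. (if a' i = 0 then 0 else Suc (degree (a' i)))
              < (if a i = 0 then 0 else Suc (degree (a i)))"
            using jk by (intro bexI[of _ j]) auto
          show "\<forall>i\<in>{..<r}. (if a' i = 0 then 0 else Suc (degree (a' i)))
              \<le> (if a i = 0 then 0 else Suc (degree (a i)))"
            using jk * by (auto simp: a'_def)
        qed simp
        from less.hyps[OF this sp z] have "a' k = 0" using jk by blast
        then show False using jk by (simp add: a'_def)
      qed
    qed
  qed
  then show ?thesis using b0 by (simp add: indep_def)
qed

text \<open>At this length every generating family is independent. Hence later exchanges have to
  preserve generation only.\<close>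

lemma ex_basis:
  assumes "\<And>p x. x \<in> C \<Longrightarrow> p \<odot> x = \<zero> \<Longrightarrow> p = 0 \<or> x = \<zero>" and "\<exists>r b. spans r b"
  obtains r where "\<exists>b. spans r b" "\<And>b. spans r b \<Longrightarrow> indep r b"
proof -
  define r where "r = (LEAST r. \<exists>b. spans r b)"
  have "\<exists>b. spans r b" unfolding r_def using assms(2) by (rule LeastI_ex)
  moreover have "\<And>r' b'. r' < r \<Longrightarrow> \<not> spans r' b'" unfolding r_def using not_less_Least by blast
  ultimately show ?thesis using that minimal_spans_indep[OF assms(1)] by blast
qed

end

section \<open>Chains of submodules and adapted bases\<close>

text \<open>The axioms mirror the entries of the order: \<open>U_Suc\<close> the units above the
  diagonal, \<open>U_X\<close> the entries x below it, \<open>U_n\<close> the corner x^(-1), and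
  \<open>U_XX\<close> that x^2 is allowed everywhere.\<close>

locale rchain = rmod C add zero sm
  for C :: "'a set" and add (infixl "\<oplus>" 65) and zero ("\<zero>") and sm :: "'k::field poly \<Rightarrow> 'a \<Rightarrow> 'a" (infixr "\<odot>" 70) +
  fixes U :: "nat \<Rightarrow> 'a set" and n :: nat
  assumes n_pos: "1 \<le> n"
    and U_1: "U 1 = C"
    and U_add: "i \<in> {1..n} \<Longrightarrow> x \<in> U i \<Longrightarrow> y \<in> U i \<Longrightarrow> x \<oplus> y \<in> U i"
    and U_sm: "i \<in> {1..n} \<Longrightarrow> x \<in> U i \<Longrightarrow> p \<odot> x \<in> U i"
    and U_Suc: "1 \<le> i \<Longrightarrow> i < n \<Longrightarrow> U (Suc i) \<subseteq> U i"
    and U_X: "1 \<le> i \<Longrightarrow> i < n \<Longrightarrow> x \<in> U i \<Longrightarrow> Xp \<odot> x \<in> U (Suc i)"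
    and U_n: "x \<in> U n \<Longrightarrow> \<exists>l\<in>C. x = Xp \<odot> l"
    and U_XX: "i \<in> {1..n} \<Longrightarrow> x \<in> C \<Longrightarrow> Xp \<odot> Xp \<odot> x \<in> U i"
begin

lemma U_antimono: "1 \<le> i \<Longrightarrow> i \<le> j \<Longrightarrow> j \<le> n \<Longrightarrow> U j \<subseteq> U i"
proof (induction j)
  case (Suc j)
  then show ?case using U_Suc[of j] by (cases "i = Suc j") auto
qed simp

lemma U_zero: "i \<in> {1..n} \<Longrightarrow> \<zero> \<in> U i"
  using U_XX[of i \<zero>] by simp

lemma U_lc: "i \<in> {1..n} \<Longrightarrow> (\<And>j. j < r \<Longrightarrow> a j \<odot> b j \<in> U i) \<Longrightarrow> \<Sigma> a b r \<in> U i"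
  by (induction r) (simp_all add: U_zero U_add)

text \<open>Membership in \<open>U i\<close> depends on each coefficient only up to multiples that
  already send the generator into \<open>U i\<close>. The truncations of coefficients below rest on
  this.\<close>

lemma U_lc_change:
  assumes "i \<in> {1..n}" "\<And>j. j < r \<Longrightarrow> b j \<in> C" "\<Sigma> a b r \<in> U i"
    and "\<And>j. j < r \<Longrightarrow> (d j - a j) \<odot> b j \<in> U i"
  shows "\<Sigma> d b r \<in> U i"
proof -
  have "\<Sigma> (\<lambda>j. a j + (d j - a j)) b r = \<Sigma> a b r \<oplus> \<Sigma> (\<lambda>j. d j - a j) b r"
    using assms(2) by (rule lc_add)
  then show ?thesis using assms by (simp add: U_add U_lc)
qed

lemma U_Xdvd: "i \<in> {1..n} \<Longrightarrow> x \<in> C \<Longrightarrow> Xp \<odot> x \<in> U i \<Longrightarrow> coeff p 0 = 0 \<Longrightarrow> p \<odot> x \<in> U i"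
proof -
  assume a: "i \<in> {1..n}" "x \<in> C" "Xp \<odot> x \<in> U i" "coeff p 0 = 0"
  then obtain q where "p = q * Xp" by (metis coeff_0_iff_Xp_dvd dvd_def mult.commute)
  then show ?thesis using a by (simp only: sm_mult U_sm)
qed

lemma U_XXdvd: "i \<in> {1..n} \<Longrightarrow> x \<in> C \<Longrightarrow> coeff p 0 = 0 \<Longrightarrow> Xp \<odot> p \<odot> x \<in> U i"
proof -
  assume a: "i \<in> {1..n}" "x \<in> C" "coeff p 0 = 0"
  have "Xp \<odot> p \<odot> x = p \<odot> Xp \<odot> x" using a by (metis mult.commute sm_mult)
  then show ?thesis using a U_Xdvd[of i "Xp \<odot> x" p] U_XX by simp
qed

definition lev :: "'a \<Rightarrow> nat" where "lev y = Max {i \<in> {1..n}. y \<in> U i}"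

lemma lev_in: "y \<in> C \<Longrightarrow> lev y \<in> {i \<in> {1..n}. y \<in> U i}"
  unfolding lev_def using U_1 n_pos by (intro Max_in) auto

lemma lev_le: "y \<in> C \<Longrightarrow> lev y \<le> n"
  using lev_in[of y] by simp

lemma lev_ge: "y \<in> C \<Longrightarrow> 1 \<le> lev y"
  using lev_in[of y] by simp

lemma lev_iff: "y \<in> C \<Longrightarrow> i \<in> {1..n} \<Longrightarrow> y \<in> U i \<longleftrightarrow> i \<le> lev y"
  using lev_in[of y] U_antimono[of i "lev y"] by (auto simp: lev_def)

abbreviation levX :: "'a \<Rightarrow> nat" where "levX y \<equiv> lev (Xp \<odot> y)"

text \<open>Any basis of maximal total level is adapted: a combination violating adaptedness could
  replace one of the basis vectors and increase the total.\<close>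

definition weight :: "nat \<Rightarrow> (nat \<Rightarrow> 'a) \<Rightarrow> nat" where
  "weight r b = (\<Sum>j<r. lev (b j) + levX (b j))"

lemma weight_upd:
  assumes "j < r" "lev (b j) + levX (b j) < lev y + levX y"
  shows "weight r b < weight r (b(j := y))"
  unfolding weight_def using assms by (intro sum_strict_mono_ex1) auto

lemma weight_bound: "spans r b \<Longrightarrow> weight r b \<le> r * (2 * n)"
proof -
  assume "spans r b"
  then have "lev (b j) + levX (b j) \<le> 2 * n" if "j < r" for j
    using lev_le[of "b j"] lev_le[of "Xp \<odot> b j"] that by (simp add: spans_def)
  then show ?thesis unfolding weight_def
    using sum_bounded_above[of "{..<r}" "\<lambda>j. lev (b j) + levX (b j)" "2 * n"] by simp
qed

end

locale rchain_tf = rchain +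
  assumes torsion_free: "x \<in> C \<Longrightarrow> p \<odot> x = \<zero> \<Longrightarrow> p = 0 \<or> x = \<zero>"
    and fin_span: "\<exists>r b. spans r b"
begin

context
  fixes r :: nat and b :: "nat \<Rightarrow> 'a"
  assumes b: "spans r b" and ind: "indep r b"
    and max: "\<And>b'. spans r b' \<Longrightarrow> weight r b' \<le> weight r b"
begin

lemma bC: "j < r \<Longrightarrow> b j \<in> C"
  using b by (simp add: spans_def)

lemma no_improve:
  assumes "j < r" "d j = [:c:]" "c \<noteq> 0"
  shows "lev (\<Sigma> d b r) + levX (\<Sigma> d b r) \<le> lev (b j) + levX (b j)"
  using max[OF spans_upd[OF b assms(1), of d c]] weight_upd[of j r b "\<Sigma> d b r"] assms by fastforce

lemma X_lc: "Xp \<odot> \<Sigma> a b r = \<Sigma> (\<lambda>j. Xp * a j) b r"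
  by (simp only: lc_scale bC)

text \<open>Because x^2 C lies in \<open>U i\<close>, only the constant terms of the coefficients
  matter for x times a combination. If some violating vector existed, the combination
  \<open>?y\<close> of all of them could replace the one with least \<open>lev\<close>: its
  \<open>levX\<close> would be at least \<open>i\<close>, hence larger, and its \<open>lev\<close>
  not smaller.\<close>

lemma adapted_X:
  assumes i: "i \<in> {1..n}" and u: "Xp \<odot> \<Sigma> a b r \<in> U i" and j: "j < r" "levX (b j) < i"
  shows "coeff (a j) 0 = 0"
proof (rule ccontr)
  assume nz: "coeff (a j) 0 \<noteq> 0"
  define J where "J = {j. j < r \<and> levX (b j) < i \<and> coeff (a j) 0 \<noteq> 0}"
  have "j \<in> J" using nz j by (simp add: J_def)
  then obtain k where k: "k \<in> J" "\<And>j. j \<in> J \<Longrightarrow> lev (b k) \<le> lev (b j)"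
    using ex_has_least_nat[of "\<lambda>j. j \<in> J" j "\<lambda>j. lev (b j)"] by blast
  \<comment> \<open>Only constant terms are kept, so the coefficient at \<open>k\<close> is a unit
    and the exchange is legitimate.\<close>
  define d where "d = (\<lambda>j. if j \<in> J then [:coeff (a j) 0:] else 0)"
  let ?y = "\<Sigma> d b r"
  have kr: "k < r" using k(1) by (simp add: J_def)
  have yC: "?y \<in> C" using bC by simp
  have "Xp \<odot> ?y \<in> U i"
    unfolding X_lc
  proof (rule U_lc_change[OF i bC])
    show "\<Sigma> (\<lambda>j. Xp * a j) b r \<in> U i" using u X_lc by simp
    fix j assume jr: "j < r"
    have "Xp \<odot> (d j - a j) \<odot> b j \<in> U i"
    proof (cases "levX (b j) < i")
      case True
      then have "coeff (d j - a j) 0 = 0" using jr by (auto simp: d_def J_def)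
      then show ?thesis using U_XXdvd i jr bC by blast
    next
      case False
      then have "Xp \<odot> b j \<in> U i" using lev_iff[of "Xp \<odot> b j" i] i jr bC by auto
      then have "(d j - a j) \<odot> Xp \<odot> b j \<in> U i" using U_sm i by blast
      then show ?thesis using jr bC by (metis mult.commute sm_mult)
    qed
    then show "(Xp * d j - Xp * a j) \<odot> b j \<in> U i"
      using bC[OF jr] by (simp only: sm_mult flip: right_diff_distrib)
  qed
  then have "i \<le> levX ?y" using lev_iff[of "Xp \<odot> ?y" i] i yC by simp
  moreover have "?y \<in> U (lev (b k))"
  proof (rule U_lc)
    show L: "lev (b k) \<in> {1..n}" using lev_in[OF bC[OF kr]] by blast
    fix j assume "j < r"
    then show "d j \<odot> b j \<in> U (lev (b k))"
      using k(2)[of j] lev_iff[of "b j" "lev (b k)"] bC L by (auto simp: d_def U_zero U_sm)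
  qed
  then have "lev (b k) \<le> lev ?y" using lev_iff[OF yC] lev_in[OF bC[OF kr]] by simp
  moreover have "lev ?y + levX ?y \<le> lev (b k) + levX (b k)"
    using k(1) by (intro no_improve) (auto simp: d_def J_def)
  moreover have "levX (b k) < i" using k(1) by (simp add: J_def)
  ultimately show False by simp
qed

text \<open>The same exchange with the roles of \<open>lev\<close> and \<open>levX\<close>
  interchanged. Now the combination is not multiplied by x, so constant terms no longer suffice:
  coefficients matter modulo x^2, and the one at the exchanged vector is normalised to 1 by an
  inverse to that precision.\<close>

lemma adapted_1:
  assumes i: "i \<in> {1..n}" and u: "\<Sigma> a b r \<in> U i" and j: "j < r" "lev (b j) < i"
  shows "coeff (a j) 0 = 0"
proof (rule ccontr)
  assume nz: "coeff (a j) 0 \<noteq> 0"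
  define J where "J = {j. j < r \<and> lev (b j) < i \<and> coeff (a j) 0 \<noteq> 0}"
  have "j \<in> J" using nz j by (simp add: J_def)
  then obtain k where k: "k \<in> J" "\<And>j. j \<in> J \<Longrightarrow> levX (b k) \<le> levX (b j)"
    using ex_has_least_nat[of "\<lambda>j. j \<in> J" j "\<lambda>j. levX (b j)"] by blast
  have kr: "k < r" using k(1) by (simp add: J_def)
  \<comment> \<open>An inverse of the coefficient modulo the square of the variable.\<close>
  define q where "q = [:1 / coeff (a k) 0, - coeff (a k) 1 / (coeff (a k) 0)\<^sup>2:]"
  have ak0: "coeff (a k) 0 \<noteq> 0" using k(1) by (simp add: J_def)
  have "coeff (1 - q * a k) 0 = 0" "coeff (1 - q * a k) 1 = 0"
    using ak0 by (simp_all add: q_def coeff_mult power2_eq_square field_simps)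
  then obtain e where e: "1 - q * a k = Xp * (Xp * e)"
  proof -
    have "1 - q * a k = pCons 0 (pCons 0 (poly_shift 2 (1 - q * a k)))"
      using \<open>coeff (1 - q * a k) 0 = 0\<close> \<open>coeff (1 - q * a k) 1 = 0\<close>
      by (intro poly_eqI) (auto simp: coeff_pCons coeff_poly_shift numeral_2_eq_2 split: nat.splits)
    then show ?thesis using that[of "poly_shift 2 (1 - q * a k)"] by simp
  qed
  \<comment> \<open>Terms with \<open>i \<le> lev (b j)\<close> are dropped, as they lie in
    \<open>U i\<close> anyway. The entry 1 at \<open>k\<close> differs from \<open>q * a k\<close>
    by a multiple of x^2.\<close>
  define d where "d = (\<lambda>j. if j = k then [:1:] else if lev (b j) < i then q * a j else 0)"
  let ?y = "\<Sigma> d b r"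
  have yC: "?y \<in> C" using bC by simp
  have "?y \<in> U i"
  proof (rule U_lc_change[OF i bC])
    show "\<Sigma> (\<lambda>j. q * a j) b r \<in> U i" using u i bC by (simp add: lc_scale U_sm)
    fix j assume jr: "j < r"
    show "(d j - q * a j) \<odot> b j \<in> U i"
    proof (cases "j = k")
      case True
      then have "d j - q * a j = Xp * (Xp * e)" using e by (simp add: d_def one_pCons)
      then show ?thesis using U_XX[OF i, of "e \<odot> b j"] jr bC by (simp only: sm_mult sm_closed)
    next
      case False
      then show ?thesis using lev_iff[of "b j" i] jr bC i by (auto simp: d_def U_zero U_sm)
    qed
  qed
  then have "i \<le> lev ?y" using lev_iff[of ?y i] i yC by simp
  moreover have "Xp \<odot> ?y \<in> U (levX (b k))"
    unfolding X_lc
  proof (rule U_lc)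
    show L: "levX (b k) \<in> {1..n}" using lev_in[OF sm_closed[OF bC[OF kr]]] by blast
    fix j assume jr: "j < r"
    have X: "(Xp * d j) \<odot> b j = d j \<odot> Xp \<odot> b j"
      using jr bC by (metis mult.commute sm_mult)
    show "(Xp * d j) \<odot> b j \<in> U (levX (b k))"
    proof (cases "j \<in> J")
      case True
      then show ?thesis unfolding X
        using k(2)[of j] lev_iff[of "Xp \<odot> b j" "levX (b k)"] bC L jr U_sm by simp
    next
      case False
      \<comment> \<open>Outside \<open>J\<close> the coefficient \<open>d j\<close> has zero
        constant term, so x times it maps \<open>b j\<close> into x^2 C, which lies in every member
        of the chain.\<close>
      then have "j \<noteq> k" using k(1) by auto
      then have "coeff (d j) 0 = 0"
        using False jr by (auto simp: d_def J_def coeff_mult)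
      then show ?thesis using U_XXdvd[OF L bC[OF jr]] bC[OF jr] by (simp only: sm_mult)
    qed
  qed
  then have "levX (b k) \<le> levX ?y" using lev_iff[OF sm_closed[OF yC]] lev_in[OF sm_closed[OF bC[OF kr]]] by simp
  moreover have "lev ?y + levX ?y \<le> lev (b k) + levX (b k)"
    using kr by (intro no_improve) (auto simp: d_def)
  moreover have "lev (b k) < i" using k(1) by (simp add: J_def)
  ultimately show False by simp
qed

text \<open>After the terms already in \<open>U i\<close> are discarded, \<open>adapted_1\<close>
  makes all remaining coefficients divisible by x. The quotients \<open>e\<close> form a combination
  to which \<open>adapted_X\<close> applies, and this supplies the second factor x.\<close>

lemma adapted_2:
  assumes i: "i \<in> {1..n}" and u: "\<Sigma> a b r \<in> U i" and j: "j < r" "levX (b j) < i"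
  shows "Xp ^ 2 dvd a j"
proof -
  define d where "d = (\<lambda>j. if lev (b j) < i then a j else 0)"
  have "\<Sigma> d b r \<in> U i"
  proof (rule U_lc_change[OF i bC u])
    fix j assume "j < r"
    then show "(d j - a j) \<odot> b j \<in> U i"
      using lev_iff[of "b j" i] bC i by (auto simp: d_def U_zero U_sm)
  qed
  define e where "e = (\<lambda>j. d j div Xp)"
  have dv: "Xp dvd d j" if "j < r" for j
    using adapted_1[OF i u that] that by (auto simp: d_def coeff_0_iff_Xp_dvd)
  have de: "Xp * e j = d j" if "j < r" for j
    unfolding e_def using dv[OF that] by (rule dvd_mult_div_cancel)
  have "Xp \<odot> \<Sigma> e b r = \<Sigma> d b r"
    unfolding X_lc using de by (intro lc_cong) auto
  with \<open>\<Sigma> d b r \<in> U i\<close> have "coeff (e j) 0 = 0"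
    using adapted_X[OF i, of e] j by simp
  then have "Xp dvd e j" by (simp add: coeff_0_iff_Xp_dvd)
  then have "Xp * Xp dvd d j" using de[OF j(1)] by (metis mult_dvd_mono dvd_refl)
  \<comment> \<open>Multiplication by x preserves each \<open>U i\<close>, so
    \<open>lev (b j) \<le> levX (b j) < i\<close> and the term at \<open>j\<close> was not
    discarded.\<close>
  moreover have "d j = a j"
  proof -
    have "lev (b j) \<le> levX (b j)"
      using lev_iff[of "Xp \<odot> b j" "lev (b j)"] lev_in[OF bC[OF j(1)]] U_sm bC[OF j(1)] by auto
    then show ?thesis using j by (simp add: d_def)
  qed
  ultimately show ?thesis by (simp add: power2_eq_square)
qed

text \<open>A basis vector in \<open>U n\<close> would be x times an element, so its own coefficient
  1 would be divisible by x. Below position \<open>n\<close>, multiplication by x moves a vector at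
  least one step down the chain. This is the source of \<open>s < t\<close>.\<close>

lemma lev_less_levX:
  assumes j: "j < r"
  shows "lev (b j) < levX (b j)"
proof -
  have L: "lev (b j) \<in> {i \<in> {1..n}. b j \<in> U i}" using lev_in[OF bC[OF j]] .
  have "lev (b j) \<noteq> n"
  proof
    assume "lev (b j) = n"
    then have "b j \<in> U n" using L by auto
    then obtain l where "l \<in> C" "b j = Xp \<odot> l" using U_n by blast
    moreover then obtain c where c: "l = \<Sigma> c b r" using b by (auto simp: spans_def)
    moreover have "\<Sigma> (\<lambda>i. if i = j then 1 else 0) b r = b j"
      using j bC by (subst lc_single[of r b j]) auto
    ultimately have "\<Sigma> (\<lambda>i. if i = j then 1 else 0) b r = \<Sigma> (\<lambda>i. Xp * c i) b r"
      using X_lc by simp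
    from indepD[OF ind bC this j] have "1 = Xp * c j" by simp
    then have "poly 1 0 = poly (Xp * c j) 0" by metis
    then show False by simp
  qed
  then have "Xp \<odot> b j \<in> U (Suc (lev (b j)))" using L by (intro U_X) auto
  then show ?thesis using lev_iff[of "Xp \<odot> b j" "Suc (lev (b j))"] L \<open>lev (b j) \<noteq> n\<close> bC j by auto
qed

end

theorem adapted_basis:
  obtains r b where "spans r b" "indep r b"
    "\<And>i a j. i \<in> {1..n} \<Longrightarrow> \<Sigma> a b r \<in> U i \<Longrightarrow> j < r \<Longrightarrow>
       (lev (b j) < i \<longrightarrow> Xp dvd a j) \<and> (levX (b j) < i \<longrightarrow> Xp ^ 2 dvd a j)"
    "\<And>j. j < r \<Longrightarrow> lev (b j) < levX (b j)"
proof -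
  obtain r where r: "\<exists>b. spans r b" "\<And>b. spans r b \<Longrightarrow> indep r b"
    using ex_basis[OF torsion_free fin_span] by blast
  then obtain b0 where "spans r b0" by blast
  moreover have "\<forall>b. spans r b \<longrightarrow> weight r b < Suc (r * (2 * n))"
    using weight_bound by (simp add: less_Suc_eq_le)
  ultimately obtain b where b: "spans r b" "\<forall>b'. spans r b' \<longrightarrow> weight r b' \<le> weight r b"
    using ex_has_greatest_nat[of "spans r" b0 "weight r" "Suc (r * (2 * n))"] by metis
  then have max: "\<And>b'. spans r b' \<Longrightarrow> weight r b' \<le> weight r b" by simp
  note ind = r(2)[OF b(1)]
  show ?thesis
  proof (rule that[OF b(1) ind])
    fix i a j assume *: "i \<in> {1..n}" "\<Sigma> a b r \<in> U i" "j < r"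
    have "Xp dvd a j" if "lev (b j) < i"
      using adapted_1[OF b(1) ind max * that] by (simp add: coeff_0_iff_Xp_dvd)
    moreover have "Xp ^ 2 dvd a j" if "levX (b j) < i"
      using adapted_2[OF b(1) ind max * that] by simp
    ultimately show "(lev (b j) < i \<longrightarrow> Xp dvd a j) \<and> (levX (b j) < i \<longrightarrow> Xp ^ 2 dvd a j)"
      by blast
  next
    fix j assume "j < r"
    then show "lev (b j) < levX (b j)" using lev_less_levX[OF b(1) ind max] by simp
  qed
qed

end

declare One_nat_def [simp del]

section \<open>Components of modules over the order\<close>

definition Eu :: "nat \<Rightarrow> nat \<Rightarrow> 'k::field poly fract \<Rightarrow> 'k kmat" where
  "Eu i j r = (\<lambda>a b. if a = i \<and> b = j then r else 0)"

lemma scal_in_Lam [simp]: "scal n p \<in> Lam n"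
  by (auto simp: Lam_def scal_def cexp_def intro: xR_mono[OF xR_embR])

lemma Eu_in_Lam: "i \<in> {1..n} \<Longrightarrow> j \<in> {1..n} \<Longrightarrow> xR (cexp n i j) r \<Longrightarrow> Eu i j r \<in> Lam n"
  by (auto simp: Lam_def Eu_def)

lemma Lam_support: "A \<in> Lam n \<Longrightarrow> i \<notin> {1..n} \<or> j \<notin> {1..n} \<Longrightarrow> A i j = 0"
  by (auto simp: Lam_def)

lemma Lam_xR: "A \<in> Lam n \<Longrightarrow> i \<in> {1..n} \<Longrightarrow> j \<in> {1..n} \<Longrightarrow> xR (cexp n i j) (A i j)"
  by (auto simp: Lam_def)

text \<open>The zero matrix is written \<open>scal n 0\<close>, since the action of scalar matrices
  is already known.\<close>

lemma matmul_Eu_Eu: "j \<in> {1..n} \<Longrightarrow> matmul n (Eu i j r) (Eu k l q) = (if j = k then Eu i l (r * q) else scal n 0)"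
proof -
  assume j: "j \<in> {1..n}"
  have "(\<Sum>m\<in>{1..n}. Eu i j r a m * Eu k l q m b) = (\<Sum>m\<in>{1..n}. if m = j then Eu i j r a j * Eu k l q j b else 0)" for a b
    by (intro sum.cong) (auto simp: Eu_def)
  then show ?thesis using j by (auto simp: matmul_def fun_eq_iff Eu_def scal_def)
qed

lemma matmul_Eu_left: "i \<in> {1..n} \<Longrightarrow> matmul n (Eu l i r) A = (\<lambda>a b. if a = l then r * A i b else 0)"
proof -
  assume i: "i \<in> {1..n}"
  have "(\<Sum>m\<in>{1..n}. Eu l i r a m * A m b) = (\<Sum>m\<in>{1..n}. if m = i then Eu l i r a i * A i b else 0)" for a b
    by (intro sum.cong) (auto simp: Eu_def)
  then show ?thesis using i by (auto simp: matmul_def fun_eq_iff Eu_def)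
qed

lemma matmul_scal_left: "A \<in> Lam n \<Longrightarrow> matmul n (scal n p) A = (\<lambda>i j. embR p * A i j)"
proof -
  assume A: "A \<in> Lam n"
  have "(\<Sum>m\<in>{1..n}. scal n p a m * A m b) = (\<Sum>m\<in>{1..n}. if m = a then embR p * A a b else 0)" for a b
    using Lam_support[OF A] by (intro sum.cong) (auto simp: scal_def)
  then show ?thesis using Lam_support[OF A] by (auto simp: matmul_def fun_eq_iff)
qed

lemma matmul_scal_right: "A \<in> Lam n \<Longrightarrow> matmul n A (scal n p) = (\<lambda>i j. embR p * A i j)"
proof -
  assume A: "A \<in> Lam n"
  have "(\<Sum>m\<in>{1..n}. A a m * scal n p m b) = (\<Sum>m\<in>{1..n}. if m = b then embR p * A a b else 0)" for a b
    using Lam_support[OF A] by (intro sum.cong) (auto simp: scal_def)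
  then show ?thesis using Lam_support[OF A] by (auto simp: matmul_def fun_eq_iff)
qed

lemma scal_mult: "scal n (p * q) = matmul n (scal n p) (scal n q)"
  by (auto simp: matmul_scal_left) (auto simp: scal_def fun_eq_iff embR_mult)

lemma scal_add: "scal n (p + q) = matadd (scal n p) (scal n q)"
  by (auto simp: matadd_def scal_def fun_eq_iff embR_add)

lemma scal_1: "scal n 1 = idm n"
  by (auto simp: scal_def idm_def fun_eq_iff)

lemma Lam_scale: "A \<in> Lam n \<Longrightarrow> (\<lambda>i j. embR p * A i j) \<in> Lam n"
  by (auto simp: Lam_def xR_mult_emb)

lemma Lam_sum: "(\<And>k. k \<in> I \<Longrightarrow> F k \<in> Lam n) \<Longrightarrow> (\<lambda>i j. \<Sum>k\<in>I. F k i j) \<in> Lam n"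
  by (auto simp: Lam_def intro!: xR_sum)

lemma xR_square: "xR (cexp n i j) (xvar * xvar)"
proof -
  have "cexp n i j \<le> 2" by (simp add: cexp_def)
  then have "xR (cexp n i j) (xvar ^ 2)" using xR_mono[OF xR_powi[of 2]] by auto
  then show ?thesis by (simp only: power2_eq_square)
qed

lemma cexp_ge: "-1 \<le> cexp n i j" by (simp add: cexp_def)

abbreviation msm where "msm n M \<equiv> (\<lambda>p. mact M (scal n p))"
abbreviation mlc where "mlc n M \<equiv> lc (mplus M) (mzero M) (msm n M)"
abbreviation tp where "tp M i \<equiv> mact M (Eu 1 i 1)"
text \<open>A torsion-free module is determined by its first component together with the chain of
  submodules \<open>UU M i\<close>, the copies of the other components inside it.\<close>

definition UU where "UU M i = tp M i ` mcar M"

lemma UU_I: "x \<in> mcar M \<Longrightarrow> tp M i x \<in> UU M i"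
  by (simp add: UU_def)

lemma is_lmod_rmod: "is_lmod n M \<Longrightarrow> rmod (mcar M) (mplus M) (mzero M) (msm n M)"
  unfolding rmod_def is_lmod_def by (simp add: scal_add scal_mult scal_1) metis

locale lmodule =
  fixes n :: nat and M :: "('k::field poly fract, 'a) lmod"
  assumes lmod: "is_lmod n M" and n2: "2 \<le> n"
begin

sublocale rmod "mcar M" "mplus M" "mzero M" "msm n M"
  using lmod by (rule is_lmod_rmod)

lemma one_le_n [simp]: "1 \<le> n" using n2 by simp

lemma act_closed [simp]: "A \<in> Lam n \<Longrightarrow> x \<in> mcar M \<Longrightarrow> mact M A x \<in> mcar M"
  using lmod by (simp add: is_lmod_def)

lemma act_add: "A \<in> Lam n \<Longrightarrow> x \<in> mcar M \<Longrightarrow> y \<in> mcar M \<Longrightarrow> mact M A (mplus M x y) = mplus M (mact M A x) (mact M A y)"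
  using lmod by (simp add: is_lmod_def)

lemma act_matadd: "A \<in> Lam n \<Longrightarrow> B \<in> Lam n \<Longrightarrow> x \<in> mcar M \<Longrightarrow> mact M (matadd A B) x = mplus M (mact M A x) (mact M B x)"
  using lmod by (simp add: is_lmod_def)

lemma act_matmul: "A \<in> Lam n \<Longrightarrow> B \<in> Lam n \<Longrightarrow> x \<in> mcar M \<Longrightarrow> mact M (matmul n A B) x = mact M A (mact M B x)"
  using lmod by (simp add: is_lmod_def)

lemma act_sm: "A \<in> Lam n \<Longrightarrow> x \<in> mcar M \<Longrightarrow> mact M A (msm n M p x) = msm n M p (mact M A x)"
  using act_matmul[of A "scal n p" x] act_matmul[of "scal n p" A x]
  by (simp add: matmul_scal_left matmul_scal_right)

lemma act_zero [simp]: "A \<in> Lam n \<Longrightarrow> mact M A (mzero M) = mzero M"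
  using act_sm[of A "mzero M" 0] by simp

lemma act_lc: "A \<in> Lam n \<Longrightarrow> (\<And>j. j < r \<Longrightarrow> b j \<in> mcar M) \<Longrightarrow> mact M A (mlc n M a b r) = mlc n M a (\<lambda>j. mact M A (b j)) r"
  by (induction r) (simp_all add: act_add act_sm)

lemma act_matsum:
  assumes "\<And>k. k < m \<Longrightarrow> F k \<in> Lam n" "x \<in> mcar M"
  shows "mact M (\<lambda>i j. \<Sum>k<m. F k i j) x = mlc n M (\<lambda>_. 1) (\<lambda>k. mact M (F k) x) m"
  using assms(1)
proof (induction m)
  case 0
  have "(\<lambda>i j. \<Sum>k<0. F k i j) = scal n 0" by (simp add: scal_def fun_eq_iff)
  then show ?case using assms(2) by simp
next
  case (Suc m)
  have "(\<lambda>i j. \<Sum>k<Suc m. F k i j) = matadd (\<lambda>i j. \<Sum>k<m. F k i j) (F m)"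
    by (simp add: matadd_def)
  moreover have "(\<lambda>i j. \<Sum>k<m. F k i j) \<in> Lam n" using Suc.prems by (intro Lam_sum) auto
  ultimately show ?case using Suc assms(2) by (simp add: act_matadd)
qed

lemma Eu_tp_Lam [simp]: "i \<in> {1..n} \<Longrightarrow> Eu 1 i 1 \<in> Lam n"
  using n2 by (intro Eu_in_Lam) (auto intro: xR_mono[OF xR_1] simp: cexp_def)

lemma Eu_diag_Lam [simp]: "i \<in> {1..n} \<Longrightarrow> Eu i i 1 \<in> Lam n"
  using n2 by (intro Eu_in_Lam) (auto simp: cexp_def)

lemma act_Eu_Eu:
  assumes "Eu i j r \<in> Lam n" "Eu j l q \<in> Lam n" "j \<in> {1..n}" "x \<in> mcar M"
  shows "mact M (Eu i j r) (mact M (Eu j l q) x) = mact M (Eu i l (r * q)) x"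
  using act_matmul[OF assms(1,2,4)] assms(3) by (simp add: matmul_Eu_Eu)

lemma act_Eu_Eu0:
  assumes "Eu i j r \<in> Lam n" "Eu k l q \<in> Lam n" "j \<in> {1..n}" "x \<in> mcar M" "j \<noteq> k"
  shows "mact M (Eu i j r) (mact M (Eu k l q) x) = mzero M"
  using act_matmul[OF assms(1,2,4)] assms(3-5) by (simp add: matmul_Eu_Eu)

lemma sm_act_Eu:
  assumes "Eu i j r \<in> Lam n" "x \<in> mcar M"
  shows "msm n M p (mact M (Eu i j r) x) = mact M (Eu i j (embR p * r)) x"
proof -
  have "matmul n (scal n p) (Eu i j r) = Eu i j (embR p * r)"
    using assms(1) by (simp add: matmul_scal_left) (auto simp: Eu_def fun_eq_iff)
  then show ?thesis using act_matmul[OF scal_in_Lam assms, of p] by simp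
qed

lemma one_in [simp]: "1 \<in> {1..n}" using n2 by auto

lemma tp_1_tp [simp]: "i \<in> {1..n} \<Longrightarrow> x \<in> mcar M \<Longrightarrow> tp M 1 (tp M i x) = tp M i x"
  by (subst act_Eu_Eu) auto

lemma tp_sm: "i \<in> {1..n} \<Longrightarrow> x \<in> mcar M \<Longrightarrow> tp M i (msm n M p x) = msm n M p (tp M i x)"
  by (rule act_sm) auto

lemma UU_closed: "i \<in> {1..n} \<Longrightarrow> x \<in> UU M i \<Longrightarrow> x \<in> mcar M"
  by (auto simp: UU_def)

lemma UU_tp_1: "i \<in> {1..n} \<Longrightarrow> x \<in> UU M i \<Longrightarrow> tp M 1 x = x"
  by (auto simp: UU_def)

lemma UU_1_iff: "x \<in> UU M 1 \<longleftrightarrow> x \<in> mcar M \<and> tp M 1 x = x"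
  using UU_closed[of 1 x] UU_tp_1[of 1 x] UU_I[of x M 1] by auto

lemma UU_subset_1: "i \<in> {1..n} \<Longrightarrow> UU M i \<subseteq> UU M 1"
  using UU_1_iff UU_closed UU_tp_1 by blast

lemma UU_add: "i \<in> {1..n} \<Longrightarrow> x \<in> UU M i \<Longrightarrow> y \<in> UU M i \<Longrightarrow> mplus M x y \<in> UU M i"
  unfolding UU_def by (auto simp: act_add[symmetric] intro!: imageI)

lemma UU_sm: "i \<in> {1..n} \<Longrightarrow> x \<in> UU M i \<Longrightarrow> msm n M p x \<in> UU M i"
  unfolding UU_def by (auto simp: tp_sm[symmetric] intro!: imageI)

text \<open>This and the next three inclusions come from one matrix of the order each:
  \<open>Eu i (Suc i) 1\<close>, \<open>Eu (Suc i) i xvar\<close>,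
  \<open>Eu 1 n (inverse xvar)\<close> and \<open>Eu i 1 (xvar * xvar)\<close>.\<close>

lemma UU_Suc: "1 \<le> i \<Longrightarrow> i < n \<Longrightarrow> UU M (Suc i) \<subseteq> UU M i"
proof
  fix x assume i: "1 \<le> i" "i < n" and "x \<in> UU M (Suc i)"
  then obtain y where y: "y \<in> mcar M" "x = tp M (Suc i) y" by (auto simp: UU_def)
  have E: "(Eu i (Suc i) 1 :: 'k kmat) \<in> Lam n"
    using i by (intro Eu_in_Lam) (auto intro: xR_mono[OF xR_1] simp: cexp_def)
  then have "x = tp M i (mact M (Eu i (Suc i) 1) y)"
    using i y by (subst act_Eu_Eu) auto
  then show "x \<in> UU M i" using E y by (auto intro: UU_I)
qed

lemma UU_X: "1 \<le> i \<Longrightarrow> i < n \<Longrightarrow> x \<in> UU M i \<Longrightarrow> msm n M Xp x \<in> UU M (Suc i)"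
proof -
  assume i: "1 \<le> i" "i < n" and "x \<in> UU M i"
  then obtain y where y: "y \<in> mcar M" "x = tp M i y" by (auto simp: UU_def)
  have E: "(Eu (Suc i) i xvar :: 'k kmat) \<in> Lam n"
    using i xR_powi[of 1] by (intro Eu_in_Lam) (auto simp: cexp_def)
  then have "msm n M Xp x = tp M (Suc i) (mact M (Eu (Suc i) i xvar) y)"
    using i y by (subst act_Eu_Eu) (auto simp: sm_act_Eu embR_Xp)
  then show ?thesis using E y by (auto intro: UU_I)
qed

lemma UU_n: "x \<in> UU M n \<Longrightarrow> \<exists>l\<in>UU M 1. x = msm n M Xp l"
proof -
  assume "x \<in> UU M n"
  then obtain y where y: "y \<in> mcar M" "x = tp M n y" by (auto simp: UU_def)
  have E: "(Eu 1 n (inverse xvar) :: 'k kmat) \<in> Lam n"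
    using n2 xR_powi[of "-1"] by (intro Eu_in_Lam) (auto simp: cexp_def power_int_minus)
  then have "x = msm n M Xp (mact M (Eu 1 n (inverse xvar)) y)"
    using y by (simp add: sm_act_Eu embR_Xp)
  moreover have "mact M (Eu 1 n (inverse xvar)) y \<in> UU M 1"
    unfolding UU_1_iff using E y by (subst act_Eu_Eu) auto
  ultimately show ?thesis by blast
qed

lemma UU_XX: "i \<in> {1..n} \<Longrightarrow> x \<in> UU M 1 \<Longrightarrow> msm n M Xp (msm n M Xp x) \<in> UU M i"
proof -
  assume i: "i \<in> {1..n}" and "x \<in> UU M 1"
  then obtain y where y: "y \<in> mcar M" "x = tp M 1 y" by (auto simp: UU_def)
  have E: "(Eu i 1 (xvar * xvar) :: 'k kmat) \<in> Lam n"
    using i by (intro Eu_in_Lam xR_square) auto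
  have E': "(Eu 1 1 xvar :: 'k kmat) \<in> Lam n"
    using xR_mono[OF xR_powi[of 1], of 0] n2 by (intro Eu_in_Lam) (auto simp: cexp_def)
  have "msm n M Xp (msm n M Xp x) = tp M i (mact M (Eu i 1 (xvar * xvar)) y)"
    using i y E E' by (subst act_Eu_Eu) (auto simp: sm_act_Eu embR_Xp)
  then show ?thesis using E y by (auto intro: UU_I)
qed

lemma rmod_UU: "rmod (UU M 1) (mplus M) (mzero M) (msm n M)"
proof
  fix x y z p q
  show "mzero M \<in> UU M 1" unfolding UU_1_iff by (simp add: act_zero)
  assume x: "x \<in> UU M 1"
  note cl = UU_closed[OF one_in(1)]
  show "mplus M (mzero M) x = x" "msm n M (p + q) x = mplus M (msm n M p x) (msm n M q x)"
    "msm n M (p * q) x = msm n M p (msm n M q x)" "msm n M 1 x = x"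
    using cl[OF x] by (simp_all only: zero_left sm_add_left sm_mult sm_one)
  show "\<exists>y\<in>UU M 1. mplus M x y = mzero M"
    using cl[OF x] x by (intro bexI[of _ "msm n M (-1) x"]) (simp_all only: add_neg UU_sm one_in)
  show "msm n M p x \<in> UU M 1" using x UU_sm by simp
  assume y: "y \<in> UU M 1"
  show "mplus M x y \<in> UU M 1" using x y UU_add by simp
  show "mplus M x y = mplus M y x" using cl x y by (metis comm)
  show "msm n M p (mplus M x y) = mplus M (msm n M p x) (msm n M p y)"
    using cl x y by (metis sm_add_right)
  assume z: "z \<in> UU M 1"
  show "mplus M (mplus M x y) z = mplus M x (mplus M y z)" using cl x y z by (metis assoc)
qed

lemma rchain_UU: "rchain (UU M 1) (mplus M) (mzero M) (msm n M) (UU M) n"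
  using n2 UU_Suc UU_X UU_n UU_XX UU_add UU_sm
  by (intro rchain.intro rmod_UU rchain_axioms.intro) auto

sublocale ch: rchain "UU M 1" "mplus M" "mzero M" "msm n M" "UU M" n
  by (rule rchain_UU)

text \<open>The factor x clears the possible x^(-1) in the corner entry, so all
  \<open>xvar * A i j\<close> are polynomials. The identity behind it is x E_1i A = sum over j of (x
  A_ij) E_1j. The index of \<open>lc\<close> starts at 0, hence the \<open>Suc j\<close>.\<close>

lemma row_act:
  assumes A: "A \<in> Lam n" and i: "i \<in> {1..n}" and x: "x \<in> mcar M"
  shows "msm n M Xp (tp M i (mact M A x)) = mlc n M (\<lambda>j. unR (xvar * A i (Suc j))) (\<lambda>j. tp M (Suc j) x) n"
proof -
  have x0: "xR 0 (xvar * A i j)" if "j \<in> {1..n}" for j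
    using xR_mono[OF xR_mult[OF xR_powi[of 1] Lam_xR[OF A i that]], of 0] cexp_ge[of n i j] by simp
  define F where "F = (\<lambda>k a b. embR (unR (xvar * A i (Suc k))) * Eu 1 (Suc k) 1 a b)"
  have F: "F k = matmul n (scal n (unR (xvar * A i (Suc k)))) (Eu 1 (Suc k) 1)" if "k < n" for k
    using that by (simp add: matmul_scal_left F_def)
  have FL: "F k \<in> Lam n" if "k < n" for k
    unfolding F_def using that by (intro Lam_scale) auto
  have B: "matmul n (Eu 1 i 1) A = (\<lambda>a b. if a = 1 then A i b else 0)"
    using i by (simp add: matmul_Eu_left fun_eq_iff)
  have E1: "(Eu 1 i 1 :: 'k kmat) \<in> Lam n" using i by simp
  have BL: "(matmul n (scal n Xp) (Eu 1 i 1) :: 'k kmat) \<in> Lam n"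
    unfolding matmul_scal_left[OF E1] using E1 by (rule Lam_scale)
  have "matmul n (matmul n (scal n Xp) (Eu 1 i 1)) A = (\<lambda>a b. if a = 1 then xvar * A i b else 0)"
  proof -
    have "matmul n (scal n Xp) (Eu 1 i 1) = (Eu 1 i xvar :: 'k kmat)"
      unfolding matmul_scal_left[OF E1] by (auto simp: Eu_def fun_eq_iff embR_Xp)
    then show ?thesis using i by (simp only: matmul_Eu_left)
  qed
  also have "\<dots> = (\<lambda>a b. \<Sum>k<n. F k a b)"
  proof (intro ext)
    fix a b
    show "(if a = 1 then xvar * A i b else 0) = (\<Sum>k<n. F k a b)"
    proof (cases "a = 1 \<and> b \<in> {1..n}")
      case True
      have "(\<Sum>k<n. F k a b) = (\<Sum>k<n. if k = b - 1 then xvar * A i b else 0)"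
        using True x0 by (intro sum.cong) (auto simp: F_def Eu_def embR_unR)
      also have "\<dots> = xvar * A i b" using True by auto
      finally show ?thesis using True by simp
    next
      case False
      then have "(\<Sum>k<n. F k a b) = 0" by (intro sum.neutral) (auto simp: F_def Eu_def)
      moreover have "a = 1 \<Longrightarrow> A i b = 0" using False Lam_support[OF A] by blast
      ultimately show ?thesis by simp
    qed
  qed
  finally have "mact M (matmul n (matmul n (scal n Xp) (Eu 1 i 1)) A) x = mlc n M (\<lambda>_. 1) (\<lambda>k. mact M (F k) x) n"
    using act_matsum[OF FL x] by simp
  moreover have "mact M (matmul n (matmul n (scal n Xp) (Eu 1 i 1)) A) x = msm n M Xp (tp M i (mact M A x))"
    using A BL x E1 by (simp add: act_matmul)
  moreover have "mlc n M (\<lambda>_. 1) (\<lambda>k. mact M (F k) x) n = mlc n M (\<lambda>k. unR (xvar * A i (Suc k))) (\<lambda>k. tp M (Suc k) x) n"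
  proof -
    have "mlc n M (\<lambda>_. 1) (\<lambda>k. mact M (F k) x) m = mlc n M (\<lambda>k. unR (xvar * A i (Suc k))) (\<lambda>k. tp M (Suc k) x) m" if "m \<le> n" for m
      using that x by (induction m) (simp_all add: F act_matmul)
    then show ?thesis by simp
  qed
  ultimately show ?thesis by simp
qed

end

section \<open>Torsion-free modules are determined by their components\<close>

definition torsion_free :: "nat \<Rightarrow> ('k::field poly fract, 'a) lmod \<Rightarrow> bool" where
  "torsion_free n M \<longleftrightarrow> (\<forall>p x. x \<in> mcar M \<and> msm n M p x = mzero M \<longrightarrow> p = 0 \<or> x = mzero M)"

locale tf_lmodule = lmodule n M
  for n :: nat and M :: "('k::field poly fract, 'a) lmod" +
  assumes tf: "torsion_free n M"
begin

lemma sm_eq_0D: "x \<in> mcar M \<Longrightarrow> msm n M p x = mzero M \<Longrightarrow> p = 0 \<or> x = mzero M"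
  using tf[unfolded torsion_free_def, THEN spec, THEN spec, of x p] by blast

lemma sm_cancel:
  assumes "x \<in> mcar M" "y \<in> mcar M" "p \<noteq> 0" "msm n M p x = msm n M p y"
  shows "x = y"
proof -
  have "msm n M p (mplus M x (msm n M (-1) y)) = mplus M (msm n M p x) (msm n M (-1) (msm n M p y))"
    using assms act_sm[of "scal n p" y "-1"] by (simp add: sm_add_right)
  also have "\<dots> = mzero M" using assms by simp
  finally have "mplus M x (msm n M (-1) y) = mzero M"
    using sm_eq_0D[of "mplus M x (msm n M (-1) y)" p] assms by simp
  then show ?thesis using neg_eq_iff assms by simp
qed

text \<open>x^2 times the identity is the sum of the products of x^2 E_k1 with E_1k. Hence x^2 kills
  an element whose components all vanish.\<close>

lemma eq_0_if_tp:
  assumes x: "x \<in> mcar M" and z: "\<And>i. i \<in> {1..n} \<Longrightarrow> tp M i x = mzero M"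
  shows "x = mzero M"
proof -
  define F where "F = (\<lambda>k. Eu (Suc k) (Suc k) (xvar * xvar) :: 'k kmat)"
  have E: "(Eu i 1 (xvar * xvar) :: 'k kmat) \<in> Lam n" if "i \<in> {1..n}" for i
    using that by (intro Eu_in_Lam xR_square) auto
  have F: "F k = matmul n (Eu (Suc k) 1 (xvar * xvar)) (Eu 1 (Suc k) 1)" if "k < n" for k
    by (simp add: matmul_Eu_Eu F_def)
  have FL: "F k \<in> Lam n" if "k < n" for k
    unfolding F_def using that by (intro Eu_in_Lam xR_square) auto
  have Fx: "mact M (F k) x = mzero M" if "k < n" for k
    using that x z[of "Suc k"] E[of "Suc k"] by (simp add: F act_matmul)
  have "scal n (Xp * Xp) = (\<lambda>i j. \<Sum>k<n. F k i j)"
  proof (intro ext)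
    fix i j
    have "(\<Sum>k<n. F k i j) = (\<Sum>k<n. if k = i - 1 then (if i = j \<and> i \<in> {1..n} then xvar * xvar else 0) else 0)"
      by (intro sum.cong) (auto simp: F_def Eu_def)
    then show "scal n (Xp * Xp) i j = (\<Sum>k<n. F k i j)"
      unfolding scal_def embR_mult embR_Xp by auto
  qed
  then have "msm n M (Xp * Xp) x = mlc n M (\<lambda>_. 1) (\<lambda>k. mact M (F k) x) n"
    using act_matsum[OF FL x] by simp
  also have "\<dots> = mzero M" by (rule lc_zero) (simp_all add: Fx)
  finally show ?thesis using sm_eq_0D[OF x, of "Xp * Xp"] by simp
qed

lemma eq_if_tp:
  assumes x: "x \<in> mcar M" "y \<in> mcar M" and z: "\<And>i. i \<in> {1..n} \<Longrightarrow> tp M i x = tp M i y"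
  shows "x = y"
proof -
  have "mplus M x (msm n M (-1) y) = mzero M"
  proof (rule eq_0_if_tp)
    fix i assume i: "i \<in> {1..n}"
    have "tp M i (mplus M x (msm n M (-1) y)) = mplus M (tp M i x) (tp M i (msm n M (-1) y))"
      using x i by (intro act_add) auto
    also have "\<dots> = mplus M (tp M i y) (msm n M (-1) (tp M i y))"
      unfolding z[OF i] tp_sm[OF i x(2)] ..
    also have "\<dots> = mzero M" using x i by (intro add_neg) auto
    finally show "tp M i (mplus M x (msm n M (-1) y)) = mzero M" .
  qed (use x in simp)
  then show ?thesis using neg_eq_iff x by simp
qed

text \<open>The diagonal units lie in the order and are orthogonal idempotents, so elements with the
  prescribed components can be cut out one row at a time and added.\<close>

lemma ex_tp:
  assumes l: "\<And>i. i \<in> {1..n} \<Longrightarrow> l i \<in> UU M i"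
  shows "\<exists>x\<in>mcar M. \<forall>i\<in>{1..n}. tp M i x = l i"
proof -
  have "\<forall>i\<in>{1..n}. \<exists>m\<in>mcar M. l i = tp M i m" using l unfolding UU_def by blast
  then obtain m where m: "\<And>i. i \<in> {1..n} \<Longrightarrow> m i \<in> mcar M \<and> l i = tp M i (m i)"
    by metis
  define b where "b = (\<lambda>k. mact M (Eu (Suc k) (Suc k) 1) (m (Suc k)))"
  have b: "b k \<in> mcar M" if "k < n" for k using m[of "Suc k"] that by (simp add: b_def)
  have "tp M i (mlc n M (\<lambda>_. 1) b n) = l i" if i: "i \<in> {1..n}" for i
  proof -
    have tb: "tp M i (b k) = (if Suc k = i then l i else mzero M)" if "k < n" for k
      using m[of "Suc k"] that i unfolding b_def
      by (auto simp: act_Eu_Eu act_Eu_Eu0)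
    have i1: "i - 1 < n" using i n2 by auto
    have "tp M i (mlc n M (\<lambda>_. 1) b n) = mlc n M (\<lambda>_. 1) (\<lambda>k. tp M i (b k)) n"
      using b i by (intro act_lc) auto
    also have "\<dots> = msm n M 1 (tp M i (b (i - 1)))"
      using b i tb m[OF i] by (intro lc_single) (auto split: if_splits)
    also have "\<dots> = l i" using tb[OF i1] i i1 m[OF i] by simp
    finally show ?thesis .
  qed
  then show ?thesis using b by (intro bexI[of _ "mlc n M (\<lambda>_. 1) b n"]) auto
qed

end

section \<open>Homomorphisms, direct sums and the rank one modules\<close>

lemma hom_closed: "hom n M N f \<Longrightarrow> x \<in> mcar M \<Longrightarrow> f x \<in> mcar N"
  by (simp add: hom_def)

lemma hom_add: "hom n M N f \<Longrightarrow> x \<in> mcar M \<Longrightarrow> y \<in> mcar M \<Longrightarrow> f (mplus M x y) = mplus N (f x) (f y)"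
  by (simp add: hom_def)

lemma hom_act: "hom n M N f \<Longrightarrow> A \<in> Lam n \<Longrightarrow> x \<in> mcar M \<Longrightarrow> f (mact M A x) = mact N A (f x)"
  by (simp add: hom_def)

lemma hom_comp: "hom n M N f \<Longrightarrow> hom n N Q g \<Longrightarrow> hom n M Q (\<lambda>x. g (f x))"
  by (simp add: hom_def)

lemma hom_id: "hom n M M (\<lambda>x. x)"
  by (simp add: hom_def)

lemma hom_zero: "is_lmod n M \<Longrightarrow> is_lmod n N \<Longrightarrow> hom n M N f \<Longrightarrow> f (mzero M) = mzero N"
proof -
  assume "is_lmod n M" "is_lmod n N" and f: "hom n M N f"
  then interpret M: rmod "mcar M" "mplus M" "mzero M" "msm n M" + N: rmod "mcar N" "mplus N" "mzero N" "msm n N"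
    by (simp_all add: is_lmod_rmod)
  have "f (msm n M 0 (mzero M)) = msm n N 0 (f (mzero M))"
    using f by (intro hom_act) auto
  then show ?thesis using hom_closed[OF f, of "mzero M"] by simp
qed

lemma hom_lc:
  assumes "is_lmod n M" "is_lmod n N" and f: "hom n M N f" and "\<And>j. j < r \<Longrightarrow> b j \<in> mcar M"
  shows "f (mlc n M a b r) = mlc n N a (\<lambda>j. f (b j)) r"
proof -
  from assms interpret M: rmod "mcar M" "mplus M" "mzero M" "msm n M"
    by (simp add: is_lmod_rmod)
  show ?thesis using assms(4)
    by (induction r) (simp_all add: hom_zero[OF assms(1-3)] hom_add[OF f] hom_act[OF f])
qed

lemma hom_tp_UU: "hom n M N f \<Longrightarrow> is_lmod n M \<Longrightarrow> 2 \<le> n \<Longrightarrow> i \<in> {1..n} \<Longrightarrow> x \<in> UU M i \<Longrightarrow> f x \<in> UU N i"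
proof -
  assume f: "hom n M N f" and "is_lmod n M" "2 \<le> n" and i: "i \<in> {1..n}" and x: "x \<in> UU M i"
  then interpret lmodule n M by unfold_locales
  obtain y where y: "y \<in> mcar M" "x = tp M i y" using x by (auto simp: UU_def)
  then have "f x = tp N i (f y)" using f i by (simp add: hom_act)
  then show ?thesis using y f by (auto intro: UU_I hom_closed)
qed

lemma hom_inv:
  assumes M: "is_lmod n M" and f: "hom n M N f" and b: "bij_betw f (mcar M) (mcar N)"
  shows "hom n N M (inv_into (mcar M) f)" "bij_betw (inv_into (mcar M) f) (mcar N) (mcar M)"
proof -
  let ?g = "inv_into (mcar M) f"
  interpret M: rmod "mcar M" "mplus M" "mzero M" "msm n M" using M by (rule is_lmod_rmod)
  show g: "bij_betw ?g (mcar N) (mcar M)" using b by (rule bij_betw_inv_into)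
  have gc: "?g y \<in> mcar M" if "y \<in> mcar N" for y using g that by (rule bij_betwE[THEN bspec])
  have fg: "f (?g y) = y" if "y \<in> mcar N" for y using b that by (rule bij_betw_inv_into_right)
  have gf: "?g (f x) = x" if "x \<in> mcar M" for x using b that by (rule bij_betw_inv_into_left)
  have "?g (mplus N x y) = mplus M (?g x) (?g y)" if "x \<in> mcar N" "y \<in> mcar N" for x y
  proof -
    have "f (mplus M (?g x) (?g y)) = mplus N x y" using f gc fg that by (simp add: hom_add)
    then show ?thesis using gf[of "mplus M (?g x) (?g y)"] gc that by simp
  qed
  moreover have "?g (mact N A x) = mact M A (?g x)" if "x \<in> mcar N" "A \<in> Lam n" for x A
  proof -
    have "f (mact M A (?g x)) = mact N A x" using f gc fg that by (simp add: hom_act)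
    moreover have "mact M A (?g x) \<in> mcar M" using M gc that by (simp add: is_lmod_def)
    ultimately show ?thesis using gf by metis
  qed
  ultimately show "hom n N M ?g" using gc by (simp add: hom_def)
qed

lemma iso_refl: "iso n M M"
  unfolding iso_def using hom_id bij_betw_id[unfolded id_def] by blast

lemma iso_sym: "is_lmod n M \<Longrightarrow> iso n M N \<Longrightarrow> iso n N M"
  unfolding iso_def using hom_inv by blast

lemma iso_trans: "iso n M N \<Longrightarrow> iso n N Q \<Longrightarrow> iso n M Q"
proof -
  assume "iso n M N" "iso n N Q"
  then obtain f g where "hom n M N f" "hom n N Q g" "bij_betw f (mcar M) (mcar N)" "bij_betw g (mcar N) (mcar Q)"
    unfolding iso_def by blast
  then have "hom n M Q (\<lambda>x. g (f x))" "bij_betw (\<lambda>x. g (f x)) (mcar M) (mcar Q)"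
    using bij_betw_trans[of f "mcar M" "mcar N" g "mcar Q"] by (auto intro: hom_comp simp: o_def)
  then show ?thesis unfolding iso_def by blast
qed

lemma iso_inverse:
  assumes "is_lmod n M" "iso n M N"
  obtains f g where "hom n M N f" "hom n N M g" "\<And>x. x \<in> mcar M \<Longrightarrow> g (f x) = x" "\<And>y. y \<in> mcar N \<Longrightarrow> f (g y) = y"
proof -
  obtain f where f: "hom n M N f" "bij_betw f (mcar M) (mcar N)"
    using assms(2) by (auto simp: iso_def)
  show ?thesis
    by (rule that[OF f(1) hom_inv(1)[OF assms(1) f]])
      (use f(2) in \<open>auto simp: bij_betw_inv_into_left bij_betw_inv_into_right\<close>)
qed

lemma isoI:
  assumes "hom n M N f" "hom n N M g" "\<And>x. x \<in> mcar M \<Longrightarrow> g (f x) = x" "\<And>y. y \<in> mcar N \<Longrightarrow> f (g y) = y"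
  shows "iso n M N"
proof -
  have "bij_betw f (mcar M) (mcar N)"
    by (rule bij_betw_byWitness[where f' = g]) (use assms in \<open>auto simp: hom_def\<close>)
  then show ?thesis using assms(1) by (auto simp: iso_def)
qed

text \<open>The inclusion of the \<open>k\<close>-th summand, used for \<open>k < length Ms\<close>.
  The value \<open>undefined\<close> past the end is required by the carrier of
  \<open>dsum_list\<close>.\<close>

definition dinj where
  "dinj Ms k x = (\<lambda>i. if i = k then x else if i < length Ms then mzero (Ms ! i) else undefined)"

lemma is_lmod_comm: "is_lmod n M \<Longrightarrow> x \<in> mcar M \<Longrightarrow> y \<in> mcar M \<Longrightarrow> mplus M x y = mplus M y x"
  by (simp add: is_lmod_def)

lemma is_lmod_group:
  assumes "is_lmod n M"
  shows "mzero M \<in> mcar M"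
    "x \<in> mcar M \<Longrightarrow> y \<in> mcar M \<Longrightarrow> mplus M x y \<in> mcar M"
    "x \<in> mcar M \<Longrightarrow> y \<in> mcar M \<Longrightarrow> z \<in> mcar M \<Longrightarrow> mplus M (mplus M x y) z = mplus M x (mplus M y z)"
    "x \<in> mcar M \<Longrightarrow> mplus M (mzero M) x = x"
proof -
  interpret rmod "mcar M" "mplus M" "mzero M" "msm n M" using assms by (rule is_lmod_rmod)
  show "mzero M \<in> mcar M" by simp
qed (use rmod.add_closed[OF is_lmod_rmod[OF assms]] rmod.assoc[OF is_lmod_rmod[OF assms]] rmod.zero_left[OF is_lmod_rmod[OF assms]] in blast)+

lemma is_lmod_act:
  assumes "is_lmod n M"
  shows "A \<in> Lam n \<Longrightarrow> x \<in> mcar M \<Longrightarrow> mact M A x \<in> mcar M"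
    "A \<in> Lam n \<Longrightarrow> x \<in> mcar M \<Longrightarrow> y \<in> mcar M \<Longrightarrow> mact M A (mplus M x y) = mplus M (mact M A x) (mact M A y)"
    "A \<in> Lam n \<Longrightarrow> B \<in> Lam n \<Longrightarrow> x \<in> mcar M \<Longrightarrow> mact M (matadd A B) x = mplus M (mact M A x) (mact M B x)"
    "A \<in> Lam n \<Longrightarrow> B \<in> Lam n \<Longrightarrow> x \<in> mcar M \<Longrightarrow> mact M (matmul n A B) x = mact M A (mact M B x)"
    "x \<in> mcar M \<Longrightarrow> mact M (idm n) x = x"
  using assms by (simp_all add: is_lmod_def)

lemmas is_lmod_rules = is_lmod_group is_lmod_act

lemma is_lmod_dsum_list:
  assumes "\<And>X. X \<in> set Ms \<Longrightarrow> is_lmod n X"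
  shows "is_lmod n (dsum_list Ms)"
proof -
  have *: "is_lmod n (Ms ! i)" if "i < length Ms" for i using assms that by simp
  have inv: "\<exists>y\<in>mcar (dsum_list Ms). mplus (dsum_list Ms) x y = mzero (dsum_list Ms)" if "x \<in> mcar (dsum_list Ms)" for x
  proof -
    have "\<forall>i. \<exists>y. i < length Ms \<longrightarrow> y \<in> mcar (Ms ! i) \<and> mplus (Ms ! i) (x i) y = mzero (Ms ! i)"
    proof (intro allI)
      fix i
      show "\<exists>y. i < length Ms \<longrightarrow> y \<in> mcar (Ms ! i) \<and> mplus (Ms ! i) (x i) y = mzero (Ms ! i)"
      proof (cases "i < length Ms")
        case True
        then have "x i \<in> mcar (Ms ! i)" using that by (simp add: dsum_list_def)
        then show ?thesis using rmod.inverse_ex[OF is_lmod_rmod[OF *[OF True]]] by blast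
      qed simp
    qed
    then obtain y where "\<And>i. i < length Ms \<Longrightarrow> y i \<in> mcar (Ms ! i) \<and> mplus (Ms ! i) (x i) (y i) = mzero (Ms ! i)"
      by metis
    then show ?thesis
      by (intro bexI[of _ "\<lambda>i. if i < length Ms then y i else undefined"]) (auto simp: dsum_list_def)
  qed
  have cm: "mplus (dsum_list Ms) x y = mplus (dsum_list Ms) y x"
    if "x \<in> mcar (dsum_list Ms)" "y \<in> mcar (dsum_list Ms)" for x y
    using that *[THEN is_lmod_comm] by (simp add: dsum_list_def fun_eq_iff)
  show ?thesis unfolding is_lmod_def
  proof (intro conjI ballI inv cm)
  qed (use * in \<open>simp_all add: dsum_list_def is_lmod_rules[OF *] fun_eq_iff\<close>)
qed

lemma hom_dproj: "k < length Ms \<Longrightarrow> hom n (dsum_list Ms) (Ms ! k) (\<lambda>v. v k)"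
  by (simp add: hom_def dsum_list_def)

lemma act_mzero: "is_lmod n M \<Longrightarrow> A \<in> Lam n \<Longrightarrow> mact M A (mzero M) = mzero M"
proof -
  assume M: "is_lmod n M" and A: "A \<in> Lam n"
  interpret rmod "mcar M" "mplus M" "mzero M" "msm n M" using M by (rule is_lmod_rmod)
  have "mact M A (msm n M 0 (mzero M)) = mact M (matmul n A (scal n 0)) (mzero M)"
    using M A by (simp add: is_lmod_rules(8)[OF M])
  also have "matmul n A (scal n 0) = scal n 0"
    using A by (simp add: matmul_scal_right) (simp add: scal_def fun_eq_iff)
  finally show ?thesis by simp
qed

lemma hom_dinj: "(\<And>X. X \<in> set Ms \<Longrightarrow> is_lmod n X) \<Longrightarrow> k < length Ms \<Longrightarrow> hom n (Ms ! k) (dsum_list Ms) (dinj Ms k)"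
proof -
  assume Ms: "\<And>X. X \<in> set Ms \<Longrightarrow> is_lmod n X" and k: "k < length Ms"
  have z: "mplus X (mzero X) (mzero X) = mzero X \<and> mzero X \<in> mcar X" if "X \<in> set Ms" for X
    using Ms[OF that] by (simp add: is_lmod_def)
  have az: "mact X A (mzero X) = mzero X" if "X \<in> set Ms" "A \<in> Lam n" for X A
    using act_mzero[OF Ms[OF that(1)] that(2)] .
  show ?thesis using k z az unfolding hom_def
    by (auto simp: dsum_list_def dinj_def fun_eq_iff)
qed

lemma dinj_same [simp]: "dinj Ms k x k = x"
  by (simp add: dinj_def)

type_synonym 'k vec = "nat \<Rightarrow> 'k poly fract"

definition vact :: "nat \<Rightarrow> 'k::field kmat \<Rightarrow> 'k vec \<Rightarrow> 'k vec" where
  "vact n A v = (\<lambda>i. if i \<in> {1..n} then \<Sum>k\<in>{1..n}. A i k * v k else 0)"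

definition ev :: "nat \<Rightarrow> nat \<Rightarrow> nat \<Rightarrow> int" where
  "ev s t i = (if i \<le> s then 0 else if i \<le> t then 1 else 2)"

lemma stmod_sel:
  "mcar (stmod n s t) = {v. (\<forall>i. i \<notin> {1..n} \<longrightarrow> v i = 0) \<and> (\<forall>i\<in>{1..n}. xR (ev s t i) (v i))}"
  "mplus (stmod n s t) = (\<lambda>v w i. v i + w i)"
  "mzero (stmod n s t) = (\<lambda>i. 0)"
  "mact (stmod n s t) = vact n"
  by (simp_all add: stmod_def ev_def vact_def fun_eq_iff)

definition valid :: "nat \<Rightarrow> nat \<times> nat \<Rightarrow> bool" where
  "valid n p \<longleftrightarrow> 1 \<le> fst p \<and> fst p < snd p \<and> snd p \<le> n"

lemma vact_add: "vact n A (\<lambda>i. v i + w i) = (\<lambda>i. vact n A v i + vact n A w i)"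
  by (auto simp: vact_def fun_eq_iff sum.distrib distrib_left)

lemma vact_matadd: "vact n (matadd A B) v = (\<lambda>i. vact n A v i + vact n B v i)"
  by (auto simp: vact_def matadd_def fun_eq_iff sum.distrib distrib_right)

lemma vact_matmul: "vact n (matmul n A B) v = vact n A (vact n B v)"
proof
  fix i
  have "(\<Sum>k\<in>{1..n}. (\<Sum>m\<in>{1..n}. A i m * B m k) * v k) = (\<Sum>m\<in>{1..n}. A i m * (\<Sum>k\<in>{1..n}. B m k * v k))"
    unfolding sum_distrib_left sum_distrib_right by (subst sum.swap) (simp add: mult.assoc)
  then show "vact n (matmul n A B) v i = vact n A (vact n B v) i"
    by (simp add: vact_def matmul_def)
qed

lemma vact_scal: "vact n (scal n p) v = (\<lambda>i. if i \<in> {1..n} then embR p * v i else 0)"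
proof
  fix i
  have "(\<Sum>k\<in>{1..n}. scal n p i k * v k) = (\<Sum>k\<in>{1..n}. if k = i then embR p * v i else 0)" if "i \<in> {1..n}"
    using that by (intro sum.cong) (auto simp: scal_def)
  then show "vact n (scal n p) v i = (if i \<in> {1..n} then embR p * v i else 0)"
    by (simp add: vact_def)
qed

lemma vact_Eu: "i \<in> {1..n} \<Longrightarrow> j \<in> {1..n} \<Longrightarrow> vact n (Eu i j r) v = (\<lambda>k. if k = i then r * v j else 0)"
proof
  fix k assume ij: "i \<in> {1..n}" "j \<in> {1..n}"
  have *: "(\<Sum>m\<in>{1..n}. Eu i j r k m * v m) = (\<Sum>m\<in>{1..n}. if m = j then (if k = i then r * v j else 0) else 0)"
    by (intro sum.cong) (auto simp: Eu_def)
  show "vact n (Eu i j r) v k = (if k = i then r * v j else 0)"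
    unfolding vact_def * using ij by auto
qed

text \<open>The exponent inequality that makes the lattice \<open>(s, t)\<close> stable under the
  order. As \<open>s < t\<close>, the exponent rises by at most one per row, and as
  \<open>s < n\<close>, the last exponent is at least 1, which pays for the corner entry
  x^(-1).\<close>

lemma ev_cexp: "1 \<le> s \<Longrightarrow> s < t \<Longrightarrow> t \<le> n \<Longrightarrow> i \<in> {1..n} \<Longrightarrow> j \<in> {1..n} \<Longrightarrow> ev s t i \<le> cexp n i j + ev s t j"
  by (auto simp: ev_def cexp_def)

lemma vact_stmod:
  assumes "valid n (s, t)" "A \<in> Lam n" "v \<in> mcar (stmod n s t)"
  shows "vact n A v \<in> mcar (stmod n s t)"
proof -
  have "xR (ev s t i) (\<Sum>k\<in>{1..n}. A i k * v k)" if "i \<in> {1..n}" for i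
  proof (rule xR_sum)
    fix k assume k: "k \<in> {1..n}"
    then have "xR (cexp n i k + ev s t k) (A i k * v k)"
      using assms that by (intro xR_mult Lam_xR) (auto simp: stmod_sel)
    then show "xR (ev s t i) (A i k * v k)"
      using ev_cexp[of s t n i k] assms(1) that k by (auto simp: valid_def intro: xR_mono)
  qed
  then show ?thesis by (simp add: stmod_sel vact_def)
qed

lemma is_lmod_stmod: "valid n (s, t) \<Longrightarrow> is_lmod n (stmod n s t :: 'k::field umod)"
proof -
  assume v: "valid n (s, t)"
  have "vact n (idm n) x = x" if "x \<in> mcar (stmod n s t)" for x :: "'k vec"
    using that vact_scal[of n 1 x] by (auto simp: scal_1 stmod_sel fun_eq_iff)
  moreover have "\<exists>y\<in>mcar (stmod n s t). (\<lambda>i. x i + y i) = (\<lambda>i. 0)"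
    if "x \<in> mcar (stmod n s t)" for x :: "'k vec"
    using that by (intro bexI[of _ "\<lambda>i. - x i"]) (auto simp: stmod_sel xR_minus)
  moreover have "(\<lambda>i. x i + y i) \<in> mcar (stmod n s t)"
    if "x \<in> mcar (stmod n s t)" "y \<in> mcar (stmod n s t)" for x y :: "'k vec"
    using that by (auto simp: stmod_sel xR_add)
  moreover have "(\<lambda>i. 0 :: 'k poly fract) \<in> mcar (stmod n s t)" by (simp add: stmod_sel)
  ultimately show ?thesis
    unfolding is_lmod_def stmod_sel(2-4)
    by (simp add: vact_add vact_matadd vact_matmul vact_stmod[OF v] ac_simps)
qed

definition SM where "SM n p = stmod n (fst p) (snd p)"
type_synonym 'k gmod = "('k poly fract, nat \<Rightarrow> 'k vec) lmod"

definition DS where "DS n ts = dsum_list (map (SM n) ts)"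

lemma is_lmod_SM: "valid n p \<Longrightarrow> is_lmod n (SM n p)"
  unfolding SM_def by (rule is_lmod_stmod) simp

lemma is_lmod_DS: "list_all (valid n) ts \<Longrightarrow> is_lmod n (DS n ts)"
  unfolding DS_def by (rule is_lmod_dsum_list) (auto simp: list_all_iff is_lmod_SM)

lemma SM_mcar: "v \<in> mcar (SM n p) \<longleftrightarrow> (\<forall>i. i \<notin> {1..n} \<longrightarrow> v i = 0) \<and> (\<forall>i\<in>{1..n}. xR (ev (fst p) (snd p) i) (v i))"
  by (simp add: SM_def stmod_sel)

lemma ev_ge_0: "0 \<le> ev s t i" by (simp add: ev_def)

lemma SM_R: "v \<in> mcar (SM n p) \<Longrightarrow> xR 0 (v i)"
  by (cases "i \<in> {1..n}") (auto simp: SM_mcar intro: xR_mono[OF _ ev_ge_0])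

lemma DS_mcar: "v \<in> mcar (DS n ts) \<longleftrightarrow> (\<forall>k<length ts. v k \<in> mcar (SM n (ts ! k))) \<and> (\<forall>k\<ge>length ts. v k = undefined)"
  by (auto simp: DS_def dsum_list_def)

lemma DS_mplus: "k < length ts \<Longrightarrow> mplus (DS n ts) v w k i = v k i + w k i"
  by (simp add: DS_def dsum_list_def SM_def stmod_sel)

lemma DS_mzero: "k < length ts \<Longrightarrow> mzero (DS n ts) k i = 0"
  by (simp add: DS_def dsum_list_def SM_def stmod_sel)

lemma DS_mact: "k < length ts \<Longrightarrow> mact (DS n ts) A v k = vact n A (v k)"
  by (simp add: DS_def dsum_list_def SM_def stmod_sel)

lemma DS_eqI: "v \<in> mcar (DS n ts) \<Longrightarrow> w \<in> mcar (DS n ts) \<Longrightarrow>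
    (\<And>k i. k < length ts \<Longrightarrow> i \<in> {1..n} \<Longrightarrow> v k i = w k i) \<Longrightarrow> v = w"
proof
  fix k assume v: "v \<in> mcar (DS n ts)" "w \<in> mcar (DS n ts)"
    and eq: "\<And>k i. k < length ts \<Longrightarrow> i \<in> {1..n} \<Longrightarrow> v k i = w k i"
  show "v k = w k"
  proof (cases "k < length ts")
    case True
    show ?thesis
    proof
      fix i show "v k i = w k i"
        using v True eq[OF True, of i] by (cases "i \<in> {1..n}") (auto simp: DS_mcar SM_mcar)
    qed
  qed (use v in \<open>auto simp: DS_mcar\<close>)
qed

lemma DS_lc: "k < length ts \<Longrightarrow> i \<in> {1..n} \<Longrightarrow> mlc n (DS n ts) a b r k i = (\<Sum>j<r. embR (a j) * b j k i)"
  by (induction r) (simp_all add: DS_mzero DS_mplus DS_mact vact_scal)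

lemma torsion_free_DS: "list_all (valid n) ts \<Longrightarrow> torsion_free n (DS n ts)"
  unfolding torsion_free_def
proof (intro allI impI disjCI)
  fix p :: "'a poly" and x
  assume ts: "list_all (valid n) ts" and x: "x \<in> mcar (DS n ts) \<and> msm n (DS n ts) p x = mzero (DS n ts)"
    and "x \<noteq> mzero (DS n ts)"
  interpret rmod "mcar (DS n ts :: 'a gmod)" "mplus (DS n ts)" "mzero (DS n ts)" "msm n (DS n ts)"
    using ts by (intro is_lmod_rmod is_lmod_DS)
  obtain k i where ki: "k < length ts" "i \<in> {1..n}" "x k i \<noteq> mzero (DS n ts) k i"
    using DS_eqI[of x n ts "mzero (DS n ts)"] x \<open>x \<noteq> mzero (DS n ts)\<close> zero_closed by blast
  have "msm n (DS n ts) p x k i = 0" using x ki by (simp add: DS_mzero)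
  then have "embR p * x k i = 0" using ki by (simp add: DS_mact vact_scal)
  then show "p = 0" using ki by (simp add: DS_mzero)
qed

lemma spans_DS:
  assumes "list_all (valid n) ts" "1 \<le> n"
  shows "\<exists>r b. rmod.spans (mcar (DS n ts :: 'k::field gmod))
     (mplus (DS n ts)) (mzero (DS n ts)) (msm n (DS n ts)) r b"
proof -
  let ?D = "DS n ts :: 'k::field gmod"
  let ?e = "\<lambda>k. ev (fst (ts ! k)) (snd (ts ! k))"
  interpret rmod "mcar ?D" "mplus ?D" "mzero ?D" "msm n ?D"
    using assms by (intro is_lmod_rmod is_lmod_DS)
  \<comment> \<open>The number \<open>q = k * n + (i - 1)\<close> encodes summand \<open>k\<close>
    and row \<open>i\<close>, and \<open>b q\<close> is the smallest admissible power of x in that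
    place.\<close>
  define b :: "nat \<Rightarrow> nat \<Rightarrow> 'k vec" where
    "b = (\<lambda>q k. if k < length ts then (\<lambda>i. if k = q div n \<and> i = Suc (q mod n) then xvar powi ?e k i else 0) else undefined)"
  have b: "b q \<in> mcar ?D" for q
  proof -
    have "q mod n < n" using assms(2) by simp
    then show ?thesis by (auto simp: DS_mcar SM_mcar b_def)
  qed
  have "\<exists>a. v = lc (mplus ?D) (mzero ?D) (msm n ?D) a b (length ts * n)" if v: "v \<in> mcar ?D" for v
  proof -
    define a where "a = (\<lambda>q. unR (v (q div n) (Suc (q mod n)) * xvar powi (- ?e (q div n) (Suc (q mod n)))))"
    have "v k i = mlc n ?D a b (length ts * n) k i" if k: "k < length ts" and i: "i \<in> {1..n}" for k i
    proof -
      let ?q = "k * n + (i - 1)"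
      obtain i' where i': "i = Suc i'" "i' < n" using i by (cases i) auto
      then have q: "?q div n = k" "Suc (?q mod n) = i" by auto
      have ql: "?q < length ts * n"
      proof -
        have "?q < Suc k * n" using i by auto
        also have "\<dots> \<le> length ts * n" using k by (intro mult_le_mono1) simp
        finally show ?thesis .
      qed
      have uniq: "q = ?q" if "k = q div n" "i = Suc (q mod n)" for q
        using that div_mult_mod_eq[of q n] by simp
      have "xR 0 (v k i * xvar powi (- ?e k i))"
        using v k i by (simp add: xR_shift DS_mcar SM_mcar)
      then have "embR (a ?q) * xvar powi ?e k i = v k i"
        unfolding a_def q by (simp add: embR_unR mult.assoc flip: power_int_add)
      moreover have "mlc n ?D a b (length ts * n) k i = (\<Sum>q<length ts * n. embR (a q) * b q k i)"
        using k i by (rule DS_lc)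
      moreover have "\<dots> = (\<Sum>q<length ts * n. if q = ?q then embR (a ?q) * xvar powi ?e k i else 0)"
      proof (intro sum.cong refl)
        fix q
        show "embR (a q) * b q k i = (if q = ?q then embR (a ?q) * xvar powi ?e k i else 0)"
        proof (cases "q = ?q")
          case True
          show ?thesis unfolding True b_def by (simp only: q k if_True simp_thms)
        next
          case False
          then have "\<not> (k = q div n \<and> i = Suc (q mod n))" using uniq[of q] by blast
          then have "b q k i = 0" using k by (auto simp: b_def)
          then show ?thesis using False by simp
        qed
      qed
      ultimately show ?thesis using ql by simp
    qed
    then show ?thesis using v b by (intro exI[of _ a] DS_eqI) auto
  qed
  then show ?thesis unfolding spans_def using b by blast
qed

section \<open>Maps out of sums of rank one modules and the classification\<close>

context tf_lmodule
begin

text \<open>A map from \<open>(s, t)\<close> is determined by the image \<open>y\<close> of the unit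
  vector in row 1. Admissible are the elements of the s-th submodule for which \<open>x y\<close>
  lies in the t-th. On the i-th component the map multiplies \<open>y\<close> by the i-th
  coordinate.\<close>

lemma construct:
  assumes ts: "list_all (valid n) ts"
    and y: "\<And>k. k < length ts \<Longrightarrow> y k \<in> UU M (fst (ts ! k)) \<and> msm n M Xp (y k) \<in> UU M (snd (ts ! k))"
  obtains f where "hom n (DS n ts) M f"
    "\<And>v i. v \<in> mcar (DS n ts) \<Longrightarrow> i \<in> {1..n} \<Longrightarrow> tp M i (f v) = mlc n M (\<lambda>k. unR (v k i)) y (length ts)"
proof -
  let ?r = "length ts"
  let ?L = "\<lambda>v i. mlc n M (\<lambda>k. unR (v k i)) y ?r"
  have va: "valid n (ts ! k)" if "k < ?r" for k using ts that by (simp add: list_all_length)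
  have yU: "y k \<in> UU M 1" if "k < ?r" for k
    using y[OF that] va[OF that] UU_subset_1[of "fst (ts ! k)"] by (auto simp: valid_def)
  have yC: "y k \<in> mcar M" if "k < ?r" for k
    using yU[OF that] by (simp only: UU_1_iff)
  \<comment> \<open>The three ranges of \<open>i\<close> match the exponents 0, 1 and 2:
    \<open>y\<close> itself, \<open>x y\<close>, or x^2 times anything lies deep enough in the
    chain.\<close>
  have LU: "?L v i \<in> UU M i" if v: "v \<in> mcar (DS n ts)" and i: "i \<in> {1..n}" for v i
  proof (rule ch.U_lc[OF i])
    fix k assume k: "k < ?r"
    let ?s = "fst (ts ! k)" and ?t = "snd (ts ! k)"
    have st: "1 \<le> ?s" "?s < ?t" "?t \<le> n" using va[OF k] by (auto simp: valid_def)
    have "xR (ev ?s ?t i) (v k i)" "xR 0 (v k i)"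
      using v k i SM_R[of "v k" n "ts ! k"] by (auto simp: DS_mcar SM_mcar)
    then obtain p where p: "v k i = embR p" "xR (ev ?s ?t i) (embR p)" by (auto simp: xR_0_iff)
    consider "i \<le> ?s" | "?s < i" "i \<le> ?t" | "?t < i" by linarith
    then have "msm n M p (y k) \<in> UU M i"
    proof cases
      case 1
      then show ?thesis using y[OF k] ch.U_antimono[of i ?s] st i UU_sm by auto
    next
      case 2
      then have "msm n M Xp (y k) \<in> UU M i" using y[OF k] ch.U_antimono[of i ?t] st by auto
      moreover have "coeff p 0 = 0" using p(2) 2 by (simp add: ev_def xR_1_embR)
      ultimately show ?thesis using ch.U_Xdvd[OF i yU[OF k]] by blast
    next
      case 3
      then have "Xp ^ 2 dvd p" using p(2) st xR_embR_pow[of 2 p] by (simp add: ev_def)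
      then obtain q where "p = q * (Xp * Xp)" by (metis dvd_def mult.commute power2_eq_square)
      then have "msm n M p (y k) = msm n M q (msm n M Xp (msm n M Xp (y k)))"
        using yC[OF k] by (simp only: sm_mult sm_closed)
      then show ?thesis using UU_XX[OF i yU[OF k]] UU_sm[OF i] by metis
    qed
    then show "msm n M (unR (v k i)) (y k) \<in> UU M i" by (simp add: p(1))
  qed
  \<comment> \<open>Existence of such an element is \<open>ex_tp\<close> and uniqueness is
    \<open>eq_if_tp\<close>.\<close>
  define f where "f = (\<lambda>v. THE x. x \<in> mcar M \<and> (\<forall>i\<in>{1..n}. tp M i x = ?L v i))"
  have f: "f v \<in> mcar M \<and> (\<forall>i\<in>{1..n}. tp M i (f v) = ?L v i)" if v: "v \<in> mcar (DS n ts)" for v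
    unfolding f_def
  proof (rule theI')
    obtain x where x: "x \<in> mcar M" "\<forall>i\<in>{1..n}. tp M i x = ?L v i"
      using ex_tp[of "?L v"] LU[OF v] by blast
    show "\<exists>!x. x \<in> mcar M \<and> (\<forall>i\<in>{1..n}. tp M i x = ?L v i)"
      by (rule ex1I[of _ x]) (use x eq_if_tp in auto)
  qed
  interpret D: lmodule n "DS n ts" using is_lmod_DS[OF ts] n2 by unfold_locales
  have vR: "xR 0 (v k i)" if "v \<in> mcar (DS n ts)" "k < ?r" for v :: "nat \<Rightarrow> 'k vec" and k i
    using that SM_R[of "v k" n "ts ! k"] by (auto simp: DS_mcar)
  have "hom n (DS n ts) M f"
    unfolding hom_def
  proof (intro conjI ballI)
    fix v :: "nat \<Rightarrow> 'k vec" assume v: "v \<in> mcar (DS n ts)"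
    show "f v \<in> mcar M" using f[OF v] by simp
  next
    fix v w :: "nat \<Rightarrow> 'k vec" assume vw: "v \<in> mcar (DS n ts)" "w \<in> mcar (DS n ts)"
    show "f (mplus (DS n ts) v w) = mplus M (f v) (f w)"
    proof (rule eq_if_tp)
      fix i assume i: "i \<in> {1..n}"
      have "tp M i (f (mplus (DS n ts) v w)) = ?L (mplus (DS n ts) v w) i"
        using f[OF D.add_closed[OF vw]] i by blast
      also have "\<dots> = mlc n M (\<lambda>k. unR (v k i) + unR (w k i)) y ?r"
        using vw by (intro lc_cong) (simp_all add: DS_mplus unR_add vR)
      also have "\<dots> = mplus M (?L v i) (?L w i)" using yC by (rule lc_add)
      also have "\<dots> = tp M i (mplus M (f v) (f w))"
        using f[OF vw(1)] f[OF vw(2)] i by (simp add: act_add)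
      finally show "tp M i (f (mplus (DS n ts) v w)) = tp M i (mplus M (f v) (f w))" .
    qed (use f vw D.add_closed in auto)
  next
    fix A :: "'k kmat" and v :: "nat \<Rightarrow> 'k vec" assume A: "A \<in> Lam n" and v: "v \<in> mcar (DS n ts)"
    have Av: "mact (DS n ts) A v \<in> mcar (DS n ts)" using A v by simp
    show "f (mact (DS n ts) A v) = mact M A (f v)"
    proof (rule eq_if_tp)
      fix i assume i: "i \<in> {1..n}"
      have x0: "xR 0 (xvar * A i j)" if "j \<in> {1..n}" for j
        using xR_mono[OF xR_mult[OF xR_powi[of 1] Lam_xR[OF A i that]], of 0] cexp_ge[of n i j] by simp
      \<comment> \<open>Both sides are compared after multiplication by x, where all coefficients
        are polynomials. Torsion-freeness cancels the factor at the end.\<close>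
      have "msm n M Xp (tp M i (mact M A (f v))) = mlc n M (\<lambda>j. unR (xvar * A i (Suc j))) (\<lambda>j. tp M (Suc j) (f v)) n"
        using f[OF v] by (intro row_act[OF A i]) simp
      also have "\<dots> = mlc n M (\<lambda>j. unR (xvar * A i (Suc j))) (\<lambda>j. ?L v (Suc j)) n"
        using f[OF v] by (intro lc_cong) auto
      also have "\<dots> = mlc n M (\<lambda>k. \<Sum>j<n. unR (xvar * A i (Suc j)) * unR (v k (Suc j))) y ?r"
        using yC by (rule lc_lc)
      also have "\<dots> = mlc n M (\<lambda>k. Xp * unR (mact (DS n ts) A v k i)) y ?r"
      proof (rule lc_cong)
        fix k assume k: "k < ?r"
        have "embR (\<Sum>j<n. unR (xvar * A i (Suc j)) * unR (v k (Suc j))) = (\<Sum>j<n. xvar * A i (Suc j) * v k (Suc j))"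
          unfolding embR_sum by (intro sum.cong) (auto simp: embR_mult embR_unR x0 vR[OF v k])
        also have "\<dots> = xvar * (\<Sum>j\<in>{1..n}. A i j * v k j)"
          by (simp add: sum.atLeast1_atMost_eq One_nat_def sum_distrib_left mult.assoc)
        also have "\<dots> = xvar * mact (DS n ts) A v k i"
          using k i by (simp add: DS_mact vact_def)
        also have "\<dots> = embR (Xp * unR (mact (DS n ts) A v k i))"
          unfolding embR_mult embR_Xp embR_unR[OF vR[OF Av k]] ..
        finally show "(\<Sum>j<n. unR (xvar * A i (Suc j)) * unR (v k (Suc j))) = Xp * unR (mact (DS n ts) A v k i)"
          by (simp only: embR_eq_iff)
      qed simp
      also have "\<dots> = msm n M Xp (?L (mact (DS n ts) A v) i)" using yC by (rule lc_scale)
      also have "?L (mact (DS n ts) A v) i = tp M i (f (mact (DS n ts) A v))"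
        using f[OF Av] i by simp
      finally have eq: "msm n M Xp (tp M i (mact M A (f v))) = msm n M Xp (tp M i (f (mact (DS n ts) A v)))" .
      have "tp M i (f (mact (DS n ts) A v)) \<in> mcar M" "tp M i (mact M A (f v)) \<in> mcar M"
        using f[OF v, THEN conjunct1] f[OF Av, THEN conjunct1] A i by simp_all
      then show "tp M i (f (mact (DS n ts) A v)) = tp M i (mact M A (f v))"
        using sm_cancel[OF _ _ _ eq] by simp
    qed (use f[OF v, THEN conjunct1] f[OF Av, THEN conjunct1] A in simp_all)
  qed
  then show ?thesis using that[of f] f by blast
qed

end

text \<open>The adapted basis provides both the pairs and the images for \<open>construct\<close>.
  Independence gives injectivity. For surjectivity, the components of any element have coefficients
  divisible by exactly the powers of x that membership in the modules \<open>(s, t)\<close>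
  demands.\<close>

theorem classification:
  fixes M :: "('k::field poly fract, 'a) lmod"
  assumes M: "is_lmod n M" "torsion_free n M" and n: "2 \<le> n"
    and fg: "\<exists>r b. rmod.spans (mcar M) (mplus M) (mzero M) (msm n M) r b"
  obtains ts where "list_all (valid n) ts" "iso n (DS n ts) M"
proof -
  interpret tf_lmodule n M using M n by unfold_locales
  have lc_UU: "mlc n M a (\<lambda>j. tp M 1 (b j)) r = tp M 1 (mlc n M a b r)" if "\<And>j. j < r \<Longrightarrow> b j \<in> mcar M" for a b r
    using act_lc[of "Eu 1 1 1" r b a] that by simp
  interpret ch: rchain_tf "UU M 1" "mplus M" "mzero M" "msm n M" "UU M" n
  proof (unfold_locales)
    show "x \<in> UU M 1 \<Longrightarrow> msm n M p x = mzero M \<Longrightarrow> p = 0 \<or> x = mzero M" for x p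
      using sm_eq_0D[of x p] UU_1_iff by blast
    obtain r b where b: "spans r b" using fg by blast
    have "rmod.spans (UU M 1) (mplus M) (mzero M) (msm n M) r (\<lambda>j. tp M 1 (b j))"
      unfolding ch.spans_def
    proof (intro conjI allI ballI impI)
      fix j assume "j < r" then show "tp M 1 (b j) \<in> UU M 1" using b by (auto simp: spans_def intro: UU_I)
    next
      fix l assume l: "l \<in> UU M 1"
      then have "l \<in> mcar M" "tp M 1 l = l" by (simp_all only: UU_1_iff)
      moreover then obtain a where "l = mlc n M a b r" using b unfolding spans_def by blast
      ultimately show "\<exists>a. l = mlc n M a (\<lambda>j. tp M 1 (b j)) r"
        using lc_UU[of r b a] b by (intro exI[of _ a]) (auto simp: spans_def)
    qed
    then show "\<exists>r b. rmod.spans (UU M 1) (mplus M) (mzero M) (msm n M) r b" by blast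
  qed
  obtain r b where sp: "ch.spans r b" and ind: "ch.indep r b"
    and ad: "\<And>i a j. i \<in> {1..n} \<Longrightarrow> mlc n M a b r \<in> UU M i \<Longrightarrow> j < r \<Longrightarrow>
       (ch.lev (b j) < i \<longrightarrow> Xp dvd a j) \<and> (ch.levX (b j) < i \<longrightarrow> Xp ^ 2 dvd a j)"
    and lv: "\<And>j. j < r \<Longrightarrow> ch.lev (b j) < ch.levX (b j)"
    using ch.adapted_basis by blast
  define ts where "ts = map (\<lambda>j. (ch.lev (b j), ch.levX (b j))) [0..<r]"
  have len: "length ts = r" and nth: "\<And>k. k < r \<Longrightarrow> ts ! k = (ch.lev (b k), ch.levX (b k))"
    by (simp_all add: ts_def)
  have bU: "b k \<in> UU M 1" if "k < r" for k using sp that by (simp add: ch.spans_def)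
  have bX: "msm n M Xp (b k) \<in> UU M 1" if "k < r" for k using UU_sm[of 1] bU[OF that] by simp
  have bC: "b k \<in> mcar M" if "k < r" for k using bU[OF that] by (simp only: UU_1_iff)
  have val: "list_all (valid n) ts"
    unfolding list_all_length valid_def len
    using nth lv ch.lev_ge[OF bU] ch.lev_le[OF bX] by simp
  obtain f where f: "hom n (DS n ts) M f"
    "\<And>v i. v \<in> mcar (DS n ts) \<Longrightarrow> i \<in> {1..n} \<Longrightarrow> tp M i (f v) = mlc n M (\<lambda>k. unR (v k i)) b (length ts)"
  proof (rule construct[OF val, of b])
    fix k assume "k < length ts"
    then have k: "k < r" by (simp add: len)
    show "b k \<in> UU M (fst (ts ! k)) \<and> msm n M Xp (b k) \<in> UU M (snd (ts ! k))"
      using nth[OF k] ch.lev_in[OF bU[OF k]] ch.lev_in[OF bX[OF k]] by simp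
  qed blast
  have vR: "xR 0 (v k i)" if "v \<in> mcar (DS n ts)" "k < r" for v :: "nat \<Rightarrow> 'k vec" and k i
    using that SM_R[of "v k" n "ts ! k"] len by (auto simp: DS_mcar)
  have "inj_on f (mcar (DS n ts))"
  proof
    fix v w assume v: "v \<in> mcar (DS n ts)" and w: "w \<in> mcar (DS n ts)" and "f v = f w"
    show "v = w"
    proof (rule DS_eqI[OF v w])
      fix k i assume ki: "k < length ts" "i \<in> {1..n}"
      have "mlc n M (\<lambda>k. unR (v k i)) b r = mlc n M (\<lambda>k. unR (w k i)) b r"
        using f(2)[OF v ki(2)] f(2)[OF w ki(2)] \<open>f v = f w\<close> len by simp
      then have "unR (v k i) = unR (w k i)"
        using ch.indepD[OF ind bU, of "\<lambda>k. unR (v k i)" "\<lambda>k. unR (w k i)" k] ki len by simp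
      then show "v k i = w k i" using vR[OF v] vR[OF w] ki len by (metis embR_unR)
    qed
  qed
  moreover have "\<exists>v\<in>mcar (DS n ts). f v = m" if m: "m \<in> mcar M" for m
  proof -
    have "\<exists>a. tp M i m = mlc n M a b r" if "i \<in> {1..n}" for i
      using sp UU_subset_1[OF that] UU_I[OF m, of i] unfolding ch.spans_def by blast
    then obtain a where a: "\<And>i. i \<in> {1..n} \<Longrightarrow> tp M i m = mlc n M (a i) b r" by metis
    define v where "v = (\<lambda>k. if k < r then (\<lambda>i. if i \<in> {1..n} then embR (a i k) else 0) else undefined)"
    have "xR (ev (ch.lev (b k)) (ch.levX (b k)) i) (embR (a i k))" if "k < r" "i \<in> {1..n}" for k i
    proof -
      have "(ch.lev (b k) < i \<longrightarrow> Xp ^ 1 dvd a i k) \<and> (ch.levX (b k) < i \<longrightarrow> Xp ^ 2 dvd a i k)"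
        using ad[OF that(2), of "a i" k] a[OF that(2)] UU_I[OF m, of i] that by simp
      then show ?thesis using xR_embR_pow[of 1 "a i k"] xR_embR_pow[of 2 "a i k"]
        by (auto simp: ev_def)
    qed
    then have v: "v \<in> mcar (DS n ts)"
      by (auto simp: DS_mcar SM_mcar len nth v_def)
    have "f v = m"
    proof (rule eq_if_tp)
      fix i assume i: "i \<in> {1..n}"
      have "tp M i (f v) = mlc n M (a i) b r"
        unfolding f(2)[OF v i] len using i by (intro ch.lc_cong) (auto simp: v_def)
      then show "tp M i (f v) = tp M i m" using a[OF i] by simp
    qed (use hom_closed[OF f(1) v] m in auto)
    then show ?thesis using v by blast
  qed
  ultimately have "bij_betw f (mcar (DS n ts)) (mcar M)"
    using hom_closed[OF f(1)] unfolding bij_betw_def by blast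
  then show ?thesis using that[OF val] f(1) by (auto simp: iso_def)
qed

section \<open>Cohen--Macaulay modules and their summands\<close>

context rmod
begin

text \<open>\<open>lincomb\<close> folds its list from the front, whereas \<open>lc\<close> adds the
  last term outermost.\<close>

lemma lc_shift: "(\<And>j. j < Suc r \<Longrightarrow> b j \<in> C) \<Longrightarrow>
    \<Sigma> a b (Suc r) = (a 0 \<odot> b 0) \<oplus> \<Sigma> (\<lambda>j. a (Suc j)) (\<lambda>j. b (Suc j)) r"
proof (induction r)
  case (Suc r)
  then have "\<Sigma> a b (Suc (Suc r)) = ((a 0 \<odot> b 0) \<oplus> \<Sigma> (\<lambda>j. a (Suc j)) (\<lambda>j. b (Suc j)) r) \<oplus> (a (Suc r) \<odot> b (Suc r))"
    by simp
  then show ?case using Suc.prems by (simp add: assoc)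
qed simp

end

lemma lincomb_lc:
  assumes M: "is_lmod n M"
  shows "set bs \<subseteq> mcar M \<Longrightarrow> length ps = length bs \<Longrightarrow>
    lincomb M (zip (map (scal n) ps) bs) = mlc n M (\<lambda>j. ps ! j) (\<lambda>j. bs ! j) (length bs)"
proof (induction bs arbitrary: ps)
  case Nil
  then show ?case by (simp add: lincomb_def)
next
  case (Cons b bs)
  interpret rmod "mcar M" "mplus M" "mzero M" "msm n M" using M by (rule is_lmod_rmod)
  obtain p ps' where ps: "ps = p # ps'" "length ps' = length bs"
    using Cons.prems by (cases ps) auto
  have bC: "(b # bs) ! j \<in> mcar M" if "j < Suc (length bs)" for j
    using Cons.prems(1) nth_mem[of j "b # bs"] that by auto
  have "lincomb M (zip (map (scal n) ps) (b # bs)) = mplus M (msm n M p b) (lincomb M (zip (map (scal n) ps') bs))"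
    by (simp add: ps lincomb_def)
  also have "\<dots> = mlc n M (\<lambda>j. ps ! j) (\<lambda>j. (b # bs) ! j) (Suc (length bs))"
    using Cons.IH[of ps'] Cons.prems(1) ps by (subst lc_shift[OF bC]) simp_all
  finally show ?case by simp
qed

definition fg :: "nat \<Rightarrow> ('k::field poly fract, 'a) lmod \<Rightarrow> bool" where
  "fg n M \<longleftrightarrow> (\<exists>r b. rmod.spans (mcar M) (mplus M) (mzero M) (msm n M) r b)"

lemma R_free_iff:
  fixes M :: "('k::field poly fract, 'a) lmod"
  assumes M: "is_lmod n M"
  shows "R_free n M \<longleftrightarrow> (\<exists>r b. rmod.spans (mcar M) (mplus M) (mzero M) (msm n M) r b \<and>
     rmod.indep (mplus M) (mzero M) (msm n M) r b)"
proof -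
  interpret rmod "mcar M" "mplus M" "mzero M" "msm n M" using M by (rule is_lmod_rmod)
  show ?thesis
  proof
    assume "R_free n M"
    then obtain bs where bs: "set bs \<subseteq> mcar M"
      and ex: "\<forall>m\<in>mcar M. \<exists>!ps. length ps = length bs \<and> m = lincomb M (zip (map (scal n) ps) bs)"
      unfolding R_free_def by (elim exE conjE) (rule that)
    note ex1 = bspec[OF ex]
    let ?b = "\<lambda>j. bs ! j" and ?r = "length bs"
    have bC: "\<And>j. j < ?r \<Longrightarrow> ?b j \<in> mcar M" using bs by auto
    have lin: "lincomb M (zip (map (scal n) (map a [0..<?r])) bs) = mlc n M a ?b ?r" for a
      using lincomb_lc[OF M bs, of "map a [0..<?r]"] by (simp, intro lc_cong) auto
    have "spans ?r ?b"
      unfolding spans_def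
    proof (intro conjI allI impI ballI bC)
      fix l assume "l \<in> mcar M"
      then obtain ps where "length ps = ?r" "l = lincomb M (zip (map (scal n) ps) bs)" using ex1 by blast
      then show "\<exists>a. l = mlc n M a ?b ?r" using lincomb_lc[OF M bs, of ps] by auto
    qed
    moreover have "indep ?r ?b"
      unfolding indep_def
    proof (intro allI impI)
      fix a j assume a: "mlc n M a ?b ?r = mzero M" and j: "j < ?r"
      have z: "mlc n M (\<lambda>_. 0) ?b ?r = mzero M" by (rule lc_zero) (use bC in auto)
      let ?ps = "map a [0..<?r]" and ?qs = "map (\<lambda>_. 0 :: 'k poly) [0..<?r]"
      have "length ?ps = ?r \<and> mzero M = lincomb M (zip (map (scal n) ?ps) bs)" unfolding lin using a by simp
      moreover have "length ?qs = ?r \<and> mzero M = lincomb M (zip (map (scal n) ?qs) bs)" unfolding lin using z by simp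
      ultimately have "?ps = ?qs" using ex1[OF zero_closed] by blast
      then show "a j = 0" using j by simp
    qed
    ultimately show "\<exists>r b. spans r b \<and> indep r b" by blast
  next
    assume "\<exists>r b. spans r b \<and> indep r b"
    then obtain r b where b: "spans r b" "indep r b" by blast
    let ?bs = "map b [0..<r]"
    have bC: "\<And>j. j < r \<Longrightarrow> b j \<in> mcar M" using b(1) by (simp add: spans_def)
    have bs: "set ?bs \<subseteq> mcar M" using bC by auto
    have lin: "lincomb M (zip (map (scal n) ps) ?bs) = mlc n M (\<lambda>j. ps ! j) b r" if "length ps = r" for ps
      using lincomb_lc[OF M bs, of ps] that by (simp, intro lc_cong) auto
    have "\<exists>!ps. length ps = length ?bs \<and> m = lincomb M (zip (map (scal n) ps) ?bs)" if m: "m \<in> mcar M" for m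
    proof -
      obtain a where a: "m = mlc n M a b r" using b(1) m unfolding spans_def by blast
      have "mlc n M (\<lambda>j. map a [0..<r] ! j) b r = mlc n M a b r" by (rule lc_cong) auto
      moreover have "ps = map a [0..<r]" if "length ps = r" "m = mlc n M (\<lambda>j. ps ! j) b r" for ps
        using indepD[OF b(2) bC, where a = "\<lambda>j. ps ! j" and a' = a] that a by (intro nth_equalityI) auto
      ultimately show ?thesis using a lin lin[of "map a [0..<r]"]
        by (intro ex1I[of _ "map a [0..<r]"]) auto
    qed
    then show "R_free n M" unfolding R_free_def using bs by blast
  qed
qed

text \<open>Over K[x] a finitely generated torsion-free module is free, by the minimal generating
  families above. The right-hand properties are the ones that pass directly to retracts. Generation
  over the order follows from generation by scalar matrices.\<close>

lemma CM_iff: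
  fixes M :: "('k::field poly fract, 'a) lmod"
  shows "CM n M \<longleftrightarrow> is_lmod n M \<and> torsion_free n M \<and> fg n M"
proof (cases "is_lmod n M")
  case True
  interpret rmod "mcar M" "mplus M" "mzero M" "msm n M" using True by (rule is_lmod_rmod)
  have 1: "torsion_free n M \<and> fg n M" if "R_free n M"
  proof -
    obtain r b where b: "spans r b" "indep r b" using R_free_iff[OF True] \<open>R_free n M\<close> by blast
    have bC: "\<And>j. j < r \<Longrightarrow> b j \<in> mcar M" using b(1) by (simp add: spans_def)
    have "p = 0 \<or> x = mzero M" if x: "x \<in> mcar M" "msm n M p x = mzero M" for p x
    proof (cases "p = 0")
      case False
      obtain a where a: "x = mlc n M a b r" using b(1) x(1) unfolding spans_def by blast
      have "mlc n M (\<lambda>j. p * a j) b r = mzero M" using x(2) a bC by (simp only: lc_scale)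
      then have "\<forall>j<r. p * a j = 0" using b(2) unfolding indep_def by blast
      then have "\<forall>j<r. a j = 0" using False by simp
      then show ?thesis unfolding a using bC by (intro disjI2 lc_zero) auto
    qed simp
    then show ?thesis using b(1) unfolding torsion_free_def fg_def by blast
  qed
  have 2: "R_free n M" if t: "torsion_free n M" and f: "fg n M"
  proof -
    have "p = 0 \<or> x = mzero M" if "x \<in> mcar M" "msm n M p x = mzero M" for p x
      using t[unfolded torsion_free_def, THEN spec, THEN spec, of x p] that by blast
    then obtain r where "\<exists>b. spans r b" "\<And>b. spans r b \<Longrightarrow> indep r b"
      using ex_basis f[unfolded fg_def] by metis
    then show ?thesis using R_free_iff[OF True] by blast
  qed
  have 3: "fin_gen n M" if "R_free n M"
  proof -
    obtain bs where bs: "set bs \<subseteq> mcar M"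
      and ex: "\<forall>m\<in>mcar M. \<exists>!ps. length ps = length bs \<and> m = lincomb M (zip (map (scal n) ps) bs)"
      using \<open>R_free n M\<close> unfolding R_free_def by (elim exE conjE) (rule that)
    note ex1 = bspec[OF ex]
    have "\<exists>As. length As = length bs \<and> set As \<subseteq> Lam n \<and> m = lincomb M (zip As bs)" if m: "m \<in> mcar M" for m
    proof -
      obtain ps where "length ps = length bs" "m = lincomb M (zip (map (scal n) ps) bs)" using ex1[OF m] by blast
      then show ?thesis by (intro exI[of _ "map (scal n) ps"]) auto
    qed
    then show ?thesis unfolding fin_gen_def using bs by blast
  qed
  show ?thesis unfolding CM_def using 1 2 3 by blast
qed (simp add: CM_def)

lemma CM_DS: "list_all (valid n) ts \<Longrightarrow> 1 \<le> n \<Longrightarrow> CM n (DS n ts)"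
  unfolding CM_iff fg_def using is_lmod_DS torsion_free_DS spans_DS by blast

lemma CM_decompose:
  assumes "CM n M" "2 \<le> n"
  obtains ts where "list_all (valid n) ts" "iso n (DS n ts) M"
  using classification[of n M] assms unfolding CM_iff fg_def by blast

section \<open>Retracts and direct summands\<close>

text \<open>Being a direct summand without mention of a complement, which makes transitivity
  immediate.\<close>

definition retract :: "nat \<Rightarrow> ('k::field poly fract, 'a) lmod \<Rightarrow> ('k poly fract, 'b) lmod \<Rightarrow> bool" where
  "retract n X T \<longleftrightarrow> (\<exists>f g. hom n X T f \<and> hom n T X g \<and> (\<forall>x\<in>mcar X. g (f x) = x))"

lemma retract_trans: "retract n X Y \<Longrightarrow> retract n Y T \<Longrightarrow> retract n X T"
proof -
  assume "retract n X Y" "retract n Y T"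
  then obtain f g f' g' where *: "hom n X Y f" "hom n Y X g" "\<forall>x\<in>mcar X. g (f x) = x"
    "hom n Y T f'" "hom n T Y g'" "\<forall>x\<in>mcar Y. g' (f' x) = x"
    unfolding retract_def by blast
  have "\<forall>x\<in>mcar X. g (g' (f' (f x))) = x" using * hom_closed[OF *(1)] by simp
  then show ?thesis
    unfolding retract_def using hom_comp[OF *(1,4)] hom_comp[OF *(5,2)] by blast
qed

lemma iso_retract: "is_lmod n M \<Longrightarrow> iso n M N \<Longrightarrow> retract n M N"
  and iso_retract': "is_lmod n M \<Longrightarrow> iso n M N \<Longrightarrow> retract n N M"
  unfolding retract_def by (metis iso_inverse)+

lemma retract_torsion_free:
  assumes "is_lmod n X" "is_lmod n T" "retract n X T" "torsion_free n T"
  shows "torsion_free n X"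
proof -
  obtain f g where *: "hom n X T f" "hom n T X g" "\<forall>x\<in>mcar X. g (f x) = x"
    using assms(3) unfolding retract_def by blast
  have "p = 0 \<or> x = mzero X" if x: "x \<in> mcar X" "msm n X p x = mzero X" for p x
  proof -
    have "msm n T p (f x) = mzero T"
      using hom_act[OF *(1) scal_in_Lam x(1), of p] hom_zero[OF assms(1,2) *(1)] x(2) by simp
    then have "p = 0 \<or> f x = mzero T"
      using assms(4)[unfolded torsion_free_def, THEN spec, THEN spec, of "f x" p] hom_closed[OF *(1) x(1)] by blast
    then show ?thesis using *(3) x(1) hom_zero[OF assms(2,1) *(2)] by metis
  qed
  then show ?thesis unfolding torsion_free_def by blast
qed

lemma retract_fg:
  assumes "is_lmod n X" "is_lmod n T" "retract n X T" "fg n T"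
  shows "fg n X"
proof -
  obtain f g where *: "hom n X T f" "hom n T X g" "\<forall>x\<in>mcar X. g (f x) = x"
    using assms(3) unfolding retract_def by blast
  interpret X: rmod "mcar X" "mplus X" "mzero X" "msm n X" using assms(1) by (rule is_lmod_rmod)
  interpret T: rmod "mcar T" "mplus T" "mzero T" "msm n T" using assms(2) by (rule is_lmod_rmod)
  obtain r b where b: "T.spans r b" using assms(4) unfolding fg_def by blast
  have bC: "\<And>j. j < r \<Longrightarrow> b j \<in> mcar T" using b by (simp add: T.spans_def)
  have "X.spans r (\<lambda>j. g (b j))"
    unfolding X.spans_def
  proof (intro conjI allI impI ballI)
    fix j assume "j < r" then show "g (b j) \<in> mcar X" using bC hom_closed[OF *(2)] by simp
  next
    fix l assume l: "l \<in> mcar X"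
    have "\<exists>a. f l = mlc n T a b r"
      using b hom_closed[OF *(1) l] by (simp add: T.spans_def)
    then obtain a where a: "f l = mlc n T a b r" ..
    have "g (mlc n T a b r) = mlc n X a (\<lambda>j. g (b j)) r"
      by (rule hom_lc[OF assms(2,1) *(2) bC])
    then have "l = mlc n X a (\<lambda>j. g (b j)) r"
      using *(3)[rule_format, OF l] unfolding a by simp
    then show "\<exists>a. l = mlc n X a (\<lambda>j. g (b j)) r" by blast
  qed
  then show ?thesis unfolding fg_def by blast
qed

lemma dsum2_sel:
  "mcar (dsum2 M N) = mcar M \<times> mcar N"
  "mplus (dsum2 M N) = (\<lambda>x y. (mplus M (fst x) (fst y), mplus N (snd x) (snd y)))"
  "mzero (dsum2 M N) = (mzero M, mzero N)"
  "mact (dsum2 M N) = (\<lambda>A x. (mact M A (fst x), mact N A (snd x)))"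
  by (simp_all add: dsum2_def)

lemma hom_dsum2_fst: "hom n (dsum2 M N) M fst"
  by (simp add: hom_def dsum2_sel)

lemma hom_dsum2_inl: "is_lmod n N \<Longrightarrow> hom n M (dsum2 M N) (\<lambda>x. (x, mzero N))"
  by (simp add: hom_def dsum2_sel is_lmod_rules act_mzero)

lemma is_lmod_dsum2:
  assumes "is_lmod n M" "is_lmod n N"
  shows "is_lmod n (dsum2 M N)"
proof -
  have inv: "\<exists>y\<in>mcar (dsum2 M N). mplus (dsum2 M N) x y = mzero (dsum2 M N)" if "x \<in> mcar (dsum2 M N)" for x
  proof -
    have x: "fst x \<in> mcar M" "snd x \<in> mcar N" using that by (auto simp: dsum2_sel)
    obtain y where y: "y \<in> mcar M" "mplus M (fst x) y = mzero M"
      using rmod.inverse_ex[OF is_lmod_rmod[OF assms(1)] x(1)] by blast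
    obtain z where z: "z \<in> mcar N" "mplus N (snd x) z = mzero N"
      using rmod.inverse_ex[OF is_lmod_rmod[OF assms(2)] x(2)] by blast
    show ?thesis by (intro bexI[of _ "(y, z)"]) (use y z in \<open>auto simp: dsum2_sel\<close>)
  qed
  have cm: "mplus (dsum2 M N) x y = mplus (dsum2 M N) y x"
    if "x \<in> mcar (dsum2 M N)" "y \<in> mcar (dsum2 M N)" for x y
    using that is_lmod_comm[OF assms(1), of "fst x" "fst y"] is_lmod_comm[OF assms(2), of "snd x" "snd y"]
    by (auto simp: dsum2_sel)
  show ?thesis unfolding is_lmod_def
  proof (intro conjI ballI inv cm)
  qed (auto simp: dsum2_sel is_lmod_rules[OF assms(1)] is_lmod_rules[OF assms(2)])
qed

lemma summand_retract:
  assumes "summand n X T"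
  shows "retract n X T"
proof -
  from assms obtain Y :: "('a poly fract, 'c) lmod" where X: "is_lmod n X" and Y: "is_lmod n Y" and i: "iso n (dsum2 X Y) T"
    by (auto simp: summand_def)
  have "retract n X (dsum2 X Y)"
    unfolding retract_def using hom_dsum2_inl[OF Y, of X] hom_dsum2_fst[of n X Y] by force
  then show ?thesis using iso_retract[OF is_lmod_dsum2[OF X Y] i] retract_trans by blast
qed

text \<open>The decomposition is t = f (g t) + (t - f (g t)). The complement is the kernel of
  \<open>g\<close> inside \<open>T\<close>, so it has the carrier type that \<open>summand\<close>
  asks of it.\<close>

lemma split_retract:
  fixes X :: "('k::field poly fract, 'a) lmod" and T :: "('k poly fract, 'b) lmod"
  assumes X: "is_lmod n X" and T: "is_lmod n T"
    and f: "hom n X T f" and g: "hom n T X g" and gf: "\<And>x. x \<in> mcar X \<Longrightarrow> g (f x) = x"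
  defines "Y \<equiv> T\<lparr>mcar := {t \<in> mcar T. g t = mzero X}\<rparr>"
  shows "is_lmod n Y" "iso n (dsum2 X Y) T"
proof -
  interpret X: rmod "mcar X" "mplus X" "mzero X" "msm n X" using X by (rule is_lmod_rmod)
  interpret T: rmod "mcar T" "mplus T" "mzero T" "msm n T" using T by (rule is_lmod_rmod)
  have Ysel: "mcar Y = {t \<in> mcar T. g t = mzero X}" "mplus Y = mplus T" "mzero Y = mzero T" "mact Y = mact T"
    by (simp_all add: Y_def)
  have g0: "g (mzero T) = mzero X" using hom_zero[OF T X g] .
  have fc: "f x \<in> mcar T" if "x \<in> mcar X" for x using hom_closed[OF f that] .
  have gc: "g x \<in> mcar X" if "x \<in> mcar T" for x using hom_closed[OF g that] .
  have inv: "\<exists>y\<in>mcar Y. mplus Y x y = mzero Y" if "x \<in> mcar Y" for x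
    using that hom_act[OF g scal_in_Lam, of x "-1"]
    by (intro bexI[of _ "msm n T (-1) x"]) (auto simp: Ysel)
  have cm: "mplus Y x y = mplus Y y x" if "x \<in> mcar Y" "y \<in> mcar Y" for x y
    using that is_lmod_comm[OF T, of x y] by (simp add: Ysel)
  show "is_lmod n Y" unfolding is_lmod_def
  proof (intro conjI ballI inv cm)
  qed (auto simp: Ysel g0 is_lmod_rules[OF T] hom_add[OF g] hom_act[OF g] act_mzero[OF X])
  let ?F = "\<lambda>p. mplus T (f (fst p)) (snd p)"
  let ?G = "\<lambda>t. (g t, mplus T t (msm n T (-1) (f (g t))))"
  show "iso n (dsum2 X Y) T"
  proof (rule isoI[of n _ _ ?F ?G])
    show "hom n (dsum2 X Y) T ?F"
      unfolding hom_def by (auto simp: dsum2_sel Ysel fc hom_add[OF f] hom_act[OF f] is_lmod_rules[OF T] T.ac is_lmod_rules[OF X])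
    have msg: "g (msm n T p x) = msm n X p (g x)" if "x \<in> mcar T" for x p
      using hom_act[OF g scal_in_Lam that] .
    have actsm: "mact T A (msm n T p x) = msm n T p (mact T A x)" if "A \<in> Lam n" "x \<in> mcar T" for A :: "'k kmat" and p x
    proof -
      have "mact T (matmul n A (scal n p)) x = mact T (matmul n (scal n p) A) x"
        using that by (simp add: matmul_scal_left matmul_scal_right)
      then show ?thesis using that by (simp add: is_lmod_rules(8)[OF T])
    qed
    show "hom n T (dsum2 X Y) ?G"
      unfolding hom_def
    proof (intro conjI ballI)
      fix x assume x: "x \<in> mcar T"
      then show "?G x \<in> mcar (dsum2 X Y)"
        by (simp add: dsum2_sel Ysel gc fc hom_add[OF g] msg gf)
    next
      fix x y assume xy: "x \<in> mcar T" "y \<in> mcar T"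
      show "?G (mplus T x y) = mplus (dsum2 X Y) (?G x) (?G y)"
        using xy by (simp add: dsum2_sel Ysel gc fc hom_add[OF g] hom_add[OF f] T.sm_add_right T.ac)
    next
      fix A :: "'k kmat" and x assume "A \<in> Lam n" "x \<in> mcar T"
      then show "?G (mact T A x) = mact (dsum2 X Y) A (?G x)"
        by (simp add: dsum2_sel Ysel gc fc hom_act[OF g] hom_act[OF f] is_lmod_rules[OF T] actsm del: T.sm_closed)
    qed
    fix x assume "x \<in> mcar (dsum2 X Y)"
    then show "?G (?F x) = x"
      by (auto simp: dsum2_sel Ysel fc hom_add[OF g] gf T.ac T.left_comm[of _ _ "msm n T (-1) _"])
  next
    fix t assume t: "t \<in> mcar T"
    then have "?F (?G t) = mplus T t (mplus T (f (g t)) (msm n T (-1) (f (g t))))"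
      by (simp add: gc fc T.left_comm)
    then show "?F (?G t) = t" using t by (simp add: gc fc)
  qed
qed

lemma retract_summand: "is_lmod n X \<Longrightarrow> is_lmod n T \<Longrightarrow> retract n X T \<Longrightarrow> summand n X T"
  unfolding summand_def retract_def using split_retract by blast

section \<open>Detecting rank one summands\<close>

definition ue :: "nat \<Rightarrow> 'r::zero \<Rightarrow> nat \<Rightarrow> 'r" where
  "ue i r = (\<lambda>k. if k = i then r else 0)"

lemma ue_SM: "i \<in> {1..n} \<Longrightarrow> xR (ev (fst p) (snd p) i) r \<Longrightarrow> ue i r \<in> mcar (SM n p)"
  by (auto simp: SM_mcar ue_def)

lemma SM_xR: "v \<in> mcar (SM n p) \<Longrightarrow> i \<in> {1..n} \<Longrightarrow> xR (ev (fst p) (snd p) i) (v i)"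
  by (simp add: SM_mcar)

lemma SM_mact: "mact (SM n p) = vact n"
  by (simp add: SM_def stmod_sel)

text \<open>E_1i moves the i-th coordinate of \<open>v\<close> to row 1, where the result is a
  polynomial multiple of the first unit vector; the scalar is the first coordinate of the image of
  that vector. Compatibility with the action is asked for rowwise, and the values may leave every
  lattice, as happens for a split cocycle below.\<close>

lemma rank_one:
  fixes h :: "'k::field vec \<Rightarrow> 'k vec"
  assumes p: "valid n p"
    and h: "\<And>A v i. A \<in> Lam n \<Longrightarrow> v \<in> mcar (SM n p) \<Longrightarrow> i \<in> {1..n} \<Longrightarrow> h (vact n A v) i = vact n A (h v) i"
  shows "\<exists>a. \<forall>v\<in>mcar (SM n p). \<forall>i\<in>{1..n}. h v i = a * v i"
proof (intro exI ballI)
  fix v :: "'k vec" and i assume v: "v \<in> mcar (SM n p)" and i: "i \<in> {1..n}"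
  have n: "2 \<le> n" using p by (auto simp: valid_def)
  have 1: "(1::nat) \<in> {1..n}" using n by simp
  have e: "(ue 1 1 :: 'k vec) \<in> mcar (SM n p)"
    using p by (intro ue_SM 1) (simp add: ev_def valid_def)
  have E: "(Eu 1 i 1 :: 'k kmat) \<in> Lam n"
    using i n by (intro Eu_in_Lam) (auto intro: xR_mono[OF xR_1] simp: cexp_def)
  obtain q where q: "v i = embR q" using SM_R[OF v, of i] by (auto simp: xR_0_iff)
  have "h v i = vact n (Eu 1 i 1) (h v) 1" using i 1 by (simp add: vact_Eu)
  also have "\<dots> = h (vact n (Eu 1 i 1) v) 1" using h[OF E v 1] by simp
  also have "vact n (Eu 1 i 1) v = vact n (scal n q) (ue 1 1)"
    using i 1 q by (auto simp: vact_Eu vact_scal ue_def fun_eq_iff)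
  also have "h \<dots> 1 = h (ue 1 1) 1 * v i"
    using h[OF scal_in_Lam e 1, of q] 1 q by (simp add: vact_scal)
  finally show "h v i = h (ue 1 1) 1 * v i" .
qed

text \<open>The endomorphism rings of the rank one modules are \<open>K[x]\<close>, which is not local, so the
  Krull--Schmidt theorem is not available. Working modulo the variable replaces it: a composite
  \<open>SM n p \<rightarrow> SM n q \<rightarrow> SM n p\<close> with \<open>p \<noteq> q\<close> is divisible by the variable, and sums of such
  composites are never the identity.\<close>

definition vis :: "nat \<Rightarrow> nat \<times> nat \<Rightarrow> ('k::field poly fract, 'a) lmod \<Rightarrow> bool" where
  "vis n p N \<longleftrightarrow> (\<exists>f g v. hom n (SM n p) N f \<and> hom n N (SM n p) g \<and> v \<in> mcar (SM n p) \<and> \<not> xR 1 (g (f v) 1))"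

lemma vis_retract:
  fixes N :: "('k::field poly fract, 'a) lmod"
  assumes p: "valid n p" and "retract n (SM n p) N"
  shows "vis n p N"
proof -
  from assms(2)  obtain f g where fg: "hom n (SM n p) N f" "hom n N (SM n p) g" "\<forall>x\<in>mcar (SM n p). g (f x) = x"
    unfolding retract_def by blast
  let ?u = "ue 1 1 :: 'k vec"
  have u: "?u \<in> mcar (SM n p)" using p by (intro ue_SM) (auto simp: ev_def valid_def)
  then have "g (f ?u) = ?u" using fg(3) by blast
  moreover have "?u 1 = 1" by (simp add: ue_def)
  ultimately have "\<not> xR 1 (g (f ?u) 1)" by (metis not_xR_1_1)
  then show ?thesis using fg(1,2) u unfolding vis_def by blast
qed

lemma vis_mono: "retract n X T \<Longrightarrow> vis n p X \<Longrightarrow> vis n p T"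
proof -
  assume "retract n X T" "vis n p X"
  then obtain f g f' g' v where *: "hom n X T f" "hom n T X g" "\<forall>x\<in>mcar X. g (f x) = x"
    "hom n (SM n p) X f'" "hom n X (SM n p) g'" "v \<in> mcar (SM n p)" "\<not> xR 1 (g' (f' v) 1)"
    unfolding retract_def vis_def by blast
  have "\<not> xR 1 (g' (g (f (f' v))) 1)" using * hom_closed[OF *(4,6)] by simp
  then show ?thesis unfolding vis_def using hom_comp[OF *(4,1)] hom_comp[OF *(2,5)] *(6) by blast
qed

text \<open>A composite through the sum is the sum of the composites through the summands. If each
  of those is divisible by x at row 1, so is their sum.\<close>

lemma vis_dsum_list:
  assumes Xs: "\<And>X. X \<in> set Xs \<Longrightarrow> is_lmod n X" and p: "valid n p" and vis: "vis n p (dsum_list Xs)"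
  shows "\<exists>X\<in>set Xs. vis n p X"
proof (rule ccontr)
  assume nv: "\<not> ?thesis"
  let ?D = "dsum_list Xs"
  obtain f g v where fg: "hom n (SM n p) ?D f" "hom n ?D (SM n p) g" "v \<in> mcar (SM n p)" "\<not> xR 1 (g (f v) 1)"
    using vis unfolding vis_def by blast
  define u where "u = f v"
  have u: "u \<in> mcar ?D" using hom_closed[OF fg(1,3)] by (simp add: u_def)
  have D: "is_lmod n ?D" using Xs by (rule is_lmod_dsum_list)
  have comp: "xR 1 (g (dinj Xs k (u k)) 1)" if k: "k < length Xs" for k
  proof -
    have "hom n (SM n p) (Xs ! k) (\<lambda>v. f v k)" using hom_comp[OF fg(1) hom_dproj[OF k]] .
    moreover have "hom n (Xs ! k) (SM n p) (\<lambda>x. g (dinj Xs k x))"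
      using hom_comp[OF hom_dinj[OF Xs k] fg(2)] .
    ultimately show ?thesis using nv nth_mem[OF k] fg(3) unfolding vis_def u_def by blast
  qed
  \<comment> \<open>The truncation of \<open>u\<close> to its first \<open>m\<close> components,
    which turns the decomposition of \<open>u\<close> into an induction.\<close>
  define w where "w = (\<lambda>m i. if i < m then u i else if i < length Xs then mzero (Xs ! i) else undefined)"
  have "w m \<in> mcar ?D \<and> xR 1 (g (w m) 1)" if "m \<le> length Xs" for m
    using that
  proof (induction m)
    case 0
    have "w 0 = mzero ?D" by (simp add: w_def dsum_list_def)
    moreover have "g (mzero ?D) 1 = 0"
      using hom_zero[OF D is_lmod_SM[OF p] fg(2)] by (simp add: SM_def stmod_sel)
    ultimately show ?case using is_lmod_rules(1)[OF D] by simp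
  next
    case (Suc m)
    then have m: "m < length Xs" by simp
    have d: "dinj Xs m (u m) \<in> mcar ?D"
      using hom_closed[OF hom_dinj[OF Xs m]] u m by (simp add: dsum_list_def)
    have z: "mplus (Xs ! i) (mzero (Xs ! i)) x = x" "mplus (Xs ! i) x (mzero (Xs ! i)) = x" if "i < length Xs" "x \<in> mcar (Xs ! i)" for i x
      using rmod.zero_left[OF is_lmod_rmod[OF Xs[OF nth_mem[OF that(1)]]] that(2)]
        rmod.zero_right[OF is_lmod_rmod[OF Xs[OF nth_mem[OF that(1)]]] that(2)] by auto
    have z0: "mzero (Xs ! i) \<in> mcar (Xs ! i)" if "i < length Xs" for i
      using is_lmod_rules(1)[OF Xs[OF nth_mem[OF that]]] .
    have "w (Suc m) = mplus ?D (w m) (dinj Xs m (u m))"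
      using u m z z0 by (auto simp: w_def dsum_list_def dinj_def fun_eq_iff less_Suc_eq)
    moreover have "g \<dots> 1 = g (w m) 1 + g (dinj Xs m (u m)) 1"
      using hom_add[OF fg(2)] Suc d by (simp add: SM_def stmod_sel)
    ultimately show ?case
      using Suc d comp[OF m] is_lmod_rules(2)[OF D, of "w m" "dinj Xs m (u m)"] by (auto intro: xR_add)
  qed
  from this[of "length Xs"] have "xR 1 (g (w (length Xs)) 1)" by simp
  moreover have "w (length Xs) = u" using u by (auto simp: w_def dsum_list_def fun_eq_iff)
  ultimately show False using fg(4) by (simp add: u_def)
qed

text \<open>Both maps are multiplications by polynomials \<open>a\<close> and \<open>b\<close>. A
  composite that is nonzero modulo x forces nonzero constant terms in both, so neither map can lower
  an x-order, and the two exponent vectors bound each other.\<close>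

lemma vis_SM:
  assumes p: "valid n p" and q: "valid n q"
    and vis: "vis n p (SM n q :: 'k::field umod)"
  shows "p = q"
proof -
  obtain f g and v :: "'k vec" where fg: "hom n (SM n p) (SM n q) f" "hom n (SM n q) (SM n p) g"
    and v: "v \<in> mcar (SM n p)" "\<not> xR 1 (g (f v) 1)"
    using vis unfolding vis_def by blast
  have 1: "1 \<in> {1..n}" using p by (auto simp: valid_def)
  obtain a where a: "\<And>v i. v \<in> mcar (SM n p) \<Longrightarrow> i \<in> {1..n} \<Longrightarrow> f v i = a * v i"
    using rank_one[OF p, of f] hom_act[OF fg(1)] unfolding SM_mact by force
  obtain b where b: "\<And>v i. v \<in> mcar (SM n q) \<Longrightarrow> i \<in> {1..n} \<Longrightarrow> g v i = b * v i"
    using rank_one[OF q, of g] hom_act[OF fg(2)] unfolding SM_mact by force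
  have e: "ue 1 1 \<in> mcar (SM n r)" if "valid n r" for r
    using that by (intro ue_SM 1) (auto simp: ev_def valid_def)
  have R: "xR 0 a" "xR 0 b"
    using SM_R[OF hom_closed[OF fg(1) e[OF p]], of 1] a[OF e[OF p] 1]
      SM_R[OF hom_closed[OF fg(2) e[OF q]], of 1] b[OF e[OF q] 1] by (simp_all add: ue_def)
  have "\<not> xR 1 (b * (a * v 1))"
    using v a[OF v(1) 1] b[OF hom_closed[OF fg(1) v(1)] 1] by simp
  moreover have "xR 1 (b * (a * v 1))" if "xR 1 a \<or> xR 1 b"
    using that R SM_R[OF v(1), of 1] xR_mult[of 0 b 1 "a * v 1"] xR_mult[of 1 a 0 "v 1"]
      xR_mult[of 1 b 0 "a * v 1"] xR_mult[of 0 a 0 "v 1"] by auto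
  ultimately have nz: "\<not> xR 1 a" "\<not> xR 1 b" by blast+
  have le: "ev (fst q) (snd q) i \<le> ev (fst p) (snd p) i" if i: "i \<in> {1..n}" for i
  proof -
    have u: "ue i (xvar powi ev (fst p) (snd p) i) \<in> mcar (SM n p)"
      using i by (intro ue_SM) auto
    have "xR (ev (fst q) (snd q) i) (a * xvar powi ev (fst p) (snd p) i)"
      using SM_xR[OF hom_closed[OF fg(1) u] i] a[OF u i] by (simp add: ue_def)
    then show ?thesis using R(1) nz(1) by (rule xR_powi_le)
  qed
  have ge: "ev (fst p) (snd p) i \<le> ev (fst q) (snd q) i" if i: "i \<in> {1..n}" for i
  proof -
    have u: "ue i (xvar powi ev (fst q) (snd q) i) \<in> mcar (SM n q)"
      using i by (intro ue_SM) auto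
    have "xR (ev (fst p) (snd p) i) (b * xvar powi ev (fst q) (snd q) i)"
      using SM_xR[OF hom_closed[OF fg(2) u] i] b[OF u i] by (simp add: ue_def)
    then show ?thesis using R(2) nz(2) by (rule xR_powi_le)
  qed
  \<comment> \<open>The ends of a pair are the rows after which its exponent vector jumps.\<close>
  have "fst p = fst q" "snd p = snd q"
    using le[of "fst p"] ge[of "fst q"] le[of "snd p"] ge[of "snd q"] p q
    by (auto simp: ev_def valid_def split: if_splits)
  then show ?thesis by (simp add: prod_eq_iff)
qed

lemma retract_SM_DS:
  assumes ts: "list_all (valid n) ts" and p: "p \<in> set ts"
  shows "retract n (SM n p :: 'k::field umod) (DS n ts)"
proof -
  let ?Ms = "map (SM n) ts :: 'k umod list"
  obtain k where k: "k < length ts" "p = ts ! k" using p by (auto simp: in_set_conv_nth)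
  have Xs: "X \<in> set ?Ms \<Longrightarrow> is_lmod n X" for X
    using ts by (auto simp: list_all_iff is_lmod_SM)
  have "hom n (SM n p) (dsum_list ?Ms) (dinj ?Ms k)" "hom n (dsum_list ?Ms) (SM n p) (\<lambda>v. v k)"
    using hom_dinj[of ?Ms n k, OF Xs] hom_dproj[of k ?Ms n] k by simp_all
  then show ?thesis unfolding retract_def DS_def
    by (intro exI[of _ "dinj ?Ms k"] exI[of _ "\<lambda>v. v k"]) simp
qed

lemma vis_DS: "list_all (valid n) ts \<Longrightarrow> valid n p \<Longrightarrow> vis n p (DS n ts :: 'k::field gmod) \<longleftrightarrow> p \<in> set ts"
proof
  assume ts: "list_all (valid n) ts" and p: "valid n p" and v: "vis n p (DS n ts :: 'k gmod)"
  have "\<exists>X\<in>set (map (SM n) ts :: 'k umod list). vis n p X"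
    by (rule vis_dsum_list[OF _ p v[unfolded DS_def]]) (use ts in \<open>auto simp: list_all_iff is_lmod_SM\<close>)
  then show "p \<in> set ts" using vis_SM[OF p] ts by (auto simp: list_all_iff)
qed (use vis_retract retract_SM_DS in blast)

lemma in_add_iff:
  fixes T :: "('k::field poly fract, 't) lmod" and Z :: "('k poly fract, 'z) lmod"
  assumes T: "is_lmod n T" "iso n (DS n ts) T" "list_all (valid n) ts"
    and Z: "is_lmod n Z" "iso n (DS n zs) Z" "list_all (valid n) zs"
  shows "in_add n T Z \<longleftrightarrow> set zs \<subseteq> set ts"
proof
  assume "in_add n T Z"
  then obtain Xs :: "'k umod list" where Xs: "\<And>X. X \<in> set Xs \<Longrightarrow> summand n X T" and i: "iso n (dsum_list Xs) Z"
    unfolding in_add_def by blast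
  have XL: "\<And>X. X \<in> set Xs \<Longrightarrow> is_lmod n X" using Xs by (simp add: summand_def)
  show "set zs \<subseteq> set ts"
  proof
    fix p assume p: "p \<in> set zs"
    have vp: "valid n p" using Z(3) p by (simp add: list_all_iff)
    have "vis n p (DS n zs :: 'k gmod)"
      using vis_DS[OF Z(3) vp] p by blast
    then have "vis n p Z" using vis_mono[OF iso_retract[OF is_lmod_DS[OF Z(3)] Z(2)]] by blast
    then have "vis n p (dsum_list Xs)" using vis_mono[OF iso_retract'[OF is_lmod_dsum_list[OF XL] i]] by blast
    then obtain X where "X \<in> set Xs" "vis n p X" using vis_dsum_list[OF XL vp] by blast
    then have "vis n p T" using vis_mono[OF summand_retract[OF Xs]] by blast
    then have "vis n p (DS n ts :: 'k gmod)"
      using vis_mono[OF iso_retract'[OF is_lmod_DS[OF T(3)] T(2)]] by blast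
    then show "p \<in> set ts" using vis_DS[OF T(3) vp] by blast
  qed
next
  assume sub: "set zs \<subseteq> set ts"
  have "summand n X T" if X: "X \<in> set (map (SM n) zs :: 'k umod list)" for X
  proof -
    obtain p where p: "p \<in> set zs" "X = SM n p" using X unfolding set_map by blast
    then have "retract n X T"
      using retract_trans[OF retract_SM_DS[OF T(3), of p] iso_retract[OF is_lmod_DS[OF T(3)] T(2)]] sub by blast
    moreover have "valid n p" using p(1) Z(3) by (simp add: list_all_iff)
    ultimately show ?thesis using retract_summand[OF _ T(1)] is_lmod_SM p(2) by blast
  qed
  then show "in_add n T Z" unfolding in_add_def using Z(2) DS_def by metis
qed

section \<open>Crossing pairs have nonsplit extensions\<close>

text \<open>A term of the commutator with the twisting matrix survives only if exactly one of the
  two rows lies in the range from \<open>u + 1\<close> to \<open>v\<close>. The inequality says that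
  such a term still lies in the lattice \<open>(u, v)\<close>, the last summand being the loss from
  the entry x^(-1) used when \<open>s < u\<close>.\<close>

lemma cross_arith:
  assumes "valid n (s, t)" "valid n (u, v)" "crosses (s, t) (u, v)" "i \<in> {1..n}" "k \<in> {1..n}"
    and "(u < i \<and> i \<le> v) \<noteq> (u < k \<and> k \<le> v)"
  shows "ev u v i \<le> cexp n i k + ev s t k - (if s < u then 1 else 0)"
  using assms by (auto simp: valid_def crosses_def ev_def cexp_def)

lemma vact_diff: "vact n A (\<lambda>i. v i - w i) = (\<lambda>i. vact n A v i - vact n A w i)"
  by (auto simp: vact_def fun_eq_iff right_diff_distrib sum_subtractf)

text \<open>The middle term is the product set with the action twisted by a cocycle. A section would
  make this cocycle the coboundary of an integral map on the rank one parts. That map differs from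
  the twisting matrix by a scalar, and no scalar makes the two crossing exponent patterns
  compatible.\<close>

lemma not_ext1_zero:
  fixes T :: "('k::field poly fract, 't) lmod" and Z :: "('k poly fract, 'z) lmod"
  assumes T: "is_lmod n T" and Z: "is_lmod n Z" and p: "valid n (s, t)" and q: "valid n (u, v)"
    and rT: "retract n (SM n (s, t)) T" and rZ: "retract n (SM n (u, v)) Z" and cr: "crosses (s, t) (u, v)"
  shows "\<not> ext1_zero n T Z"
proof
  assume ext: "ext1_zero n T Z"
  let ?P = "SM n (s, t) :: 'k umod" and ?Q = "SM n (u, v) :: 'k umod"
  obtain \<sigma> \<rho> where \<sigma>: "hom n ?P T \<sigma>" and \<rho>: "hom n T ?P \<rho>" and \<rho>\<sigma>: "\<forall>x\<in>mcar ?P. \<rho> (\<sigma> x) = x"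
    using rT unfolding retract_def by blast
  obtain \<psi> \<pi> where \<psi>: "hom n ?Q Z \<psi>" and \<pi>: "hom n Z ?Q \<pi>" and \<pi>\<psi>: "\<forall>x\<in>mcar ?Q. \<pi> (\<psi> x) = x"
    using rZ unfolding retract_def by blast
  note P = is_lmod_SM[OF p, where ?'a = 'k] and Q = is_lmod_SM[OF q, where ?'a = 'k]
  define m :: int where "m = (if s < u then 1 else 0)"
  \<comment> \<open>The extension is twisted by the coboundary of a diagonal matrix over the fraction field; it
    is integral exactly because the two pairs cross, but the matrix itself is not integral.\<close>
  define \<delta> :: "'k vec" where "\<delta> = (\<lambda>i. if u < i \<and> i \<le> v then xvar powi (- m) else 0)"
  define D :: "'k kmat \<Rightarrow> 'k vec \<Rightarrow> 'k vec" where
    "D = (\<lambda>A w i. \<delta> i * vact n A w i - vact n A (\<lambda>k. \<delta> k * w k) i)"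
  have Qsel: "mplus ?Q = (\<lambda>v w i. v i + w i)" "mzero ?Q = (\<lambda>i. 0)" "mact ?Q = vact n"
    and Psel: "mplus ?P = (\<lambda>v w i. v i + w i)" "mzero ?P = (\<lambda>i. 0)" "mact ?P = vact n"
    by (simp_all add: SM_def stmod_sel)
  have D_closed: "D A w \<in> mcar ?Q" if A: "A \<in> Lam n" and w: "w \<in> mcar ?P" for A w
  proof -
    have "xR (ev u v i) (D A w i)" if i: "i \<in> {1..n}" for i
    proof -
      have "D A w i = (\<Sum>k\<in>{1..n}. (\<delta> i - \<delta> k) * (A i k * w k))"
        using i unfolding D_def vact_def by (simp add: sum_distrib_left algebra_simps flip: sum_subtractf)
      also have "xR (ev u v i) \<dots>"
      proof (rule xR_sum)
        fix k assume k: "k \<in> {1..n}"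
        show "xR (ev u v i) ((\<delta> i - \<delta> k) * (A i k * w k))"
        proof (cases "(u < i \<and> i \<le> v) = (u < k \<and> k \<le> v)")
          case True
          then show ?thesis by (simp add: \<delta>_def)
        next
          case False
          have "xR (- m) (\<delta> i - \<delta> k)"
            by (intro xR_diff) (simp_all add: \<delta>_def)
          moreover have "xR (cexp n i k + ev s t k) (A i k * w k)"
            using SM_xR[OF w k] by (intro xR_mult Lam_xR[OF A i k]) simp
          ultimately have "xR (- m + (cexp n i k + ev s t k)) ((\<delta> i - \<delta> k) * (A i k * w k))"
            by (rule xR_mult)
          then show ?thesis
            using cross_arith[OF p q cr i k False] by (elim xR_mono) (simp add: m_def)
        qed
      qed
      finally show ?thesis .
    qed
    moreover have "D A w i = 0" if "i \<notin> {1..n}" for i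
      using that by (auto simp: D_def vact_def)
    ultimately show ?thesis by (simp add: SM_mcar)
  qed
  have D_add: "D A (\<lambda>i. w i + w' i) = (\<lambda>i. D A w i + D A w' i)" for A w w'
    by (simp add: D_def vact_add distrib_left fun_eq_iff)
  have D_matadd: "D (matadd A B) w = (\<lambda>i. D A w i + D B w i)" for A B w
    by (simp add: D_def vact_matadd distrib_left fun_eq_iff)
  have D_matmul: "D (matmul n A B) w = (\<lambda>i. vact n A (D B w) i + D A (vact n B w) i)" for A B w
    by (simp add: D_def vact_matmul vact_diff fun_eq_iff)
  have D_idm: "D (idm n) w = (\<lambda>i. 0)" for w
    by (simp add: D_def vact_scal fun_eq_iff flip: scal_1)
  have D_zero: "D A (\<lambda>i. 0) = (\<lambda>i. 0)" for A
    by (simp add: D_def vact_def fun_eq_iff)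
  \<comment> \<open>The cocycle between the rank one modules is pulled back along
    \<open>\<rho>\<close> and pushed forward along \<open>\<psi>\<close>, so arbitrary
    \<open>T\<close> and \<open>Z\<close> with these retracts are covered.\<close>
  define \<phi> where "\<phi> = (\<lambda>A x. \<psi> (D A (\<rho> x)))"
  have \<phi>_closed: "\<phi> A x \<in> mcar Z" if "A \<in> Lam n" "x \<in> mcar T" for A x
    unfolding \<phi>_def by (intro hom_closed[OF \<psi>] D_closed hom_closed[OF \<rho>] that)
  have \<phi>_add: "\<phi> A (mplus T x y) = mplus Z (\<phi> A x) (\<phi> A y)" if "A \<in> Lam n" "x \<in> mcar T" "y \<in> mcar T" for A x y
  proof -
    have "\<rho> (mplus T x y) = (\<lambda>i. \<rho> x i + \<rho> y i)" using hom_add[OF \<rho> that(2,3)] by (simp add: Psel)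
    then show ?thesis unfolding \<phi>_def
      using hom_add[OF \<psi> D_closed[OF that(1) hom_closed[OF \<rho> that(2)]] D_closed[OF that(1) hom_closed[OF \<rho> that(3)]]]
      by (simp add: D_add Qsel)
  qed
  have \<phi>_matadd: "\<phi> (matadd A B) x = mplus Z (\<phi> A x) (\<phi> B x)" if "A \<in> Lam n" "B \<in> Lam n" "x \<in> mcar T" for A B x
    unfolding \<phi>_def D_matadd
    using hom_add[OF \<psi> D_closed[OF that(1) hom_closed[OF \<rho> that(3)]] D_closed[OF that(2) hom_closed[OF \<rho> that(3)]]]
    by (simp add: Qsel)
  have \<phi>_matmul: "\<phi> (matmul n A B) x = mplus Z (mact Z A (\<phi> B x)) (\<phi> A (mact T B x))"
    if "A \<in> Lam n" "B \<in> Lam n" "x \<in> mcar T" for A B x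
  proof -
    have 1: "D B (\<rho> x) \<in> mcar ?Q" by (intro D_closed hom_closed[OF \<rho>] that)
    have 2: "\<rho> (mact T B x) = vact n B (\<rho> x)" using hom_act[OF \<rho> that(2,3)] by (simp add: Psel)
    have 3: "D A (\<rho> (mact T B x)) \<in> mcar ?Q"
      by (intro D_closed hom_closed[OF \<rho>] is_lmod_rules(5)[OF T] that)
    have 4: "vact n A (D B (\<rho> x)) \<in> mcar ?Q" using is_lmod_rules(5)[OF Q that(1) 1] by (simp add: Qsel)
    have "\<psi> (\<lambda>i. vact n A (D B (\<rho> x)) i + D A (vact n B (\<rho> x)) i) = mplus Z (\<psi> (vact n A (D B (\<rho> x)))) (\<psi> (D A (vact n B (\<rho> x))))"
      using hom_add[OF \<psi> 4 3] by (simp add: Qsel 2)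
    also have "\<psi> (vact n A (D B (\<rho> x))) = mact Z A (\<psi> (D B (\<rho> x)))"
      using hom_act[OF \<psi> that(1) 1] by (simp add: Qsel)
    finally show ?thesis unfolding \<phi>_def D_matmul 2 .
  qed
  have \<psi>0: "\<psi> (\<lambda>i. 0) = mzero Z" using hom_zero[OF Q Z \<psi>] by (simp add: Qsel)
  have \<rho>0: "\<rho> (mzero T) = (\<lambda>i. 0)" using hom_zero[OF T P \<rho>] by (simp add: Psel)
  have \<phi>_idm: "\<phi> (idm n) x = mzero Z" for x by (simp add: \<phi>_def D_idm \<psi>0)
  have \<phi>_zero: "\<phi> A (mzero T) = mzero Z" for A by (simp add: \<phi>_def \<rho>0 D_zero \<psi>0)
  interpret Z: rmod "mcar Z" "mplus Z" "mzero Z" "msm n Z" using Z by (rule is_lmod_rmod)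
  interpret T: rmod "mcar T" "mplus T" "mzero T" "msm n T" using T by (rule is_lmod_rmod)
  define E :: "('k poly fract, 'z \<times> 't) lmod" where
    "E = \<lparr>mcar = mcar Z \<times> mcar T, mplus = (\<lambda>x y. (mplus Z (fst x) (fst y), mplus T (snd x) (snd y))),
       mzero = (mzero Z, mzero T),
       mact = (\<lambda>A x. (mplus Z (mact Z A (fst x)) (\<phi> A (snd x)), mact T A (snd x)))\<rparr>"
  have Esel: "mcar E = mcar Z \<times> mcar T" "mplus E = (\<lambda>x y. (mplus Z (fst x) (fst y), mplus T (snd x) (snd y)))"
    "mzero E = (mzero Z, mzero T)"
    "mact E = (\<lambda>A x. (mplus Z (mact Z A (fst x)) (\<phi> A (snd x)), mact T A (snd x)))"
    by (simp_all add: E_def)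
  have "is_lmod n E"
  proof -
    have inv: "\<exists>y\<in>mcar E. mplus E x y = mzero E" if "x \<in> mcar E" for x
    proof -
      have x: "fst x \<in> mcar Z" "snd x \<in> mcar T" using that by (auto simp: Esel)
      obtain y z where "y \<in> mcar Z" "mplus Z (fst x) y = mzero Z" "z \<in> mcar T" "mplus T (snd x) z = mzero T"
        using Z.inverse_ex[OF x(1)] T.inverse_ex[OF x(2)] by blast
      then show ?thesis by (intro bexI[of _ "(y, z)"]) (auto simp: Esel)
    qed
    have cm: "mplus E x y = mplus E y x" if "x \<in> mcar E" "y \<in> mcar E" for x y
      using that is_lmod_comm[OF Z, of "fst x" "fst y"] is_lmod_comm[OF T, of "snd x" "snd y"]
      by (auto simp: Esel)
    show ?thesis unfolding is_lmod_def
    proof (intro conjI ballI inv cm)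
    qed (auto simp: Esel is_lmod_rules[OF Z] is_lmod_rules[OF T] \<phi>_closed \<phi>_add \<phi>_matadd \<phi>_matmul \<phi>_idm Z.ac)
  qed
  moreover have "ses n Z E T (\<lambda>z. (z, mzero T)) snd"
    unfolding ses_def
  proof (intro conjI)
    show "hom n Z E (\<lambda>z. (z, mzero T))"
      by (simp add: hom_def Esel is_lmod_rules[OF Z] \<phi>_zero act_mzero[OF T])
    show "hom n E T snd" by (simp add: hom_def Esel)
    show "inj_on (\<lambda>z. (z, mzero T)) (mcar Z)" by (simp add: inj_on_def)
    show "snd ` mcar E = mcar T" using Z.zero_closed unfolding Esel snd_image_times by (metis empty_iff)
    show "(\<lambda>z. (z, mzero T)) ` mcar Z = {e \<in> mcar E. snd e = mzero T}" by (auto simp: Esel)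
  qed
  ultimately obtain h where h: "hom n T E h" "\<forall>x\<in>mcar T. snd (h x) = x"
    using ext unfolding ext1_zero_def by blast
  \<comment> \<open>The first component of the section between the retracts. It is equivariant up to
    \<open>D\<close>, so subtracting \<open>\<delta>\<close> times the argument makes it
    equivariant, hence a scalar by \<open>rank_one\<close>.\<close>
  define c where "c = (\<lambda>w. \<pi> (fst (h (\<sigma> w))))"
  have c_closed: "c w \<in> mcar ?Q" if "w \<in> mcar ?P" for w
  proof -
    have "fst (h (\<sigma> w)) \<in> mcar Z"
      using hom_closed[OF h(1) hom_closed[OF \<sigma> that]] by (auto simp: Esel)
    then show ?thesis unfolding c_def by (rule hom_closed[OF \<pi>])
  qed
  have c_act: "c (vact n A w) i = vact n A (c w) i + D A w i" if A: "A \<in> Lam n" and w: "w \<in> mcar ?P" for A w i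
  proof -
    have \<sigma>w: "\<sigma> w \<in> mcar T" using hom_closed[OF \<sigma> w] .
    have hz: "fst (h (\<sigma> w)) \<in> mcar Z" using hom_closed[OF h(1) \<sigma>w] by (auto simp: Esel)
    have "\<sigma> (vact n A w) = mact T A (\<sigma> w)" using hom_act[OF \<sigma> A w] by (simp add: Psel)
    then have "fst (h (\<sigma> (vact n A w))) = mplus Z (mact Z A (fst (h (\<sigma> w)))) (\<phi> A (\<sigma> w))"
      using hom_act[OF h(1) A \<sigma>w] h(2) \<sigma>w by (simp add: Esel)
    also have "\<phi> A (\<sigma> w) = \<psi> (D A w)" using \<rho>\<sigma> w by (simp add: \<phi>_def)
    finally have "c (vact n A w) = \<pi> (mplus Z (mact Z A (fst (h (\<sigma> w)))) (\<psi> (D A w)))" by (simp add: c_def)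
    also have "\<dots> = mplus ?Q (\<pi> (mact Z A (fst (h (\<sigma> w))))) (\<pi> (\<psi> (D A w)))"
      by (intro hom_add[OF \<pi>] is_lmod_rules(5)[OF Z] A hz hom_closed[OF \<psi>] D_closed w)
    also have "\<pi> (mact Z A (fst (h (\<sigma> w)))) = vact n A (c w)"
      using hom_act[OF \<pi> A hz] by (simp add: Qsel c_def)
    also have "\<pi> (\<psi> (D A w)) = D A w" using \<pi>\<psi> D_closed[OF A w] by blast
    finally show ?thesis by (simp add: Qsel)
  qed
  have "\<exists>a. \<forall>w\<in>mcar ?P. \<forall>i\<in>{1..n}. (\<lambda>w i. c w i - \<delta> i * w i) w i = a * w i"
    by (rule rank_one[OF p]) (simp add: c_act D_def vact_diff)
  then obtain a where "\<forall>w\<in>mcar ?P. \<forall>i\<in>{1..n}. (\<lambda>w i. c w i - \<delta> i * w i) w i = a * w i" ..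
  then have a: "c w i - \<delta> i * w i = a * w i" if "w \<in> mcar ?P" "i \<in> {1..n}" for w i
    using that by blast
  have key: "xR (ev u v i - ev s t i) (a + \<delta> i)" if i: "i \<in> {1..n}" for i
  proof -
    let ?w = "ue i (xvar powi ev s t i) :: 'k vec"
    have w: "?w \<in> mcar ?P" using i by (intro ue_SM) auto
    have "c ?w i = (a + \<delta> i) * xvar powi ev s t i"
      using a[OF w i] by (simp add: ue_def algebra_simps)
    moreover have "xR (ev u v i) (c ?w i)" using SM_xR[OF c_closed[OF w] i] by simp
    ultimately show ?thesis by (simp add: xR_shift)
  qed
  have bounds: "1 \<le> s" "s < t" "t \<le> n" "1 \<le> u" "u < v" "v \<le> n" using p q by (auto simp: valid_def)
  \<comment> \<open>Two rows suffice. If \<open>s < u\<close>, rows 1 and \<open>t\<close> put both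
    \<open>a\<close> and a + x^(-1) into R; otherwise rows \<open>s\<close> and \<open>t\<close> put
    both a + 1 and \<open>a\<close> into x R.\<close>
  show False
  proof (cases "s < u")
    case True
    then have o: "u < t" "t < v" using cr by (auto simp: crosses_def)
    have "xR 0 a" using key[of 1] bounds by (simp add: ev_def \<delta>_def)
    moreover have "xR 0 (a + xvar powi (-1))" using key[of t] True o bounds by (simp add: ev_def \<delta>_def m_def)
    ultimately have "xR 0 ((1 :: 'k poly fract) * xvar powi (-1))" using xR_diff[of 0 "a + xvar powi (-1)" a] by simp
    then show False unfolding xR_shift by simp
  next
    case False
    then have o: "u < s" "s < v" "v < t" using cr by (auto simp: crosses_def)
    have "xR 1 (a + 1)" using key[of s] False o bounds by (simp add: ev_def \<delta>_def m_def)
    moreover have "xR 1 a" using key[of t] o bounds by (simp add: ev_def \<delta>_def)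
    ultimately show False using xR_diff[of 1 "a + 1" a] by simp
  qed
qed

section \<open>Noncrossing families have only split extensions\<close>

lemma (in rmod) sm_swap: "x \<in> C \<Longrightarrow> p \<odot> q \<odot> x = q \<odot> p \<odot> x"
  by (metis mult.commute sm_mult)

lemma (in rmod) add_neg_swap:
  assumes C: "a \<in> C" "b \<in> C" "e \<in> C" "h \<in> C" and eq: "a \<oplus> ((-1) \<odot> b) = e \<oplus> h"
  shows "a \<oplus> ((-1) \<odot> e) = b \<oplus> h"
proof -
  have "a = (a \<oplus> ((-1) \<odot> b)) \<oplus> b" using C comm[of "(-1) \<odot> b" b] by (simp add: assoc)
  then have "a \<oplus> ((-1) \<odot> e) = ((e \<oplus> h) \<oplus> b) \<oplus> ((-1) \<odot> e)" unfolding eq by simp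
  also have "\<dots> = (b \<oplus> h) \<oplus> (e \<oplus> ((-1) \<odot> e))"
    using C comm[of h b] left_comm[of e] by (simp add: assoc del: add_neg)
  also have "\<dots> = b \<oplus> h" using C by simp
  finally show ?thesis .
qed

lemma sesD:
  assumes "ses n Z E T f g"
  shows "hom n Z E f" "hom n E T g" "inj_on f (mcar Z)" "\<And>x. x \<in> mcar T \<Longrightarrow> \<exists>e\<in>mcar E. g e = x"
    "\<And>e. e \<in> mcar E \<Longrightarrow> g e = mzero T \<Longrightarrow> \<exists>z\<in>mcar Z. e = f z" "\<And>z. z \<in> mcar Z \<Longrightarrow> g (f z) = mzero T"
proof -
  show "hom n Z E f" "hom n E T g" "inj_on f (mcar Z)" using assms by (simp_all add: ses_def)
  have im: "g ` mcar E = mcar T" and ker: "f ` mcar Z = {e \<in> mcar E. g e = mzero T}"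
    using assms by (simp_all add: ses_def)
  show "\<exists>e\<in>mcar E. g e = x" if "x \<in> mcar T" for x
    using that unfolding im[symmetric] by auto
  show "\<exists>z\<in>mcar Z. e = f z" if "e \<in> mcar E" "g e = mzero T" for e
  proof -
    have "e \<in> f ` mcar Z" unfolding ker using that by simp
    then show ?thesis by auto
  qed
  show "g (f z) = mzero T" if "z \<in> mcar Z" for z
    using imageI[OF that, of f] unfolding ker by simp
qed

text \<open>This brings the middle term of an extension under the component description and under
  \<open>construct\<close>.\<close>

lemma ses_torsion_free:
  fixes E :: "('k::field poly fract, 'e) lmod"
  assumes "is_lmod n Z" "is_lmod n E" "is_lmod n T" "ses n Z E T f g" "torsion_free n Z" "torsion_free n T"
  shows "torsion_free n E"
proof -
  note s = sesD[OF assms(4)]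
  have "p = 0 \<or> x = mzero E" if x: "x \<in> mcar E" "msm n E p x = mzero E" for p x
  proof (cases "p = 0")
    case False
    have "msm n T p (g x) = mzero T"
      using hom_act[OF s(2) scal_in_Lam x(1), of p] hom_zero[OF assms(2,3) s(2)] x(2) by simp
    then have "g x = mzero T"
      using assms(6)[unfolded torsion_free_def, THEN spec, THEN spec, of "g x" p] False hom_closed[OF s(2) x(1)] by blast
    then obtain z where z: "z \<in> mcar Z" "x = f z" using s(5)[OF x(1)] by blast
    have "f (msm n Z p z) = f (mzero Z)"
      using hom_act[OF s(1) scal_in_Lam z(1), of p] x(2) z(2) hom_zero[OF assms(1,2) s(1)] by simp
    then have "msm n Z p z = mzero Z"
      using inj_onD[OF s(3)] is_lmod_rules(1,5)[OF assms(1)] z(1) scal_in_Lam by metis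
    then have "z = mzero Z"
      using assms(5)[unfolded torsion_free_def, THEN spec, THEN spec, of z p] False z(1) by blast
    then show ?thesis using z(2) hom_zero[OF assms(1,2) s(1)] by simp
  qed simp
  then show ?thesis unfolding torsion_free_def by blast
qed

text \<open>Exactness holds at each member of the chain: an element of the i-th submodule of
  \<open>E\<close> that dies in \<open>T\<close> comes from the i-th submodule of
  \<open>Z\<close>.\<close>

lemma ses_UU:
  assumes Z: "is_lmod n Z" and E: "is_lmod n E" and T: "is_lmod n T" "torsion_free n T" and s: "ses n Z E T f g"
    and n: "2 \<le> n" and i: "i \<in> {1..n}" and e: "e \<in> UU E i" "g e = mzero T"
  shows "\<exists>z\<in>UU Z i. e = f z"
proof -
  note s = sesD[OF s]
  interpret Z: lmodule n Z using Z n by unfold_locales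
  interpret E: lmodule n E using E n by unfold_locales
  interpret T: tf_lmodule n T using T n by unfold_locales
  obtain x where x: "x \<in> mcar E" "e = tp E i x" using e(1) by (auto simp: UU_def)
  \<comment> \<open>Cutting down to row \<open>i\<close> keeps the component \<open>e\<close> and
    removes the others, so the whole image of \<open>y\<close> in \<open>T\<close> vanishes.\<close>
  define y where "y = mact E (Eu i i 1) x"
  have y: "y \<in> mcar E" using x i by (simp add: y_def)
  have tpy: "tp E i y = e" unfolding y_def x(2) using x(1) i by (subst E.act_Eu_Eu) auto
  have gx: "g x \<in> mcar T" using hom_closed[OF s(2) x(1)] .
  have gy: "g y = mact T (Eu i i 1) (g x)" unfolding y_def using x i by (intro hom_act[OF s(2)]) auto
  have gtp: "tp T i (g x) = mzero T" using hom_act[OF s(2) E.Eu_tp_Lam[OF i] x(1)] e(2) x(2) by simp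
  have "g y = mzero T"
  proof (rule T.eq_0_if_tp)
    show "g y \<in> mcar T" using hom_closed[OF s(2) y] .
    fix j assume j: "j \<in> {1..n}"
    show "tp T j (g y) = mzero T"
    proof (cases "j = i")
      case True
      show ?thesis unfolding gy True using gx i gtp by (subst T.act_Eu_Eu) auto
    next
      case False
      then show ?thesis unfolding gy using gx i j by (intro T.act_Eu_Eu0) auto
    qed
  qed
  then obtain z where z: "z \<in> mcar Z" "y = f z" using s(5)[OF y] by blast
  have "e = f (tp Z i z)"
    using hom_act[OF s(1) Z.Eu_tp_Lam[OF i] z(1)] tpy z(2) by simp
  then show ?thesis using UU_I[OF z(1)] by blast
qed

text \<open>A section over the rank one summand \<open>(s, t)\<close> is a lift \<open>y\<close> of its generator with \<open>y\<close> in the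
  \<open>s\<close>-th and \<open>x y\<close> in the \<open>t\<close>-th submodule of the chain. Independent lifts for \<open>s\<close> and \<open>t\<close> differ
  by an element of \<open>Z\<close>, and the exponent comparison below says that it can be absorbed.\<close>

lemma noncross_arith:
  assumes "valid n (s, t)" "valid n (u, v)" "\<not> crosses (s, t) (u, v)"
  shows "t < n \<Longrightarrow> 1 + ev u v s \<le> ev u v (Suc s) \<or> 1 + ev u v s \<le> ev u v (Suc t) - 1 \<or>
      ev u v t \<le> ev u v (Suc s) \<or> ev u v t \<le> ev u v (Suc t) - 1"
    and "t = n \<Longrightarrow> 1 + ev u v s \<le> ev u v (Suc s) \<or> 1 + ev u v s \<le> 1 \<or>
      ev u v t \<le> ev u v (Suc s) \<or> ev u v t \<le> 1"
  using assms by (auto simp: valid_def crosses_def ev_def split: if_splits)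

lemma DS_UU_coord:
  assumes "z \<in> UU (DS n zs) i" "i \<in> {1..n}" "1 \<in> {1..n}" "l < length zs"
  shows "\<exists>r. z l = ue 1 r \<and> xR (ev (fst (zs ! l)) (snd (zs ! l)) i) r"
proof -
  obtain w where w: "w \<in> mcar (DS n zs)" "z = tp (DS n zs) i w" using assms(1) by (auto simp: UU_def)
  have "z l = ue 1 (w l i)"
    unfolding w(2) using assms by (simp add: DS_mact vact_Eu) (auto simp: ue_def fun_eq_iff)
  moreover have "w l \<in> mcar (SM n (zs ! l))" using w(1) assms(4) by (simp add: DS_mcar)
  ultimately show ?thesis using SM_xR assms(2) by blast
qed

lemma DS_tp: "k < length ts \<Longrightarrow> i \<in> {1..n} \<Longrightarrow> 1 \<in> {1..n} \<Longrightarrow> tp (DS n ts) i v k = ue 1 (v k i)"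
  by (simp add: DS_mact vact_Eu) (auto simp: ue_def fun_eq_iff)

text \<open>Lifts \<open>y0\<close> of the generator in the s-th submodule and \<open>y1\<close> of
  its x-multiple in the t-th are chosen independently. If their defect \<open>x y0 - y1\<close>
  equals \<open>f (x p + q)\<close> with \<open>p\<close> in the s-th and \<open>q\<close> in the
  t-th submodule of \<open>Z\<close>, then \<open>y = y0 - f p\<close> is a common lift, because
  \<open>x y = y1 + f q\<close>.\<close>

lemma ses_lift:
  fixes E :: "('k::field poly fract, 'e) lmod"
  assumes n: "2 \<le> n" and zs: "list_all (valid n) zs" and ts: "list_all (valid n) ts"
    and E: "is_lmod n E" and ses: "ses n (DS n zs) E (DS n ts) f g"
    and k: "k < length ts" and nc: "\<forall>q\<in>set zs. \<not> crosses (ts ! k) q"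
  shows "\<exists>y. y \<in> UU E (fst (ts ! k)) \<and> msm n E Xp y \<in> UU E (snd (ts ! k)) \<and> g y = dinj (map (SM n) ts) k (ue 1 1)"
proof -
  let ?Z = "DS n zs :: 'k gmod"
  let ?T = "DS n ts :: 'k gmod"
  let ?i = "dinj (map (SM n) ts :: 'k umod list) k"
  obtain s t where st: "ts ! k = (s, t)" by (cases "ts ! k")
  have vst: "valid n (s, t)" using ts k st by (metis list_all_length)
  then have b: "1 \<le> s" "s < t" "t \<le> n" by (auto simp: valid_def)
  note se = sesD[OF ses]
  note Z = is_lmod_DS[OF zs, where ?'a = 'k] and T = is_lmod_DS[OF ts, where ?'a = 'k]
  note tfZ = torsion_free_DS[OF zs, where ?'a = 'k] and tfT = torsion_free_DS[OF ts, where ?'a = 'k]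
  interpret Z: tf_lmodule n ?Z using Z tfZ n by unfold_locales
  interpret T: tf_lmodule n ?T using T tfT n by unfold_locales
  interpret E: tf_lmodule n E using E ses_torsion_free[OF Z E T ses tfZ tfT] n by unfold_locales
  have one: "(1::nat) \<in> {1..n}" and si: "s \<in> {1..n}" and ti: "t \<in> {1..n}" and s1: "Suc s \<in> {1..n}"
    using b by auto
  have hi: "hom n (SM n (s, t)) ?T ?i"
  proof -
    have "is_lmod n X" if "X \<in> set (map (SM n) ts :: 'k umod list)" for X
      using that ts is_lmod_SM by (force simp: list_all_iff)
    then show ?thesis using hom_dinj[of "map (SM n) ts :: 'k umod list" n k] k st by (simp add: DS_def)
  qed
  have u1: "(ue 1 1 :: 'k vec) \<in> mcar (SM n (s, t))"
    and us: "(ue s 1 :: 'k vec) \<in> mcar (SM n (s, t))"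
    and ut: "(ue t xvar :: 'k vec) \<in> mcar (SM n (s, t))"
    using b xR_powi[of 1] by (auto intro!: ue_SM simp: ev_def)
  have tpu: "vact n (Eu 1 i 1) (ue i r) = ue 1 r" if "i \<in> {1..n}" for i and r :: "'k poly fract"
    using that one by (simp add: vact_Eu) (auto simp: ue_def fun_eq_iff)
  define w where "w = ?i (ue 1 1)"
  have ws: "tp ?T s (?i (ue s 1)) = w"
    using hom_act[OF hi T.Eu_tp_Lam[OF si] us] by (simp add: SM_mact tpu[OF si] w_def)
  have Xue: "vact n (scal n Xp) (ue 1 1) = (ue 1 xvar :: 'k vec)"
    using one by (auto simp: vact_scal ue_def embR_Xp fun_eq_iff)
  have wt: "tp ?T t (?i (ue t xvar)) = msm n ?T Xp w"
    using hom_act[OF hi T.Eu_tp_Lam[OF ti] ut] hom_act[OF hi scal_in_Lam u1, of Xp]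
    unfolding SM_mact tpu[OF ti] Xue w_def by simp
  obtain Y0 where Y0: "Y0 \<in> mcar E" "g Y0 = ?i (ue s 1)" using se(4)[OF hom_closed[OF hi us]] by blast
  obtain Y1 where Y1: "Y1 \<in> mcar E" "g Y1 = ?i (ue t xvar)" using se(4)[OF hom_closed[OF hi ut]] by blast
  define y0 where "y0 = tp E s Y0"
  define y1 where "y1 = tp E t Y1"
  have y0: "y0 \<in> UU E s" "g y0 = w" and y1: "y1 \<in> UU E t" "g y1 = msm n ?T Xp w"
    using UU_I[OF Y0(1)] UU_I[OF Y1(1)] hom_act[OF se(2) E.Eu_tp_Lam[OF si] Y0(1)]
      hom_act[OF se(2) E.Eu_tp_Lam[OF ti] Y1(1)] Y0(2) Y1(2) ws wt
    by (simp_all add: y0_def y1_def)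
  have y0C: "y0 \<in> mcar E" and y1C: "y1 \<in> mcar E" using E.UU_closed y0 y1 si ti by blast+
  have wC: "w \<in> mcar ?T" using hom_closed[OF se(2) y0C] y0(2) by simp
  have gsm: "g (msm n E p x) = msm n ?T p (g x)" if "x \<in> mcar E" for p x
    using hom_act[OF se(2) scal_in_Lam that] .
  have fsm: "f (msm n ?Z p x) = msm n E p (f x)" if "x \<in> mcar ?Z" for p x
    using hom_act[OF se(1) scal_in_Lam that] .
  define d where "d = mplus E (msm n E Xp y0) (msm n E (-1) y1)"
  have dC: "d \<in> mcar E" unfolding d_def by (intro E.add_closed E.sm_closed y0C y1C)
  have gd: "g d = mzero ?T"
  proof -
    have "g d = mplus ?T (g (msm n E Xp y0)) (g (msm n E (-1) y1))"
      unfolding d_def by (intro hom_add[OF se(2)] E.sm_closed y0C y1C)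
    also have "\<dots> = mplus ?T (msm n ?T Xp w) (msm n ?T (-1) (msm n ?T Xp w))"
      by (simp only: gsm y0C y1C y0 y1)
    also have "\<dots> = mzero ?T" by (intro T.add_neg T.sm_closed wC)
    finally show ?thesis .
  qed
  \<comment> \<open>Multiplication by x moves \<open>y0\<close> one step down, and \<open>y1\<close>
    already lies that deep since \<open>s < t\<close>.\<close>
  have dU: "d \<in> UU E (Suc s)"
  proof -
    have "msm n E Xp y0 \<in> UU E (Suc s)" using b y0 by (intro E.UU_X) auto
    moreover have "y1 \<in> UU E (Suc s)" using E.ch.U_antimono[of "Suc s" t] y1 b by auto
    ultimately show ?thesis unfolding d_def by (rule E.UU_add[OF s1 _ E.UU_sm[OF s1]])
  qed
  obtain z where z: "z \<in> UU ?Z (Suc s)" "d = f z"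
    using ses_UU[OF Z E T tfT ses n s1 dU gd] by blast
  have zC: "z \<in> mcar ?Z" using Z.UU_closed[OF s1 z(1)] .
  \<comment> \<open>A second bound on the coordinates of \<open>z\<close>: in x times the defect,
    x^2 \<open>y0\<close> lies in every submodule and \<open>x y1\<close> in the one after position
    \<open>t\<close>.\<close>
  have zt: "msm n ?Z Xp z \<in> UU ?Z (Suc t)" if "t < n"
  proof -
    have t1: "Suc t \<in> {1..n}" using that by simp
    have "msm n E Xp d = mplus E (msm n E Xp (msm n E Xp y0)) (msm n E Xp (msm n E (-1) y1))"
      unfolding d_def by (intro E.sm_add_right E.sm_closed y0C y1C)
    moreover have "msm n E Xp (msm n E Xp y0) \<in> UU E (Suc t)"
      using E.UU_subset_1[OF si] y0(1) by (intro E.UU_XX t1) blast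
    moreover have "msm n E Xp (msm n E (-1) y1) \<in> UU E (Suc t)"
      using b that y1(1) by (intro E.UU_X E.UU_sm ti) auto
    ultimately have "msm n E Xp d \<in> UU E (Suc t)" using E.UU_add[OF t1] by simp
    moreover have "g (msm n E Xp d) = mzero ?T" unfolding gsm[OF dC] gd by (rule T.sm_zero_right)
    ultimately obtain z' where z': "z' \<in> UU ?Z (Suc t)" "msm n E Xp d = f z'"
      using ses_UU[OF Z E T tfT ses n t1] by blast
    have "f (msm n ?Z Xp z) = f z'" using fsm[OF zC] z(2) z'(2) by simp
    then have "msm n ?Z Xp z = z'"
      by (rule inj_onD[OF se(3) _ Z.sm_closed[OF zC] Z.UU_closed[OF t1 z'(1)]])
    then show ?thesis using z'(1) by simp
  qed
  \<comment> \<open>There is no submodule after position \<open>n\<close>; instead \<open>y1\<close>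
    is divisible by x there, hence so is the defect.\<close>
  have zn: "\<exists>q\<in>UU ?Z 1. z = msm n ?Z Xp q" if tn: "t = n"
  proof -
    obtain l where l: "l \<in> UU E 1" "y1 = msm n E Xp l" using E.UU_n[of y1] y1(1) tn by blast
    have lC: "l \<in> mcar E" using E.UU_closed[OF one l(1)] .
    define x where "x = mplus E y0 (msm n E (-1) l)"
    have x1: "x \<in> UU E 1"
      unfolding x_def using E.UU_subset_1[OF si] y0(1) by (intro E.UU_add E.UU_sm one l(1)) blast
    have xC: "x \<in> mcar E" using E.UU_closed[OF one x1] .
    have "msm n E (-1) y1 = msm n E Xp (msm n E (-1) l)"
      unfolding l(2) using lC by (rule E.sm_swap)
    then have dx: "d = msm n E Xp x" unfolding d_def x_def
      by (simp only: E.sm_add_right E.sm_closed y0C lC)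
    then have "msm n ?T Xp (g x) = mzero ?T" using gd gsm[OF xC] by metis
    then have "g x = mzero ?T" using T.sm_eq_0D[OF hom_closed[OF se(2) xC]] by fastforce
    then obtain q where q: "q \<in> UU ?Z 1" "x = f q" using ses_UU[OF Z E T tfT ses n one x1] by blast
    have qC: "q \<in> mcar ?Z" using Z.UU_closed[OF one q(1)] .
    have "f z = f (msm n ?Z Xp q)" using fsm[OF qC] z(2) dx q(2) by simp
    then have "z = msm n ?Z Xp q" by (rule inj_onD[OF se(3) _ zC Z.sm_closed[OF qC]])
    then show ?thesis using q(1) by blast
  qed
  let ?e = "\<lambda>l. ev (fst (zs ! l)) (snd (zs ! l))"
  have "\<exists>r. z l = ue 1 r \<and> (xR (1 + ?e l s) r \<or> xR (?e l t) r)" if l: "l < length zs" for l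
  proof -
    obtain u v where uv: "zs ! l = (u, v)" by (cases "zs ! l")
    have vuv: "valid n (u, v)" using zs l uv by (metis list_all_length)
    have ncl: "\<not> crosses (s, t) (u, v)" using nc l uv st nth_mem[OF l] by metis
    obtain r where r: "z l = ue 1 r" "xR (ev u v (Suc s)) r"
      using DS_UU_coord[OF z(1) s1 one l] uv by auto
    have "\<exists>c. xR c r \<and> (1 + ev u v s \<le> c \<or> ev u v t \<le> c)"
    proof (cases "t < n")
      case True
      then have t1: "Suc t \<in> {1..n}" by simp
      obtain r' where r': "msm n ?Z Xp z l = ue 1 r'" "xR (ev u v (Suc t)) r'"
        using DS_UU_coord[OF zt[OF True] t1 one l] uv by auto
      have "r' = msm n ?Z Xp z l 1" using r'(1) by (simp add: ue_def)
      also have "\<dots> = r * xvar powi 1"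
        using l one r(1) by (simp add: DS_mact vact_scal embR_Xp) (simp add: ue_def)
      finally have "xR (ev u v (Suc t) - 1) r" using r'(2) by (simp only: xR_shift)
      then show ?thesis using noncross_arith(1)[OF vst vuv ncl True] r(2) by blast
    next
      case False
      then have tn: "t = n" using b by simp
      obtain q where q: "q \<in> UU ?Z 1" "z = msm n ?Z Xp q" using zn[OF tn] by blast
      obtain r' where r': "q l = ue 1 r'" "xR (ev u v 1) r'"
        using DS_UU_coord[OF q(1) one one l] uv by auto
      have "r = z l 1" using r(1) by (simp add: ue_def)
      also have "\<dots> = r' * xvar powi 1"
        unfolding q(2) using l one r'(1) by (simp add: DS_mact vact_scal embR_Xp) (simp add: ue_def)
      finally have "xR 1 r" using xR_mono[OF r'(2) ev_ge_0] by (simp only: xR_shift) simp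
      then show ?thesis using noncross_arith(2)[OF vst vuv ncl tn] r(2) by blast
    qed
    then have "xR (1 + ev u v s) r \<or> xR (ev u v t) r" using xR_mono by blast
    then show ?thesis using r(1) uv by auto
  qed
  then obtain c where c: "\<And>l. l < length zs \<Longrightarrow> z l = ue 1 (c l) \<and> (xR (1 + ?e l s) (c l) \<or> xR (?e l t) (c l))"
    by metis
  \<comment> \<open>Each coordinate goes entirely into one part: divided by x and placed in row
    \<open>s\<close> if its exponent allows this, otherwise placed in row \<open>t\<close>.\<close>
  define p0 where "p0 = (\<lambda>l. if l < length zs then (if xR (1 + ?e l s) (c l) then ue s (c l * xvar powi (-1)) else (\<lambda>_. 0)) else undefined)"
  define p1 where "p1 = (\<lambda>l. if l < length zs then (if xR (1 + ?e l s) (c l) then (\<lambda>_. 0) else ue t (c l)) else undefined)"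
  have zero: "(\<lambda>_. 0) \<in> mcar (SM n (zs ! l) :: 'k umod)" for l
    by (simp add: SM_mcar)
  have p0l: "p0 l \<in> mcar (SM n (zs ! l))" if l: "l < length zs" for l
  proof (cases "xR (1 + ?e l s) (c l)")
    case True
    then have "xR (?e l s) (c l * xvar powi (-1))" unfolding xR_shift by (simp add: add.commute)
    then have "ue s (c l * xvar powi (-1)) \<in> mcar (SM n (zs ! l))" by (rule ue_SM[OF si])
    then show ?thesis unfolding p0_def using True l by simp
  qed (use zero l in \<open>simp add: p0_def\<close>)
  have p1l: "p1 l \<in> mcar (SM n (zs ! l))" if l: "l < length zs" for l
  proof (cases "xR (1 + ?e l s) (c l)")
    case False
    then have "ue t (c l) \<in> mcar (SM n (zs ! l))" using c[OF l] by (intro ue_SM[OF ti]) simp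
    then show ?thesis unfolding p1_def using False l by simp
  qed (use zero l in \<open>simp add: p1_def\<close>)
  have p0C: "p0 \<in> mcar ?Z" and p1C: "p1 \<in> mcar ?Z"
    using p0l p1l by (auto simp: DS_mcar) (auto simp: p0_def p1_def)
  let ?p0 = "tp ?Z s p0" and ?p1 = "tp ?Z t p1"
  have p0C': "?p0 \<in> mcar ?Z" and p1C': "?p1 \<in> mcar ?Z"
    using p0C p1C si ti by (auto intro!: Z.act_closed)
  have zsplit: "z = mplus ?Z (msm n ?Z Xp ?p0) ?p1"
  proof (rule DS_eqI[OF zC])
    show "mplus ?Z (msm n ?Z Xp ?p0) ?p1 \<in> mcar ?Z" by (intro Z.add_closed Z.sm_closed p0C' p1C')
    fix l i assume l: "l < length zs" and i: "i \<in> {1..n}"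
    have "mplus ?Z (msm n ?Z Xp ?p0) ?p1 l i = xvar * ue 1 (p0 l s) i + ue 1 (p1 l t) i"
      using l i one si ti unfolding DS_mplus[OF l] DS_mact[OF l, where A = "scal n Xp"] vact_scal DS_tp[OF l si one] DS_tp[OF l ti one]
      by (simp add: embR_Xp)
    also have "\<dots> = z l i" using c[OF l] l by (auto simp: p0_def p1_def ue_def power_int_minus)
    finally show "z l i = mplus ?Z (msm n ?Z Xp ?p0) ?p1 l i" by simp
  qed
  define y where "y = mplus E y0 (msm n E (-1) (f ?p0))"
  have f0: "f ?p0 \<in> UU E s" and f1: "f ?p1 \<in> UU E t"
    using hom_tp_UU[OF se(1) Z n si UU_I[OF p0C]] hom_tp_UU[OF se(1) Z n ti UU_I[OF p1C]] by auto
  have f0C: "f ?p0 \<in> mcar E" and f1C: "f ?p1 \<in> mcar E" using hom_closed[OF se(1)] p0C' p1C' by auto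
  have "y \<in> UU E s" unfolding y_def by (intro E.UU_add E.UU_sm si y0(1) f0)
  moreover have "msm n E Xp y \<in> UU E t"
  proof -
    have "mplus E (msm n E Xp y0) (msm n E (-1) y1) = mplus E (msm n E Xp (f ?p0)) (f ?p1)"
    proof -
      have "f z = mplus E (f (msm n ?Z Xp ?p0)) (f ?p1)"
        by (subst zsplit) (rule hom_add[OF se(1) Z.sm_closed[OF p0C'] p1C'])
      then show ?thesis unfolding z(2)[unfolded d_def] fsm[OF p0C'] .
    qed
    then have "mplus E (msm n E Xp y0) (msm n E (-1) (msm n E Xp (f ?p0))) = mplus E y1 (f ?p1)"
      by (rule E.add_neg_swap[OF E.sm_closed[OF y0C] y1C E.sm_closed[OF f0C] f1C])
    moreover have "msm n E Xp y = mplus E (msm n E Xp y0) (msm n E (-1) (msm n E Xp (f ?p0)))"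
      unfolding y_def E.sm_swap[OF f0C, of "-1" Xp] by (rule E.sm_add_right[OF y0C E.sm_closed[OF f0C]])
    ultimately show ?thesis using E.UU_add[OF ti y1(1) f1] by simp
  qed
  moreover have "g y = w"
  proof -
    have "g y = mplus ?T (g y0) (g (msm n E (-1) (f ?p0)))"
      unfolding y_def by (intro hom_add[OF se(2)] E.sm_closed y0C f0C)
    also have "g (msm n E (-1) (f ?p0)) = mzero ?T"
      unfolding gsm[OF f0C] se(6)[OF p0C'] by (rule T.sm_zero_right)
    finally show ?thesis using y0(2) T.zero_right[OF wC] by simp
  qed
  ultimately show ?thesis unfolding st w_def by auto
qed

text \<open>The lifts of the generators are admissible images for \<open>construct\<close>. The
  resulting map is a section because this can be tested on components, where it holds generator by
  generator.\<close>

lemma ses_split: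
  fixes E :: "('k::field poly fract, 'e) lmod"
  assumes n: "2 \<le> n" and zs: "list_all (valid n) zs" and ts: "list_all (valid n) ts"
    and E: "is_lmod n E" and ses: "ses n (DS n zs) E (DS n ts) f g"
    and nc: "\<forall>p\<in>set ts. \<forall>q\<in>set zs. \<not> crosses p q"
  shows "\<exists>h. hom n (DS n ts) E h \<and> (\<forall>x\<in>mcar (DS n ts). g (h x) = x)"
proof -
  let ?Z = "DS n zs :: 'k gmod"
  let ?T = "DS n ts :: 'k gmod"
  let ?i = "dinj (map (SM n) ts :: 'k umod list)"
  note se = sesD[OF ses]
  note Z = is_lmod_DS[OF zs, where ?'a = 'k] and T = is_lmod_DS[OF ts, where ?'a = 'k]
  note tfZ = torsion_free_DS[OF zs, where ?'a = 'k] and tfT = torsion_free_DS[OF ts, where ?'a = 'k]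
  interpret T: tf_lmodule n ?T using T tfT n by unfold_locales
  interpret E: tf_lmodule n E using E ses_torsion_free[OF Z E T ses tfZ tfT] n by unfold_locales
  have one: "(1::nat) \<in> {1..n}" using n by auto
  have "\<exists>y. y \<in> UU E (fst (ts ! k)) \<and> msm n E Xp y \<in> UU E (snd (ts ! k)) \<and> g y = ?i k (ue 1 1)"
    if k: "k < length ts" for k
    by (rule ses_lift[OF n zs ts E ses k]) (use nc nth_mem[OF k] in blast)
  then obtain y where y: "\<And>k. k < length ts \<Longrightarrow> y k \<in> UU E (fst (ts ! k)) \<and> msm n E Xp (y k) \<in> UU E (snd (ts ! k)) \<and> g (y k) = ?i k (ue 1 1)"
    by metis
  have yC: "y k \<in> mcar E" if k: "k < length ts" for k
    using y[OF k] E.UU_closed[of "fst (ts ! k)" "y k"] ts k by (auto simp: list_all_length valid_def)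
  obtain h where h: "hom n ?T E h" "\<And>v i. v \<in> mcar ?T \<Longrightarrow> i \<in> {1..n} \<Longrightarrow> tp E i (h v) = mlc n E (\<lambda>k. unR (v k i)) y (length ts)"
    by (rule E.construct[OF ts, of y]) (use y in blast)+
  have "g (h v) = v" if v: "v \<in> mcar ?T" for v
  proof (rule T.eq_if_tp)
    have hv: "h v \<in> mcar E" using hom_closed[OF h(1) v] .
    then show ghv: "g (h v) \<in> mcar ?T" by (rule hom_closed[OF se(2)])
    show "v \<in> mcar ?T" by fact
    fix i assume i: "i \<in> {1..n}"
    have "tp ?T i (g (h v)) = g (tp E i (h v))"
      using hom_act[OF se(2) E.Eu_tp_Lam[OF i] hv] by simp
    also have "\<dots> = mlc n ?T (\<lambda>k. unR (v k i)) (\<lambda>k. g (y k)) (length ts)"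
      unfolding h(2)[OF v i] by (rule hom_lc[OF E T se(2) yC])
    also have "\<dots> = tp ?T i v"
    proof (rule DS_eqI)
      show "mlc n ?T (\<lambda>k. unR (v k i)) (\<lambda>k. g (y k)) (length ts) \<in> mcar ?T"
        by (intro T.lc_closed hom_closed[OF se(2)] yC)
      show "tp ?T i v \<in> mcar ?T" using v i by (intro T.act_closed) auto
      fix l j assume l: "l < length ts" and j: "j \<in> {1..n}"
      have vl: "xR 0 (v l i)" using v l SM_R[of "v l" n "ts ! l"] by (simp add: DS_mcar)
      have "mlc n ?T (\<lambda>k. unR (v k i)) (\<lambda>k. g (y k)) (length ts) l j
          = (\<Sum>k<length ts. embR (unR (v k i)) * g (y k) l j)" by (rule DS_lc[OF l j])
      also have "\<dots> = (\<Sum>k<length ts. if k = l then v l i * ue 1 1 j else 0)"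
        using y l vl by (intro sum.cong) (auto simp: dinj_def SM_def stmod_sel embR_unR)
      also have "\<dots> = tp ?T i v l j" using l by (simp add: DS_tp[OF l i one]) (simp add: ue_def)
      finally show "mlc n ?T (\<lambda>k. unR (v k i)) (\<lambda>k. g (y k)) (length ts) l j = tp ?T i v l j" .
    qed
    finally show "tp ?T i (g (h v)) = tp ?T i v" .
  qed
  then show ?thesis using h(1) by blast
qed

lemma ext1_zero_if_noncrossing:
  fixes T :: "('k::field poly fract, 't) lmod" and Z :: "('k poly fract, 'z) lmod"
  assumes n: "2 \<le> n"
    and T: "is_lmod n T" "iso n (DS n ts) T" "list_all (valid n) ts"
    and Z: "is_lmod n Z" "iso n (DS n zs) Z" "list_all (valid n) zs"
    and nc: "\<forall>p\<in>set ts. \<forall>q\<in>set zs. \<not> crosses p q"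
  shows "ext1_zero n T Z"
  unfolding ext1_zero_def
proof (intro allI impI)
  fix E :: "('k poly fract, 'z \<times> 't) lmod" and f g
  assume a: "is_lmod n E \<and> ses n Z E T f g"
  then have E: "is_lmod n E" and ses: "ses n Z E T f g" by auto
  note se = sesD[OF ses]
  obtain \<beta> \<alpha> where \<beta>: "hom n (DS n ts) T \<beta>" and \<alpha>: "hom n T (DS n ts) \<alpha>"
    and ab: "\<And>x. x \<in> mcar (DS n ts) \<Longrightarrow> \<alpha> (\<beta> x) = x" "\<And>x. x \<in> mcar T \<Longrightarrow> \<beta> (\<alpha> x) = x"
    using iso_inverse[OF is_lmod_DS[OF T(3)] T(2)] by metis
  obtain \<gamma> \<epsilon> where \<gamma>: "hom n (DS n zs) Z \<gamma>" and \<epsilon>: "hom n Z (DS n zs) \<epsilon>"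
    and cd: "\<And>x. x \<in> mcar (DS n zs) \<Longrightarrow> \<epsilon> (\<gamma> x) = x" "\<And>x. x \<in> mcar Z \<Longrightarrow> \<gamma> (\<epsilon> x) = x"
    using iso_inverse[OF is_lmod_DS[OF Z(3)] Z(2)] by metis
  have \<alpha>0: "\<alpha> (mzero T) = mzero (DS n ts)" using hom_zero[OF T(1) is_lmod_DS[OF T(3)] \<alpha>] .
  have \<beta>0: "\<beta> (mzero (DS n ts)) = mzero T" using hom_zero[OF is_lmod_DS[OF T(3)] T(1) \<beta>] .
  have "ses n (DS n zs) E (DS n ts) (\<lambda>x. f (\<gamma> x)) (\<lambda>x. \<alpha> (g x))"
    unfolding ses_def
  proof (intro conjI set_eqI iffI)
    show "hom n (DS n zs) E (\<lambda>x. f (\<gamma> x))" "hom n E (DS n ts) (\<lambda>x. \<alpha> (g x))"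
      using hom_comp[OF \<gamma> se(1)] hom_comp[OF se(2) \<alpha>] by auto
    show "inj_on (\<lambda>x. f (\<gamma> x)) (mcar (DS n zs))"
    proof (rule inj_onI)
      fix x y assume xy: "x \<in> mcar (DS n zs)" "y \<in> mcar (DS n zs)" "f (\<gamma> x) = f (\<gamma> y)"
      have "\<gamma> x = \<gamma> y"
        by (rule inj_onD[OF se(3) xy(3) hom_closed[OF \<gamma> xy(1)] hom_closed[OF \<gamma> xy(2)]])
      then have "\<epsilon> (\<gamma> x) = \<epsilon> (\<gamma> y)" by (rule arg_cong)
      then show "x = y" unfolding cd(1)[OF xy(1)] cd(1)[OF xy(2)] .
    qed
  next
    fix x assume "x \<in> (\<lambda>x. \<alpha> (g x)) ` mcar E"
    then show "x \<in> mcar (DS n ts)" using hom_closed[OF \<alpha>] hom_closed[OF se(2)] by blast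
  next
    fix x :: "nat \<Rightarrow> 'k vec" assume x: "x \<in> mcar (DS n ts)"
    obtain e where "e \<in> mcar E" "g e = \<beta> x" using se(4)[OF hom_closed[OF \<beta> x]] by blast
    then show "x \<in> (\<lambda>x. \<alpha> (g x)) ` mcar E" using ab(1)[OF x] by (intro image_eqI[of _ _ e]) auto
  next
    fix e assume "e \<in> (\<lambda>x. f (\<gamma> x)) ` mcar (DS n zs)"
    then obtain x where x: "x \<in> mcar (DS n zs)" "e = f (\<gamma> x)" by blast
    then show "e \<in> {e \<in> mcar E. \<alpha> (g e) = mzero (DS n ts)}"
      using hom_closed[OF se(1) hom_closed[OF \<gamma> x(1)]] se(6)[OF hom_closed[OF \<gamma> x(1)]] \<alpha>0 by simp
  next
    fix e assume "e \<in> {e \<in> mcar E. \<alpha> (g e) = mzero (DS n ts)}"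
    then have e: "e \<in> mcar E" "\<alpha> (g e) = mzero (DS n ts)" by auto
    then have "g e = mzero T" using ab(2)[OF hom_closed[OF se(2) e(1)]] \<beta>0 by simp
    then obtain z where z: "z \<in> mcar Z" "e = f z" using se(5)[OF e(1)] by blast
    then show "e \<in> (\<lambda>x. f (\<gamma> x)) ` mcar (DS n zs)"
      using cd(2)[OF z(1)] hom_closed[OF \<epsilon> z(1)] by (intro image_eqI[of _ _ "\<epsilon> z"]) auto
  qed
  then obtain h where h: "hom n (DS n ts) E h" "\<forall>x\<in>mcar (DS n ts). \<alpha> (g (h x)) = x"
    using ses_split[OF n Z(3) T(3) E _ nc] by blast
  have "g (h (\<alpha> x)) = x" if x: "x \<in> mcar T" for x
  proof -
    have ax: "\<alpha> x \<in> mcar (DS n ts)" using hom_closed[OF \<alpha> x] .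
    then have "g (h (\<alpha> x)) = \<beta> (\<alpha> (g (h (\<alpha> x))))"
      using ab(2)[OF hom_closed[OF se(2) hom_closed[OF h(1) ax]]] by simp
    also have "\<dots> = x" using h(2) ax ab(2)[OF x] by simp
    finally show ?thesis .
  qed
  then show "\<exists>s. hom n T E s \<and> (\<forall>x\<in>mcar T. g (s x) = x)"
    using hom_comp[OF \<alpha> h(1)] by (intro exI[of _ "\<lambda>x. h (\<alpha> x)"]) simp
qed

theorem ext1_zero_iff:
  fixes T :: "('k::field poly fract, 't) lmod" and Z :: "('k poly fract, 'z) lmod"
  assumes n: "2 \<le> n"
    and T: "is_lmod n T" "iso n (DS n ts) T" "list_all (valid n) ts"
    and Z: "is_lmod n Z" "iso n (DS n zs) Z" "list_all (valid n) zs"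
  shows "ext1_zero n T Z \<longleftrightarrow> (\<forall>p\<in>set ts. \<forall>q\<in>set zs. \<not> crosses p q)"
proof
  assume ext: "ext1_zero n T Z"
  show "\<forall>p\<in>set ts. \<forall>q\<in>set zs. \<not> crosses p q"
  proof (intro ballI notI)
    fix p q assume pq: "p \<in> set ts" "q \<in> set zs" "crosses p q"
    obtain s t u v where st: "p = (s, t)" and uv: "q = (u, v)" by (cases p, cases q)
    have "retract n (SM n p) T" "retract n (SM n q) Z"
      using retract_trans[OF retract_SM_DS[OF T(3) pq(1)] iso_retract[OF is_lmod_DS[OF T(3)] T(2)]]
        retract_trans[OF retract_SM_DS[OF Z(3) pq(2)] iso_retract[OF is_lmod_DS[OF Z(3)] Z(2)]] .
    moreover have "valid n p" "valid n q" using pq T(3) Z(3) by (simp_all add: list_all_iff)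
    ultimately show False using not_ext1_zero[OF T(1) Z(1)] pq(3) ext unfolding st uv by blast
  qed
qed (rule ext1_zero_if_noncrossing[OF assms])

section \<open>Basic objects\<close>

lemma dsum_list_iso:
  assumes Ms: "\<And>i. i < r \<Longrightarrow> is_lmod n (Ms ! i)" and len: "length Ms = r" "length Ns = r"
    and \<pi>: "\<And>i. i < r \<Longrightarrow> \<pi> i < r \<and> \<tau> (\<pi> i) = i" and \<tau>: "\<And>j. j < r \<Longrightarrow> \<tau> j < r \<and> \<pi> (\<tau> j) = j"
    and iso: "\<And>i. i < r \<Longrightarrow> iso n (Ms ! i) (Ns ! \<pi> i)"
  shows "iso n (dsum_list Ms) (dsum_list Ns)"
proof -
  have "\<exists>f g. hom n (Ms ! i) (Ns ! \<pi> i) f \<and> hom n (Ns ! \<pi> i) (Ms ! i) g \<and>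
      (\<forall>x\<in>mcar (Ms ! i). g (f x) = x) \<and> (\<forall>y\<in>mcar (Ns ! \<pi> i). f (g y) = y)" if "i < r" for i
    using iso_inverse[OF Ms[OF that] iso[OF that]] by metis
  then obtain f g where f: "\<And>i. i < r \<Longrightarrow> hom n (Ms ! i) (Ns ! \<pi> i) (f i)"
    and g: "\<And>i. i < r \<Longrightarrow> hom n (Ns ! \<pi> i) (Ms ! i) (g i)"
    and gf: "\<And>i x. i < r \<Longrightarrow> x \<in> mcar (Ms ! i) \<Longrightarrow> g i (f i x) = x"
    and fg: "\<And>i y. i < r \<Longrightarrow> y \<in> mcar (Ns ! \<pi> i) \<Longrightarrow> f i (g i y) = y"
    by metis
  have f': "hom n (Ms ! \<tau> j) (Ns ! j) (f (\<tau> j))" if "j < r" for j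
    using f[of "\<tau> j"] \<tau>[OF that] by simp
  let ?F = "\<lambda>x j. if j < r then f (\<tau> j) (x (\<tau> j)) else undefined"
  let ?G = "\<lambda>y i. if i < r then g i (y (\<pi> i)) else undefined"
  have fgj: "f (\<tau> j) (g (\<tau> j) y) = y" if "j < r" "y \<in> mcar (Ns ! j)" for j y
    using fg[of "\<tau> j" y] \<tau>[OF that(1)] that by simp
  show ?thesis
  proof (rule isoI[of n _ _ ?F ?G])
    show "hom n (dsum_list Ms) (dsum_list Ns) ?F"
      using \<tau> unfolding hom_def
      by (auto simp: dsum_list_def len hom_closed[OF f'] hom_add[OF f'] hom_act[OF f'] fun_eq_iff)
    show "hom n (dsum_list Ns) (dsum_list Ms) ?G"
      using \<pi> unfolding hom_def
      by (auto simp: dsum_list_def len hom_closed[OF g] hom_add[OF g] hom_act[OF g] fun_eq_iff)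
    show "?G (?F x) = x" if "x \<in> mcar (dsum_list Ms)" for x
      using that \<pi> gf by (auto simp: dsum_list_def len fun_eq_iff)
    show "?F (?G y) = y" if "y \<in> mcar (dsum_list Ns)" for y
      using that \<tau> fgj by (auto simp: dsum_list_def len fun_eq_iff)
  qed
qed

text \<open>\<open>Tsig\<close> enumerates its pairs in sorted order, whereas a basic object
  supplies them in an arbitrary one.\<close>

lemma DS_perm:
  assumes xs: "distinct xs" "distinct ys" "set xs = set ys" "list_all (valid n) xs"
  shows "iso n (DS n xs :: 'k::field gmod) (DS n ys)"
proof -
  have len: "length ys = length xs" using xs(1-3) by (metis distinct_card)
  have "\<forall>i<length xs. \<exists>j<length xs. ys ! j = xs ! i"
    using xs(3) len by (metis in_set_conv_nth)
  then obtain \<pi> where \<pi>: "\<And>i. i < length xs \<Longrightarrow> \<pi> i < length xs \<and> ys ! \<pi> i = xs ! i" by metis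
  have "\<forall>j<length xs. \<exists>i<length xs. xs ! i = ys ! j"
    using xs(3) len by (metis in_set_conv_nth)
  then obtain \<tau> where \<tau>: "\<And>j. j < length xs \<Longrightarrow> \<tau> j < length xs \<and> xs ! \<tau> j = ys ! j" by metis
  show ?thesis unfolding DS_def
  proof (rule dsum_list_iso[where r = "length xs" and \<pi> = \<pi> and \<tau> = \<tau>])
    show "\<pi> i < length xs \<and> \<tau> (\<pi> i) = i" if "i < length xs" for i
      using \<pi>[OF that] \<tau>[of "\<pi> i"] nth_eq_iff_index_eq[OF xs(1), of "\<tau> (\<pi> i)" i] that by simp
    show "\<tau> j < length xs \<and> \<pi> (\<tau> j) = j" if "j < length xs" for j
      using \<tau>[OF that] \<pi>[of "\<tau> j"] nth_eq_iff_index_eq[OF xs(2), of "\<pi> (\<tau> j)" j] that len by simp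
    show "iso n (map (SM n) xs ! i :: 'k umod) (map (SM n) ys ! \<pi> i)" if "i < length xs" for i
      using \<pi>[OF that] that len iso_refl by simp
  qed (use xs(4) len in \<open>auto simp: list_all_length is_lmod_SM\<close>)
qed

lemma DS_single: "valid n p \<Longrightarrow> iso n (DS n [p]) (SM n p :: 'k::field umod)"
proof (rule isoI)
  assume p: "valid n p"
  let ?Ms = "[SM n p :: 'k umod]"
  show "hom n (DS n [p]) (SM n p :: 'k umod) (\<lambda>v. v 0)"
    using hom_dproj[of 0 ?Ms n] by (simp add: DS_def)
  show "hom n (SM n p) (DS n [p]) (dinj ?Ms 0)"
    using hom_dinj[of ?Ms n 0] is_lmod_SM[OF p] by (simp add: DS_def)
  show "dinj ?Ms 0 (x 0) = x" if "x \<in> mcar (DS n [p])" for x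
    using that by (auto simp: DS_mcar dinj_def fun_eq_iff)
qed simp

lemma CM_SM: "valid n p \<Longrightarrow> CM n (SM n p :: 'k::field umod)"
proof -
  assume p: "valid n p"
  then have l: "list_all (valid n) [p]" and n: "1 \<le> n" by (auto simp: valid_def)
  have r: "retract n (SM n p :: 'k umod) (DS n [p])" using retract_SM_DS[OF l, of p] by simp
  have C: "CM n (DS n [p] :: 'k gmod)" using CM_DS[OF l n] .
  show ?thesis
    using retract_torsion_free[OF is_lmod_SM[OF p] is_lmod_DS[OF l] r]
      retract_fg[OF is_lmod_SM[OF p] is_lmod_DS[OF l] r] C is_lmod_SM[OF p] unfolding CM_iff by blast
qed

lemma SM_nonzero: "valid n p \<Longrightarrow> mcar (SM n p :: 'k::field umod) \<noteq> {mzero (SM n p)}"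
proof
  assume p: "valid n p" and z: "mcar (SM n p :: 'k umod) = {mzero (SM n p)}"
  have "(ue 1 1 :: 'k vec) \<in> mcar (SM n p)"
    using p by (intro ue_SM) (auto simp: ev_def valid_def)
  then have "(ue 1 1 :: 'k vec) = (\<lambda>i. 0)" unfolding z by (simp add: SM_def stmod_sel)
  then have "(ue 1 1 :: 'k vec) 1 = 0" by simp
  then show False by (simp add: ue_def)
qed

lemma hom_dsum2_inr: "is_lmod n M \<Longrightarrow> hom n N (dsum2 M N) (\<lambda>x. (mzero M, x))"
  by (simp add: hom_def dsum2_sel is_lmod_rules act_mzero)

text \<open>Two nonzero submodules of a rank one module meet: both contain a nonzero multiple of the
  first unit vector.\<close>

lemma indec_SM:
  assumes p: "valid n p"
  shows "indec n (SM n p :: 'k::field umod)"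
  unfolding indec_def
proof (intro conjI allI impI)
  let ?S = "SM n p :: 'k umod"
  show S: "is_lmod n ?S" using is_lmod_SM[OF p] .
  show "mcar ?S \<noteq> {mzero ?S}" using SM_nonzero[OF p] .
  fix Y1 Y2 :: "'k umod"
  assume "is_lmod n Y1 \<and> is_lmod n Y2 \<and> iso n (dsum2 Y1 Y2) ?S"
  then obtain f where Y: "is_lmod n Y1" "is_lmod n Y2" and f: "hom n (dsum2 Y1 Y2) ?S f"
    and inj: "inj_on f (mcar (dsum2 Y1 Y2))"
    unfolding iso_def bij_betw_def by blast
  have one: "(1::nat) \<in> {1..n}" using p by (auto simp: valid_def)
  note f1 = hom_comp[OF hom_dsum2_inl[OF Y(2), of Y1] f] and f2 = hom_comp[OF hom_dsum2_inr[OF Y(1), of Y2] f]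
  have f0: "f (mzero Y1, mzero Y2) = (\<lambda>i. 0)"
    using hom_zero[OF is_lmod_dsum2[OF Y] S f] by (simp add: dsum2_sel SM_def stmod_sel)
  have Ez: "(Eu 1 i 1 :: 'k kmat) \<in> Lam n" if "i \<in> {1..n}" for i
    using that p by (intro Eu_in_Lam) (auto intro: xR_mono[OF xR_1] simp: cexp_def valid_def)
  have nz: "\<exists>x\<in>mcar Y. \<exists>a. a \<noteq> 0 \<and> h x = ue 1 (embR a)"
    if hY: "is_lmod n Y" "hom n Y ?S h" and y: "y \<in> mcar Y" "h y \<noteq> (\<lambda>i. 0)" for Y :: "'k umod" and h y
  proof -
    have hy: "h y \<in> mcar ?S" using hom_closed[OF hY(2) y(1)] .
    obtain i where i: "h y i \<noteq> 0" using y(2) by auto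
    then have ii: "i \<in> {1..n}" using hy by (auto simp: SM_mcar)
    obtain a where a: "h y i = embR a" using SM_R[OF hy, of i] by (auto simp: xR_0_iff)
    have "h (tp Y i y) = vact n (Eu 1 i 1) (h y)"
      using hom_act[OF hY(2) Ez[OF ii] y(1)] by (simp add: SM_mact)
    also have "\<dots> = ue 1 (embR a)" using ii one a by (auto simp: vact_Eu ue_def fun_eq_iff)
    finally show ?thesis using is_lmod_rules(5)[OF hY(1) Ez[OF ii] y(1)] a i by (intro bexI[of _ "tp Y i y"] exI[of _ a]) auto
  qed
  have sc: "h (msm n Y b x) = ue 1 (embR (a * b))"
    if "hom n Y ?S h" "x \<in> mcar Y" "h x = ue 1 (embR a)" for Y :: "'k umod" and h x a b
    using hom_act[OF that(1) scal_in_Lam that(2), of b] that(3) one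
    by (auto simp: SM_mact vact_scal ue_def fun_eq_iff embR_mult)
  show "mcar Y1 = {mzero Y1} \<or> mcar Y2 = {mzero Y2}"
  proof (rule ccontr)
    assume "\<not> ?thesis"
    then obtain y1 y2 where y: "y1 \<in> mcar Y1" "y1 \<noteq> mzero Y1" "y2 \<in> mcar Y2" "y2 \<noteq> mzero Y2"
      using is_lmod_rules(1)[OF Y(1)] is_lmod_rules(1)[OF Y(2)] by blast
    have z: "mzero Y1 \<in> mcar Y1" "mzero Y2 \<in> mcar Y2" using Y is_lmod_rules(1) by auto
    have "f (y1, mzero Y2) \<noteq> (\<lambda>i. 0)"
      using inj_onD[OF inj, of "(y1, mzero Y2)" "(mzero Y1, mzero Y2)"] y z f0 by (auto simp: dsum2_sel)
    then obtain x1 a where x1: "x1 \<in> mcar Y1" "a \<noteq> 0" "f (x1, mzero Y2) = ue 1 (embR a)"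
      using nz[OF Y(1) f1 y(1)] by blast
    have "f (mzero Y1, y2) \<noteq> (\<lambda>i. 0)"
      using inj_onD[OF inj, of "(mzero Y1, y2)" "(mzero Y1, mzero Y2)"] y z f0 by (auto simp: dsum2_sel)
    then obtain x2 b where x2: "x2 \<in> mcar Y2" "b \<noteq> 0" "f (mzero Y1, x2) = ue 1 (embR b)"
      using nz[OF Y(2) f2 y(3)] by blast
    \<comment> \<open>Scaling each element by the coefficient of the other gives both the same
      image, against injectivity.\<close>
    have c: "msm n Y1 b x1 \<in> mcar Y1" "msm n Y2 a x2 \<in> mcar Y2"
      using is_lmod_rules(5)[OF Y(1) scal_in_Lam x1(1)] is_lmod_rules(5)[OF Y(2) scal_in_Lam x2(1)] by auto
    have e: "f (msm n Y1 b x1, mzero Y2) = ue 1 (embR (a * b))" "f (mzero Y1, msm n Y2 a x2) = ue 1 (embR (a * b))"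
      using sc[OF f1 x1(1,3), of b] sc[OF f2 x2(1,3), of a] by (simp_all add: mult.commute)
    then have "(msm n Y1 b x1, mzero Y2) = (mzero Y1, msm n Y2 a x2)"
      using inj_onD[OF inj, of "(msm n Y1 b x1, mzero Y2)" "(mzero Y1, msm n Y2 a x2)"] c z by (simp add: dsum2_sel)
    then have "(ue 1 (embR (a * b)) :: 'k vec) = (\<lambda>i. 0)" using e(1) f0 by simp
    then have "(ue 1 (embR (a * b)) :: 'k vec) 1 = 0" by simp
    then show False using x1(2) x2(2) by (simp add: ue_def)
  qed
qed

lemma iso_SM_eq: "valid n p \<Longrightarrow> valid n q \<Longrightarrow> iso n (SM n p :: 'k::field umod) (SM n q) \<Longrightarrow> p = q"
  using vis_SM vis_retract iso_retract is_lmod_SM by metis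

lemma basic_DS:
  assumes ts: "list_all (valid n) ts" "distinct ts"
  shows "basic n (DS n ts :: 'k::field gmod)"
  unfolding basic_def
proof (intro exI conjI ballI allI impI)
  let ?Xs = "map (SM n) ts :: 'k umod list"
  show "iso n (dsum_list ?Xs) (DS n ts)" unfolding DS_def by (rule iso_refl)
  show "indec n X" if X: "X \<in> set ?Xs" for X
  proof -
    obtain p where "p \<in> set ts" "X = SM n p" using X unfolding set_map by blast
    then show ?thesis using indec_SM[of n p] ts(1) by (simp add: list_all_iff)
  qed
  show "\<not> iso n (?Xs ! i) (?Xs ! j)" if "i < length ?Xs" "j < length ?Xs" "i \<noteq> j" for i j
    using iso_SM_eq[of n "ts ! i" "ts ! j"] ts that by (auto simp: list_all_length nth_eq_iff_index_eq)
qed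

text \<open>The decomposition list is nonempty since \<open>X\<close> is nonzero, and any of its
  pairs splits off. The complement is carried by a subset of \<open>X\<close>, so the two parts have
  the carrier type over which \<open>indec\<close> quantifies, and the complement must
  vanish.\<close>

lemma indec_CM_SM:
  fixes X :: "'k::field umod"
  assumes X: "indec n X" "CM n X" and n: "2 \<le> n"
  shows "\<exists>p. valid n p \<and> iso n (SM n p) X"
proof -
  have XL: "is_lmod n X" using X(1) by (simp add: indec_def)
  obtain ts where ts: "list_all (valid n) ts" "iso n (DS n ts) X" using CM_decompose[OF X(2) n] .
  have "ts \<noteq> []"
  proof
    assume e: "ts = []"
    obtain f where f: "hom n (DS n ts) X f" "bij_betw f (mcar (DS n ts)) (mcar X)"
      using ts(2) by (auto simp: iso_def)
    have "mcar (DS n ts :: 'k gmod) = {\<lambda>_. undefined}"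
      unfolding e by (auto simp: DS_mcar)
    then have "mcar X = {f (\<lambda>_. undefined)}" using f(2) unfolding bij_betw_def by auto
    then have "mcar X = {mzero X}" using is_lmod_rules(1)[OF XL] by auto
    then show False using X(1) by (simp add: indec_def)
  qed
  then obtain p where p: "p \<in> set ts" by (cases ts) auto
  have vp: "valid n p" using ts(1) p by (simp add: list_all_iff)
  have "retract n (SM n p) X"
    using retract_trans[OF retract_SM_DS[OF ts(1) p] iso_retract[OF is_lmod_DS[OF ts(1)] ts(2)]] .
  then obtain f g where fg: "hom n (SM n p) X f" "hom n X (SM n p) g" "\<forall>x\<in>mcar (SM n p). g (f x) = x"
    unfolding retract_def by blast
  define Y where "Y = X\<lparr>mcar := {t \<in> mcar X. g t = mzero (SM n p)}\<rparr>"
  have Y: "is_lmod n Y" "iso n (dsum2 (SM n p) Y) X"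
    unfolding Y_def using split_retract[OF is_lmod_SM[OF vp] XL fg(1,2)] fg(3) by blast+
  have "mcar Y = {mzero Y}"
    using X(1) Y is_lmod_SM[OF vp] SM_nonzero[OF vp, where ?'k = 'k] unfolding indec_def by blast
  then have "iso n (SM n p) (dsum2 (SM n p :: 'k umod) Y)"
    by (intro isoI[OF hom_dsum2_inl[OF Y(1)] hom_dsum2_fst]) (auto simp: dsum2_sel)
  then show ?thesis using iso_trans[OF _ Y(2)] vp by blast
qed

text \<open>The indecomposable summands are retracts of \<open>T\<close>, hence Cohen--Macaulay,
  hence of rank one. Pairwise non-isomorphism becomes distinctness of the pairs.\<close>

lemma basic_CM_DS:
  fixes T :: "('k::field poly fract, 'a) lmod"
  assumes b: "basic n T" and T: "CM n T" and n: "2 \<le> n"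
  shows "\<exists>ps. list_all (valid n) ps \<and> distinct ps \<and> iso n (DS n ps) T"
proof -
  obtain Xs :: "'k umod list" where ind: "\<And>X. X \<in> set Xs \<Longrightarrow> indec n X"
    and ni: "\<And>i j. i < length Xs \<Longrightarrow> j < length Xs \<Longrightarrow> i \<noteq> j \<Longrightarrow> \<not> iso n (Xs ! i) (Xs ! j)"
    and iT: "iso n (dsum_list Xs) T"
    using b unfolding basic_def by blast
  have XL: "\<And>X. X \<in> set Xs \<Longrightarrow> is_lmod n X" using ind by (simp add: indec_def)
  have TL: "is_lmod n T" and Ttf: "torsion_free n T" and Tfg: "fg n T" using T by (simp_all add: CM_iff)
  have CMX: "CM n (Xs ! i)" if i: "i < length Xs" for i
  proof -
    have "retract n (Xs ! i) (dsum_list Xs)"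
      unfolding retract_def using hom_dinj[of Xs n i, OF XL i] hom_dproj[OF i, of n]
      by (intro exI[of _ "dinj Xs i"] exI[of _ "\<lambda>v. v i"]) simp
    then have r: "retract n (Xs ! i) T"
      using retract_trans iso_retract[OF is_lmod_dsum_list[OF XL] iT] by blast
    show ?thesis unfolding CM_iff
      using XL[OF nth_mem[OF i]] retract_torsion_free[OF _ TL r Ttf] retract_fg[OF _ TL r Tfg] by blast
  qed
  have "\<forall>i<length Xs. \<exists>p. valid n p \<and> iso n (SM n p) (Xs ! i)"
    using indec_CM_SM[OF ind CMX n] by simp
  then obtain q where q: "\<And>i. i < length Xs \<Longrightarrow> valid n (q i) \<and> iso n (SM n (q i)) (Xs ! i)" by metis
  let ?ps = "map q [0..<length Xs]"
  have "list_all (valid n) ?ps" using q by (simp add: list_all_length)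
  moreover have "distinct ?ps"
  proof -
    have "i = j" if ij: "i < length Xs" "j < length Xs" "q i = q j" for i j
    proof (rule ccontr)
      assume "i \<noteq> j"
      have "iso n (Xs ! i) (SM n (q i))"
        using iso_sym[OF is_lmod_SM] q[OF ij(1)] by blast
      then have "iso n (Xs ! i) (Xs ! j)" using iso_trans q[OF ij(2)] ij(3) by metis
      then show False using ni[OF ij(1,2) \<open>i \<noteq> j\<close>] by blast
    qed
    then show ?thesis by (auto simp: distinct_map inj_on_def)
  qed
  moreover have "iso n (DS n ?ps) (dsum_list Xs)"
    unfolding DS_def
    by (rule dsum_list_iso[where r = "length Xs" and \<pi> = "\<lambda>i. i" and \<tau> = "\<lambda>i. i"])
      (use q in \<open>auto simp: is_lmod_SM\<close>)
  ultimately show ?thesis using iso_trans[OF _ iT] by blast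
qed

section \<open>Cluster tilting objects and triangulations\<close>

lemma crosses_sym: "crosses p q \<longleftrightarrow> crosses q p"
  by (auto simp: crosses_def)

text \<open>Testing against the single modules \<open>SM n p\<close> extracts the condition on
  pairs; for the converse, any test module is decomposed. The two Ext conditions agree because
  crossing is symmetric.\<close>

lemma cluster_tilting_iff:
  fixes T :: "('k::field poly fract, 'a) lmod"
  assumes n: "2 \<le> n" and T: "CM n T" "iso n (DS n ts) T" and ts: "list_all (valid n) ts"
  shows "cluster_tilting n T \<longleftrightarrow> (\<forall>p. valid n p \<longrightarrow> (p \<in> set ts \<longleftrightarrow> (\<forall>q\<in>set ts. \<not> crosses p q)))"
proof
  have TL: "is_lmod n T" using T(1) by (simp add: CM_iff)
  show "\<forall>p. valid n p \<longrightarrow> (p \<in> set ts \<longleftrightarrow> (\<forall>q\<in>set ts. \<not> crosses p q))" if ct: "cluster_tilting n T"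
  proof (intro allI impI)
    fix p assume p: "valid n p"
    then have l: "list_all (valid n) [p]" by simp
    have "in_add n T (SM n p :: 'k umod) \<longleftrightarrow> ext1_zero n T (SM n p :: 'k umod)"
      using ct CM_SM[OF p, where ?'k = 'k] unfolding cluster_tilting_def by blast
    then show "p \<in> set ts \<longleftrightarrow> (\<forall>q\<in>set ts. \<not> crosses p q)"
      unfolding in_add_iff[OF TL T(2) ts is_lmod_SM[OF p] DS_single[OF p] l]
        ext1_zero_iff[OF n TL T(2) ts is_lmod_SM[OF p] DS_single[OF p] l]
      using crosses_sym by auto
  qed
  show "cluster_tilting n T" if max: "\<forall>p. valid n p \<longrightarrow> (p \<in> set ts \<longleftrightarrow> (\<forall>q\<in>set ts. \<not> crosses p q))"
    unfolding cluster_tilting_def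
  proof (rule conjI[OF T(1)], rule allI, rule impI)
    fix Z :: "'k umod" assume Z: "CM n Z"
    then have ZL: "is_lmod n Z" by (simp add: CM_iff)
    obtain zs where zs: "list_all (valid n) zs" "iso n (DS n zs) Z" using CM_decompose[OF Z n] .
    have "set zs \<subseteq> set ts \<longleftrightarrow> (\<forall>p\<in>set zs. \<forall>q\<in>set ts. \<not> crosses p q)"
      using zs(1) max by (auto simp: list_all_iff subset_iff)
    then show "(in_add n T Z \<longleftrightarrow> ext1_zero n T Z) \<and> (in_add n T Z \<longleftrightarrow> ext1_zero n Z T)"
      unfolding in_add_iff[OF TL T(2) ts ZL zs(2,1)] ext1_zero_iff[OF n TL T(2) ts ZL zs(2,1)]
        ext1_zero_iff[OF n ZL zs(2,1) TL T(2) ts]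
      using crosses_sym by blast
  qed
qed

lemma Tsig_DS: "Tsig n \<sigma> = DS n (sorted_list_of_set (sides n \<union> \<sigma>))"
  by (simp add: Tsig_def DS_def SM_def[abs_def] case_prod_beta')

lemma valid_iff: "3 \<le> n \<Longrightarrow> valid n p \<longleftrightarrow> p \<in> sides n \<or> p \<in> diagonals n"
  by (cases p) (auto simp: valid_def sides_def diagonals_def)

lemma sides_diagonals: "3 \<le> n \<Longrightarrow> sides n \<inter> diagonals n = {}"
  by (auto simp: sides_def diagonals_def)

lemma finite_valid: "finite {p. valid n p}"
  by (rule finite_subset[of _ "{..n} \<times> {..n}"]) (auto simp: valid_def)

lemma sides_not_cross: "p \<in> sides n \<Longrightarrow> valid n q \<Longrightarrow> \<not> crosses p q"
  by (auto simp: sides_def valid_def crosses_def)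

lemma triangulation_list:
  assumes n: "3 \<le> n" and \<sigma>: "\<sigma> \<subseteq> diagonals n"
  shows "set (sorted_list_of_set (sides n \<union> \<sigma>)) = sides n \<union> \<sigma>"
    "list_all (valid n) (sorted_list_of_set (sides n \<union> \<sigma>))"
proof -
  have "sides n \<union> \<sigma> \<subseteq> {p. valid n p}" using valid_iff[OF n] \<sigma> by auto
  moreover from this have "finite (sides n \<union> \<sigma>)" using finite_valid finite_subset by blast
  ultimately show "set (sorted_list_of_set (sides n \<union> \<sigma>)) = sides n \<union> \<sigma>"
    "list_all (valid n) (sorted_list_of_set (sides n \<union> \<sigma>))"
    by (auto simp: list_all_iff)
qed

text \<open>Sides cross nothing, so adding them does not change which diagonals are excluded, and
  maximality takes the form of the cluster tilting condition.\<close>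

lemma triangulation_iff:
  assumes n: "3 \<le> n" and \<sigma>: "\<sigma> \<subseteq> diagonals n"
  shows "triangulation n \<sigma> \<longleftrightarrow> (\<forall>p. valid n p \<longrightarrow> (p \<in> sides n \<union> \<sigma> \<longleftrightarrow> (\<forall>q\<in>sides n \<union> \<sigma>. \<not> crosses p q)))"
proof -
  have v: "valid n q" if "q \<in> sides n \<union> \<sigma>" for q using valid_iff[OF n] \<sigma> that by auto
  have sc: "\<not> crosses p q" "\<not> crosses q p" if "p \<in> sides n" "valid n q" for p q
    using sides_not_cross[OF that] crosses_sym by auto
  have d: "d \<notin> sides n" if "d \<in> diagonals n" for d using sides_diagonals[OF n] that by auto
  show ?thesis
  proof
    assume t: "triangulation n \<sigma>"
    show "\<forall>p. valid n p \<longrightarrow> (p \<in> sides n \<union> \<sigma> \<longleftrightarrow> (\<forall>q\<in>sides n \<union> \<sigma>. \<not> crosses p q))"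
    proof (intro allI impI iffI ballI)
      fix p q assume "valid n p" "p \<in> sides n \<union> \<sigma>" "q \<in> sides n \<union> \<sigma>"
      then show "\<not> crosses p q" using t sc v unfolding triangulation_def by blast
    next
      fix p assume "valid n p" "\<forall>q\<in>sides n \<union> \<sigma>. \<not> crosses p q"
      then show "p \<in> sides n \<union> \<sigma>" using t valid_iff[OF n] unfolding triangulation_def by blast
    qed
  next
    assume m: "\<forall>p. valid n p \<longrightarrow> (p \<in> sides n \<union> \<sigma> \<longleftrightarrow> (\<forall>q\<in>sides n \<union> \<sigma>. \<not> crosses p q))"
    show "triangulation n \<sigma>"
      unfolding triangulation_def
    proof (intro conjI ballI)
      show "\<sigma> \<subseteq> diagonals n" by fact
      show "\<not> crosses d e" if "d \<in> \<sigma>" "e \<in> \<sigma>" for d e using m v that by blast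
      show "\<exists>e\<in>\<sigma>. crosses d e" if "d \<in> diagonals n - \<sigma>" for d
        using m d sc valid_iff[OF n, of d] that by blast
    qed
  qed
qed

text \<open>The bijection is split into well-definedness, injectivity up to isomorphism, and
  surjectivity; in the last part \<open>T\<close> may live on any carrier type.\<close>

theorem theorem3p13:
  fixes n :: nat
  assumes "n \<ge> 3"
  shows "(\<forall>\<sigma>. triangulation n \<sigma> \<longrightarrow>
            basic n (Tsig n \<sigma> :: ('k::field poly fract, nat \<Rightarrow> nat \<Rightarrow> 'k poly fract) lmod) \<and>
            cluster_tilting n (Tsig n \<sigma> :: ('k poly fract, nat \<Rightarrow> nat \<Rightarrow> 'k poly fract) lmod)) \<and>
         (\<forall>\<sigma> \<sigma>'. triangulation n \<sigma> \<and> triangulation n \<sigma>' \<and>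
            iso n (Tsig n \<sigma> :: ('k poly fract, nat \<Rightarrow> nat \<Rightarrow> 'k poly fract) lmod) (Tsig n \<sigma>') \<longrightarrow> \<sigma> = \<sigma>') \<and>
         (\<forall>T :: ('k poly fract, 'a) lmod. basic n T \<and> cluster_tilting n T \<longrightarrow>
            (\<exists>\<sigma>. triangulation n \<sigma> \<and> iso n (Tsig n \<sigma> :: ('k poly fract, nat \<Rightarrow> nat \<Rightarrow> 'k poly fract) lmod) T))"
proof -
  have n: "2 \<le> n" "1 \<le> n" using assms by auto
  let ?L = "\<lambda>\<sigma>. sorted_list_of_set (sides n \<union> \<sigma>)"
  have sub: "\<sigma> \<subseteq> diagonals n" if "triangulation n \<sigma>" for \<sigma> using that by (simp add: triangulation_def)
  show ?thesis
  proof (intro conjI allI impI)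
    fix \<sigma> assume t: "triangulation n \<sigma>"
    note L = triangulation_list[OF assms sub[OF t]]
    show "basic n (Tsig n \<sigma> :: 'k gmod)"
      unfolding Tsig_DS using L(2) by (rule basic_DS) simp
    show "cluster_tilting n (Tsig n \<sigma> :: 'k gmod)"
      unfolding Tsig_DS cluster_tilting_iff[OF n(1) CM_DS[OF L(2) n(2)] iso_refl L(2)] L(1)
      using t triangulation_iff[OF assms sub[OF t]] by blast
  next
    fix \<sigma> \<sigma>'
    assume a: "triangulation n \<sigma> \<and> triangulation n \<sigma>' \<and>
            iso n (Tsig n \<sigma> :: 'k gmod) (Tsig n \<sigma>')"
    then have t: "triangulation n \<sigma>" "triangulation n \<sigma>'"
      and i: "iso n (DS n (?L \<sigma>) :: 'k gmod) (DS n (?L \<sigma>'))"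
      by (simp_all add: Tsig_DS)
    note L = triangulation_list[OF assms sub[OF t(1)]] and L' = triangulation_list[OF assms sub[OF t(2)]]
    \<comment> \<open>Visibility is invariant under isomorphism, so the set of pairs can be read off
      from the module.\<close>
    have "p \<in> set (?L \<sigma>) \<longleftrightarrow> p \<in> set (?L \<sigma>')" if "valid n p" for p
      using vis_DS[OF L(2) that, where ?'k = 'k] vis_DS[OF L'(2) that, where ?'k = 'k]
        vis_mono[OF iso_retract[OF is_lmod_DS[OF L(2)] i], of p] vis_mono[OF iso_retract'[OF is_lmod_DS[OF L(2)] i], of p]
      by blast
    then have "sides n \<union> \<sigma> = sides n \<union> \<sigma>'"
      using L L' unfolding list_all_iff L(1) L'(1) by blast
    then show "\<sigma> = \<sigma>'" using sub[OF t(1)] sub[OF t(2)] sides_diagonals[OF assms] by blast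
  next
    fix T :: "('k poly fract, 'a) lmod" assume T: "basic n T \<and> cluster_tilting n T"
    then have C: "CM n T" by (simp add: cluster_tilting_def)
    obtain ps where ps: "list_all (valid n) ps" "distinct ps" "iso n (DS n ps) T"
      using basic_CM_DS[OF _ C n(1)] T by blast
    define \<sigma> where "\<sigma> = set ps \<inter> diagonals n"
    have max: "\<forall>p. valid n p \<longrightarrow> (p \<in> set ps \<longleftrightarrow> (\<forall>q\<in>set ps. \<not> crosses p q))"
      using T cluster_tilting_iff[OF n(1) C ps(3,1)] by blast
    \<comment> \<open>A side crosses no pair, so the cluster tilting condition itself puts it into
      the family.\<close>
    have "p \<in> set ps" if "p \<in> sides n" for p
      using max sides_not_cross[OF that] valid_iff[OF assms, of p] that ps(1) unfolding list_all_iff by blast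
    then have set: "set ps = sides n \<union> \<sigma>"
      using ps(1) valid_iff[OF assms] unfolding \<sigma>_def list_all_iff by blast
    have \<sigma>: "\<sigma> \<subseteq> diagonals n" by (simp add: \<sigma>_def)
    note L = triangulation_list[OF assms \<sigma>]
    have "triangulation n \<sigma>" using max triangulation_iff[OF assms \<sigma>] unfolding set by blast
    moreover have "iso n (DS n (?L \<sigma>) :: 'k gmod) (DS n ps)"
      by (rule DS_perm[OF _ ps(2) _ L(2)]) (use L(1) set in auto)
    ultimately show "\<exists>\<sigma>. triangulation n \<sigma> \<and> iso n (Tsig n \<sigma> :: 'k gmod) T"
      unfolding Tsig_DS using iso_trans[OF _ ps(3)] by blast
  qed
qed

end
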